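(* Let $L>0$, $\beta>0$, $k\in\frac{2\pi}L\mathbb Z$, $\zeta_1,\zeta_2\in\mathbb R\setminus\{0\}$, and $\alpha,\gamma\in\mathbb R$, $\delta\in\mathbb R\setminus\{0\}$ such that $\alpha\gamma\ne\delta^2$. Let $$C_-=-(\alpha\zeta_1^2+\gamma\zeta_2^2)-\sqrt{(\alpha\zeta_1^2+\gamma\zeta_2^2)^2-4\zeta_1^2\zeta_2^2(\alpha\gamma-\delta^2)}.$$ If $$\beta\Big(\frac{2\pi}L\Big)^2+C_->4\beta k^2,$$ then the constant function $u_\xi=(\zeta_1,\zeta_2)^T$ is an orbitally stable $G_{\mu_\xi}$-relative equilibrium of the system $$i\partial_tu_1+\beta\Delta u_1+2\beta ik\nabla u_1+(\alpha|u_1|^2+\delta|u_2|^2)u_1-\beta k^2u_1=0,$$ $$i\partial_tu_2+\beta\Delta u_2-2\beta ik\nabla u_2+(\delta|u_1|^2+\gamma|u_2|^2)u_2-\beta k^2u_2=0$$ on the one-dimensional torus $\mathbb T$ of length $L$.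
   Context: The phase space is $E=H^1(\mathbb T,\mathbb C^2)$, on which the system is globally well posed; $v(t)$ denotes the solution with initial datum $v$. The group $G=\mathbb R\times\mathbb R$ acts by $\Phi_{\gamma_1,\gamma_2}(u)=(e^{-i\gamma_1}u_1,e^{-i\gamma_2}u_2)^T$, with momentum map $F=(F_1,F_2)$, $F_j(u)=\frac12\int_0^L|u_j|^2\,dx$. Here $\xi=(\xi_1,\xi_2)$ with $\xi_1=\beta k^2-(\alpha\zeta_1^2+\delta\zeta_2^2)$, $\xi_2=\beta k^2-(\delta\zeta_1^2+\gamma\zeta_2^2)$, $\mu_\xi=F(u_\xi)$, and $G_{\mu_\xi}$ is the stabilizer of $\mu_\xi$ under the coadjoint action; since $G$ is commutative $G_{\mu_\xi}=G$. Write $\mathcal O_u=\{\Phi_g(u):g\in G_{\mu_\xi}\}$ and $\mathrm d$ for the distance induced by the $H^1$ norm (with $\mathrm d(v,\mathcal O)=\inf_{w\in\mathcal O}\mathrm d(v,w)$). A point $u\in E$ is a $G_{\mu_\xi}$-relative equilibrium if the solution with initial datum $u$ stays in $\mathcal O_u$ for all $t\in\mathbb R$; it is orbitally stable if for every $\varepsilon>0$ there is $\eta>0$ such that for all $v\in E$ with $\mathrm d(v,u)\le\eta$ one has $\mathrm d(v(t),\mathcal O_u)\le\varepsilon$ for all $t\in\mathbb R$. *)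

theory Defs
  imports "HOL-Analysis.Analysis"
begin

section \<open>The Sobolev space on the torus of length \<open>L\<close>\<close>

text \<open>
  Functions on the torus are \<open>L\<close>-periodic functions on the real line.  A smooth complex-valued
  test function is given together with all its derivatives: \<open>\<phi> 0\<close> is the function itself and
  \<open>\<phi> n\<close> its \<open>n\<close>-th derivative.
\<close>

definition torus_test :: "real \<Rightarrow> (nat \<Rightarrow> real \<Rightarrow> complex) \<Rightarrow> bool" where
  "torus_test L \<phi> \<longleftrightarrow>
     (\<forall>x. \<phi> 0 (x + L) = \<phi> 0 x) \<and>
     (\<forall>n x. (\<phi> n has_vector_derivative \<phi> (Suc n) x) (at x))"

text \<open>The bilinear pairing of functions with test functions (no complex conjugation).\<close>

definition pairing :: "real \<Rightarrow> (real \<Rightarrow> complex) \<Rightarrow> (real \<Rightarrow> complex) \<Rightarrow> complex" where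
  "pairing L f g = (LINT x:{0..L}|lborel. f x * g x)"

definition square_integrable :: "real \<Rightarrow> (real \<Rightarrow> complex) \<Rightarrow> bool" where
  "square_integrable L g \<longleftrightarrow>
     set_borel_measurable lborel {0..L} g \<and>
     set_integrable lborel {0..L} (\<lambda>x. (cmod (g x))\<^sup>2)"

definition L2_norm_sq :: "real \<Rightarrow> (real \<Rightarrow> complex) \<Rightarrow> real" where
  "L2_norm_sq L g = (LINT x:{0..L}|lborel. (cmod (g x))\<^sup>2)"

definition is_weak_deriv :: "real \<Rightarrow> (real \<Rightarrow> complex) \<Rightarrow> (real \<Rightarrow> complex) \<Rightarrow> bool" where
  "is_weak_deriv L u g \<longleftrightarrow>
     square_integrable L g \<and>
     (\<forall>\<phi>. torus_test L \<phi> \<longrightarrow> pairing L u (\<phi> 1) = - pairing L g (\<phi> 0))"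

text \<open>
  In one space dimension every class in the Sobolev space \<open>H\<^sup>1\<close> has exactly one continuous
  representative, and elements of the space are taken to be these representatives.
\<close>

definition H1 :: "real \<Rightarrow> (real \<Rightarrow> complex) set" where
  "H1 L = {u. continuous_on UNIV u \<and> (\<forall>x. u (x + L) = u x) \<and> (\<exists>g. is_weak_deriv L u g)}"

text \<open>The weak derivative is unique up to null sets, so the choice does not affect the norm.\<close>

definition weak_deriv :: "real \<Rightarrow> (real \<Rightarrow> complex) \<Rightarrow> real \<Rightarrow> complex" where
  "weak_deriv L u = (SOME g. is_weak_deriv L u g)"

definition H1_norm_sq :: "real \<Rightarrow> (real \<Rightarrow> complex) \<Rightarrow> real" where
  "H1_norm_sq L u = L2_norm_sq L u + L2_norm_sq L (weak_deriv L u)"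

type_synonym state = "(real \<Rightarrow> complex) \<times> (real \<Rightarrow> complex)"

definition phase_space :: "real \<Rightarrow> state set" where
  "phase_space L = H1 L \<times> H1 L"

definition distE :: "real \<Rightarrow> state \<Rightarrow> state \<Rightarrow> real" where
  "distE L u v =
     sqrt (H1_norm_sq L (\<lambda>x. fst u x - fst v x) + H1_norm_sq L (\<lambda>x. snd u x - snd v x))"

definition dist_set :: "real \<Rightarrow> state \<Rightarrow> state set \<Rightarrow> real" where
  "dist_set L v A = (INF w\<in>A. distE L v w)"

section \<open>The coupled system\<close>

text \<open>
  A global solution is a map in \<open>C(\<real>, H\<^sup>1)\<close> that satisfies the system in the sense of
  distributions on the torus at every time; since the remaining terms of the equations are
  continuous in time with values in \<open>H\<^sup>-\<^sup>1\<close>, it then belongs to \<open>C\<^sup>1(\<real>, H\<^sup>-\<^sup>1)\<close>.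
  All space derivatives are moved to the test function, so that the first-order terms
  \<open>\<plusminus> 2 \<beta> i k \<nabla>u\<close> change sign.
\<close>

definition nls_solution ::
  "real \<Rightarrow> real \<Rightarrow> real \<Rightarrow> real \<Rightarrow> real \<Rightarrow> real \<Rightarrow> (real \<Rightarrow> state) \<Rightarrow> bool" where
  "nls_solution L \<beta> k \<alpha> \<gamma> \<delta> u \<longleftrightarrow>
     (\<forall>t. u t \<in> phase_space L) \<and>
     (\<forall>t. ((\<lambda>\<tau>. distE L (u \<tau>) (u t)) \<longlongrightarrow> 0) (at t)) \<and>
     (\<forall>\<phi> t. torus_test L \<phi> \<longrightarrow>
       (let u1 = fst (u t); u2 = snd (u t) in
        \<exists>d1 d2.
          ((\<lambda>\<tau>. pairing L (fst (u \<tau>)) (\<phi> 0)) has_vector_derivative d1) (at t) \<and>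
          ((\<lambda>\<tau>. pairing L (snd (u \<tau>)) (\<phi> 0)) has_vector_derivative d2) (at t) \<and>
          \<i> * d1 + of_real \<beta> * pairing L u1 (\<phi> 2)
            - 2 * of_real \<beta> * \<i> * of_real k * pairing L u1 (\<phi> 1)
            + pairing L (\<lambda>x. of_real (\<alpha> * (cmod (u1 x))\<^sup>2 + \<delta> * (cmod (u2 x))\<^sup>2) * u1 x) (\<phi> 0)
            - of_real (\<beta> * k\<^sup>2) * pairing L u1 (\<phi> 0) = 0 \<and>
          \<i> * d2 + of_real \<beta> * pairing L u2 (\<phi> 2)
            + 2 * of_real \<beta> * \<i> * of_real k * pairing L u2 (\<phi> 1)
            + pairing L (\<lambda>x. of_real (\<delta> * (cmod (u1 x))\<^sup>2 + \<gamma> * (cmod (u2 x))\<^sup>2) * u2 x) (\<phi> 0)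
            - of_real (\<beta> * k\<^sup>2) * pairing L u2 (\<phi> 0) = 0))"

section \<open>Symmetry group, momentum map and relative equilibria\<close>

text \<open>The group \<open>G = \<real> \<times> \<real>\<close> is additive.\<close>

definition act :: "real \<times> real \<Rightarrow> state \<Rightarrow> state" where
  "act g u = (\<lambda>x. exp (- \<i> * of_real (fst g)) * fst u x, \<lambda>x. exp (- \<i> * of_real (snd g)) * snd u x)"

definition momentum :: "real \<Rightarrow> state \<Rightarrow> real \<times> real" where
  "momentum L u = (L2_norm_sq L (fst u) / 2, L2_norm_sq L (snd u) / 2)"

text \<open>
  \<open>Ad g\<close> is the derivative at the identity of the conjugation by \<open>g\<close>.  The Lie algebra
  \<open>\<real> \<times> \<real>\<close> is identified with its dual through the inner product, and the coadjoint
  action sends \<open>\<mu>\<close> to \<open>\<mu> \<circ> Ad (g\<^sup>-\<^sup>1)\<close>.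
\<close>

definition Ad :: "real \<times> real \<Rightarrow> real \<times> real \<Rightarrow> real \<times> real" where
  "Ad g \<eta> = vector_derivative (\<lambda>s. g + s *\<^sub>R \<eta> - g) (at 0)"

definition coadjoint_stabilizer :: "real \<times> real \<Rightarrow> (real \<times> real) set" where
  "coadjoint_stabilizer \<mu> = {g. \<forall>\<eta>. \<mu> \<bullet> Ad (- g) \<eta> = \<mu> \<bullet> \<eta>}"

lemma coadjoint_stabilizer_eq_UNIV: "coadjoint_stabilizer \<mu> = UNIV"
proof -
  have "((\<lambda>s. g + s *\<^sub>R \<eta> - g) has_vector_derivative \<eta>) (at 0)" for g \<eta> :: "real \<times> real"
    by (auto intro!: derivative_eq_intros)
  then show ?thesis
    by (simp add: coadjoint_stabilizer_def Ad_def vector_derivative_at)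
qed

definition group_orbit :: "(real \<times> real) set \<Rightarrow> state \<Rightarrow> state set" where
  "group_orbit H u = (\<lambda>g. act g u) ` H"

text \<open>
  Below, \<open>sol\<close> is the set of global solutions of an evolution equation.  ``The solution with
  initial datum \<open>v\<close>'' is rendered by a quantification over all solutions with that initial datum.
\<close>

definition relative_equilibrium ::
  "real \<Rightarrow> (real \<Rightarrow> state) set \<Rightarrow> (real \<times> real) set \<Rightarrow> state \<Rightarrow> bool" where
  "relative_equilibrium L sol H u \<longleftrightarrow>
     u \<in> phase_space L \<and>
     (\<exists>s\<in>sol. s 0 = u) \<and>
     (\<forall>s\<in>sol. s 0 = u \<longrightarrow> (\<forall>t. s t \<in> group_orbit H u))"

definition orbitally_stable ::
  "real \<Rightarrow> (real \<Rightarrow> state) set \<Rightarrow> (real \<times> real) set \<Rightarrow> state \<Rightarrow> bool" where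
  "orbitally_stable L sol H u \<longleftrightarrow>
     (\<forall>\<epsilon>>0. \<exists>\<eta>>0. \<forall>v\<in>phase_space L. distE L v u \<le> \<eta> \<longrightarrow>
        (\<forall>s\<in>sol. s 0 = v \<longrightarrow> (\<forall>t. dist_set L (s t) (group_orbit H u) \<le> \<epsilon>)))"

definition const_state :: "real \<Rightarrow> real \<Rightarrow> state" where
  "const_state \<zeta>1 \<zeta>2 = (\<lambda>_. of_real \<zeta>1, \<lambda>_. of_real \<zeta>2)"

definition C_minus :: "real \<Rightarrow> real \<Rightarrow> real \<Rightarrow> real \<Rightarrow> real \<Rightarrow> real" where
  "C_minus \<alpha> \<gamma> \<delta> \<zeta>1 \<zeta>2 =
     - (\<alpha> * \<zeta>1\<^sup>2 + \<gamma> * \<zeta>2\<^sup>2)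
     - sqrt ((\<alpha> * \<zeta>1\<^sup>2 + \<gamma> * \<zeta>2\<^sup>2)\<^sup>2 - 4 * \<zeta>1\<^sup>2 * \<zeta>2\<^sup>2 * (\<alpha> * \<gamma> - \<delta>\<^sup>2))"

end

theory Submission
  imports Defs
begin

text \<open>
  The proof is the energy--momentum method, carried out directly on solutions in \<open>C(\<real>, H\<^sup>1)\<close>.

  The two masses and the energy are conserved.  A combination of them, the functional
  \<open>Lyapunov\<close>, has the constant state as a critical point.  Write a state, after a rotation of
  each component, as \<open>\<zeta>\<^sub>j + w\<^sub>j\<close>.  The kinetic part of the functional is quadratic in \<open>w\<close>; its
  indefinite first-order term couples the real part of \<open>w\<^sub>j\<close> with the derivative of the imaginary
  part, and completing the square costs \<open>4 \<beta> k\<^sup>2\<close> times the squared norm of the real parts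
  (\<open>kinetic_lower_bound\<close>).  The potential part costs at most \<open>- C_minus\<close> times that norm, because
  \<open>- C_minus / 2\<close> is the largest eigenvalue of the linearized coupling
  (\<open>coupling_form_le_C_minus\<close>).  On real parts of mean zero the Wirtinger inequality provides
  \<open>\<beta> (2 \<pi> / L)\<^sup>2\<close>, which by hypothesis outweighs both.  The means are not free: by
  conservation of mass the mean of the real part is of second order, and the rotation is chosen such
  that the mean of the imaginary part vanishes (\<open>optimal_phase\<close>).  Hence the functional controls
  the distance to the orbit near the orbit (\<open>Lyapunov_coercive\<close>), and a continuity argument gives
  stability (\<open>solutions_stay_near_orbit\<close>).  A solution that starts at the constant state has
  distance zero to the orbit for all times and hence stays in it, and
  an explicit solution of this kind exists (\<open>rotating_constant_solution\<close>).

  Two matters need care at this regularity.  First, solutions satisfy the equations only in the sense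
  of distributions.  Density of test functions upgrades this to differentiability in the dual of
  \<open>H\<^sup>1\<close> (\<open>schroedinger_time_derivative\<close>), which suffices for the masses.  The energy is obtained
  without smoothing the solution, by differentiating the inner product of the solution with its own time
  shift (\<open>conservation_by_time_shift\<close>, \<open>energy_conservation\<close>).  Secondly, the sharp constant in the
  Wirtinger inequality calls for Fourier series: trigonometric polynomials are dense in \<open>L\<^sup>2\<close> by the
  Stone--Weierstrass theorem on the circle, so partial sums converge (\<open>psum_tendsto\<close>).  They also
  supply the test functions for all density arguments (\<open>psum_wderiv_tendsto\<close>).
\<close>

section \<open>Square-integrable functions\<close>

definition L2 :: "'a measure \<Rightarrow> ('a \<Rightarrow> complex) set" where
  "L2 M = {f \<in> borel_measurable M. integrable M (\<lambda>x. (cmod (f x))\<^sup>2)}"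

definition norm2 :: "'a measure \<Rightarrow> ('a \<Rightarrow> complex) \<Rightarrow> real" where
  "norm2 M f = sqrt (\<integral>x. (cmod (f x))\<^sup>2 \<partial>M)"

lemma L2_measurable: "f \<in> L2 M \<Longrightarrow> f \<in> borel_measurable M"
  and L2_integrable: "f \<in> L2 M \<Longrightarrow> integrable M (\<lambda>x. (cmod (f x))\<^sup>2)"
  by (auto simp: L2_def)

lemma L2_mult_integrable:
  assumes "f \<in> L2 M" "g \<in> L2 M"
  shows "integrable M (\<lambda>x. f x * g x)"
proof (rule Bochner_Integration.integrable_bound)
  show "integrable M (\<lambda>x. (cmod (f x))\<^sup>2 + (cmod (g x))\<^sup>2)"
    using assms by (auto simp: L2_def)
  show "(\<lambda>x. f x * g x) \<in> borel_measurable M"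
    using assms by (auto simp: L2_def)
  have "cmod (f x * g x) \<le> norm ((cmod (f x))\<^sup>2 + (cmod (g x))\<^sup>2)" for x
  proof -
    have "0 \<le> (cmod (f x) - cmod (g x))\<^sup>2" by simp
    then have "2 * (cmod (f x) * cmod (g x)) \<le> (cmod (f x))\<^sup>2 + (cmod (g x))\<^sup>2"
      by (simp add: power2_diff)
    moreover have "0 \<le> cmod (f x) * cmod (g x)" by simp
    ultimately have "cmod (f x) * cmod (g x) \<le> (cmod (f x))\<^sup>2 + (cmod (g x))\<^sup>2"
      by linarith
    then show ?thesis by (simp add: norm_mult)
  qed
  then show "AE x in M. norm (f x * g x) \<le> norm ((cmod (f x))\<^sup>2 + (cmod (g x))\<^sup>2)"
    by simp
qed

lemma borel_measurable_cnj:
  "f \<in> borel_measurable M \<Longrightarrow> (\<lambda>x. cnj (f x)) \<in> borel_measurable M"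
  by (rule measurable_compose[OF _ borel_measurable_continuous_onI]) (auto intro: continuous_intros)

lemma L2_cnj: "f \<in> L2 M \<Longrightarrow> (\<lambda>x. cnj (f x)) \<in> L2 M"
  by (auto simp: L2_def borel_measurable_cnj)

lemma L2_cmult: "f \<in> L2 M \<Longrightarrow> (\<lambda>x. c * f x) \<in> L2 M"
  by (auto simp: L2_def norm_mult power_mult_distrib)

lemma L2_uminus: "f \<in> L2 M \<Longrightarrow> (\<lambda>x. - f x) \<in> L2 M"
  by (auto simp: L2_def)

lemma cmod_add_sq_le: "(cmod (a + b))\<^sup>2 \<le> 2 * ((cmod a)\<^sup>2 + (cmod b)\<^sup>2)"
proof -
  have "(cmod (a + b))\<^sup>2 \<le> (cmod a + cmod b)\<^sup>2"
    by (simp add: norm_triangle_ineq power_mono)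
  also have "\<dots> \<le> 2 * ((cmod a)\<^sup>2 + (cmod b)\<^sup>2)"
    using sum_squares_ge_zero[of "cmod a - cmod b" 0]
    by (simp add: power2_eq_square algebra_simps)
  finally show ?thesis .
qed

lemma L2_add:
  assumes "f \<in> L2 M" "g \<in> L2 M"
  shows "(\<lambda>x. f x + g x) \<in> L2 M"
proof -
  have "integrable M (\<lambda>x. (cmod (f x + g x))\<^sup>2)"
  proof (rule Bochner_Integration.integrable_bound)
    show "integrable M (\<lambda>x. 2 * ((cmod (f x))\<^sup>2 + (cmod (g x))\<^sup>2))"
      using assms by (auto simp: L2_def)
    show "(\<lambda>x. (cmod (f x + g x))\<^sup>2) \<in> borel_measurable M"
      using assms by (auto simp: L2_def)
    show "AE x in M. norm ((cmod (f x + g x))\<^sup>2) \<le> norm (2 * ((cmod (f x))\<^sup>2 + (cmod (g x))\<^sup>2))"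
      using cmod_add_sq_le by auto
  qed
  then show ?thesis using assms by (auto simp: L2_def)
qed

lemma L2_diff: "f \<in> L2 M \<Longrightarrow> g \<in> L2 M \<Longrightarrow> (\<lambda>x. f x - g x) \<in> L2 M"
  using L2_add[OF _ L2_uminus] by fastforce

lemma L2_sum: "(\<And>i. i \<in> I \<Longrightarrow> f i \<in> L2 M) \<Longrightarrow> (\<lambda>x. \<Sum>i\<in>I. f i x) \<in> L2 M"
proof (induction I rule: infinite_finite_induct)
  case (insert i I)
  then show ?case using L2_add[of "f i" M "\<lambda>x. \<Sum>i\<in>I. f i x"] by simp
qed (auto simp: L2_def)

lemma L2_mult_bounded:
  assumes "f \<in> L2 M" "g \<in> borel_measurable M" "AE x in M. cmod (g x) \<le> B"
  shows "(\<lambda>x. g x * f x) \<in> L2 M"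
proof -
  have "integrable M (\<lambda>x. (cmod (g x * f x))\<^sup>2)"
  proof (rule Bochner_Integration.integrable_bound)
    show "integrable M (\<lambda>x. B\<^sup>2 * (cmod (f x))\<^sup>2)"
      using assms by (auto simp: L2_def)
    show "(\<lambda>x. (cmod (g x * f x))\<^sup>2) \<in> borel_measurable M"
      using assms by (auto simp: L2_def)
    show "AE x in M. norm ((cmod (g x * f x))\<^sup>2) \<le> norm (B\<^sup>2 * (cmod (f x))\<^sup>2)"
      using assms(3)
      by eventually_elim (simp add: norm_mult power_mult_distrib mult_right_mono power_mono)
  qed
  then show ?thesis using assms by (auto simp: L2_def)
qed

lemma norm2_nonneg [simp]: "0 \<le> norm2 M f"
  by (simp add: norm2_def)

lemma norm2_sq: "(norm2 M f)\<^sup>2 = (\<integral>x. (cmod (f x))\<^sup>2 \<partial>M)"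
  by (simp add: norm2_def)

lemma norm2_cnj [simp]: "norm2 M (\<lambda>x. cnj (f x)) = norm2 M f"
  by (simp add: norm2_def)

lemma norm2_cmult: "norm2 M (\<lambda>x. c * f x) = cmod c * norm2 M f"
  by (simp add: norm2_def norm_mult power_mult_distrib real_sqrt_mult)

lemma norm2_diff_commute: "norm2 M (\<lambda>x. f x - g x) = norm2 M (\<lambda>x. g x - f x)"
  by (simp add: norm2_def norm_minus_commute)

lemma integral_mult_cnj: "(\<integral>x. f x * cnj (f x) \<partial>M) = of_real ((norm2 M f)\<^sup>2)"
  unfolding norm2_sq by (simp flip: integral_complex_of_real complex_norm_square)

text \<open>The Cauchy--Schwarz inequality comes from the nonnegativity of a quadratic polynomial.\<close>

lemma Cauchy_Schwarz_L2:
  assumes f: "f \<in> L2 M" and g: "g \<in> L2 M"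
  shows "cmod (\<integral>x. f x * g x \<partial>M) \<le> norm2 M f * norm2 M g"
proof -
  let ?F = "\<lambda>x. cmod (f x)" and ?G = "\<lambda>x. cmod (g x)"
  have iF: "integrable M (\<lambda>x. (?F x)\<^sup>2)" and iG: "integrable M (\<lambda>x. (?G x)\<^sup>2)"
    using f g by (auto simp: L2_def)
  have iFG: "integrable M (\<lambda>x. ?F x * ?G x)"
    using integrable_norm[OF L2_mult_integrable[OF f g]] by (simp add: norm_mult)
  define a b c where "a = (\<integral>x. (?F x)\<^sup>2 \<partial>M)" and "b = (\<integral>x. ?F x * ?G x \<partial>M)"
    and "c = (\<integral>x. (?G x)\<^sup>2 \<partial>M)"
  have pos: "0 \<le> s\<^sup>2 * a - 2 * s * t * b + t\<^sup>2 * c" for s t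
  proof -
    have "0 \<le> (\<integral>x. (s * ?F x - t * ?G x)\<^sup>2 \<partial>M)" by simp
    also have "\<dots> = (\<integral>x. s\<^sup>2 * (?F x)\<^sup>2 - 2 * s * t * (?F x * ?G x) + t\<^sup>2 * (?G x)\<^sup>2 \<partial>M)"
      by (intro Bochner_Integration.integral_cong) (auto simp: power2_eq_square algebra_simps)
    also have "\<dots> = s\<^sup>2 * a - 2 * s * t * b + t\<^sup>2 * c"
      using iF iG iFG by (simp add: a_def b_def c_def)
    finally show ?thesis .
  qed
  have nn: "0 \<le> a" "0 \<le> b" "0 \<le> c" by (auto simp: a_def b_def c_def)
  have "b\<^sup>2 \<le> a * c"
  proof (cases "c = 0")
    case True
    have "b = 0"
    proof (rule ccontr)
      assume "b \<noteq> 0"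
      then show False
        using pos[of 1 "(a + 1) / (2 * b)"] True by (simp add: field_simps)
    qed
    then show ?thesis using True by simp
  next
    case False
    then have "0 < c" using nn by simp
    have "0 \<le> c * (a * c - b\<^sup>2)"
      using pos[of c b] by (simp add: power2_eq_square algebra_simps)
    then show ?thesis using \<open>0 < c\<close> by (simp add: zero_le_mult_iff)
  qed
  then have "b \<le> sqrt (a * c)"
    using nn by (simp add: real_le_rsqrt)
  moreover have "cmod (\<integral>x. f x * g x \<partial>M) \<le> b"
    unfolding b_def using integral_norm_bound[of M "\<lambda>x. f x * g x"] by (simp add: norm_mult)
  ultimately show ?thesis
    by (simp add: norm2_def a_def c_def real_sqrt_mult)
qed

lemma norm2_add_sq:
  assumes f: "f \<in> L2 M" and g: "g \<in> L2 M"
  shows "(norm2 M (\<lambda>x. f x + g x))\<^sup>2 =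
    (norm2 M f)\<^sup>2 + 2 * Re (\<integral>x. f x * cnj (g x) \<partial>M) + (norm2 M g)\<^sup>2"
proof -
  have i: "integrable M (\<lambda>x. f x * cnj (g x))"
    by (intro L2_mult_integrable f L2_cnj g)
  have "(norm2 M (\<lambda>x. f x + g x))\<^sup>2 =
      (\<integral>x. (cmod (f x))\<^sup>2 + 2 * Re (f x * cnj (g x)) + (cmod (g x))\<^sup>2 \<partial>M)"
    unfolding norm2_sq
    by (intro Bochner_Integration.integral_cong) (auto simp: cmod_power2, simp add: power2_eq_square algebra_simps)
  also have "\<dots> = (norm2 M f)\<^sup>2 + 2 * Re (\<integral>x. f x * cnj (g x) \<partial>M) + (norm2 M g)\<^sup>2"
  proof -
    define h where "h = (\<lambda>x. Re (f x * cnj (g x)))"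
    have h: "integrable M h" "integral\<^sup>L M h = Re (\<integral>x. f x * cnj (g x) \<partial>M)"
      unfolding h_def by (rule integrable_Re[OF i], rule integral_Re[OF i])
    have "(\<integral>x. (cmod (f x))\<^sup>2 + 2 * h x + (cmod (g x))\<^sup>2 \<partial>M) =
        (norm2 M f)\<^sup>2 + 2 * integral\<^sup>L M h + (norm2 M g)\<^sup>2"
      using f g h(1) by (simp add: L2_def norm2_sq)
    then show ?thesis unfolding h(2) by (simp only: h_def)
  qed
  finally show ?thesis .
qed

lemma norm2_triangle:
  assumes f: "f \<in> L2 M" and g: "g \<in> L2 M"
  shows "norm2 M (\<lambda>x. f x + g x) \<le> norm2 M f + norm2 M g"
proof (rule power2_le_imp_le)
  have "Re (\<integral>x. f x * cnj (g x) \<partial>M) \<le> norm2 M f * norm2 M g"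
    using order_trans[OF complex_Re_le_cmod Cauchy_Schwarz_L2[OF f L2_cnj[OF g]]] by simp
  then show "(norm2 M (\<lambda>x. f x + g x))\<^sup>2 \<le> (norm2 M f + norm2 M g)\<^sup>2"
    by (simp add: norm2_add_sq[OF f g] power2_sum)
qed simp

lemma norm2_triangle_diff:
  assumes f: "f \<in> L2 M" and g: "g \<in> L2 M" and h: "h \<in> L2 M"
  shows "norm2 M (\<lambda>x. f x - h x) \<le> norm2 M (\<lambda>x. f x - g x) + norm2 M (\<lambda>x. g x - h x)"
  using norm2_triangle[OF L2_diff[OF f g] L2_diff[OF g h]] by simp

lemma norm2_reverse_triangle:
  assumes f: "f \<in> L2 M" and g: "g \<in> L2 M"
  shows "\<bar>norm2 M f - norm2 M g\<bar> \<le> norm2 M (\<lambda>x. f x - g x)"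
  using norm2_triangle[OF L2_diff[OF f g] g] norm2_triangle[OF L2_diff[OF g f] f]
    norm2_diff_commute[of M f g] by simp

lemma norm2_mono:
  assumes "g \<in> L2 M" "f \<in> borel_measurable M" "\<And>x. x \<in> space M \<Longrightarrow> cmod (f x) \<le> cmod (g x)"
  shows "norm2 M f \<le> norm2 M g"
proof -
  have "(\<integral>x. (cmod (f x))\<^sup>2 \<partial>M) \<le> (\<integral>x. (cmod (g x))\<^sup>2 \<partial>M)"
    by (intro integral_mono' L2_integrable assms) (auto intro: power_mono assms)
  then show ?thesis by (simp add: norm2_def)
qed

section \<open>Fourier series on the torus\<close>

definition torus_measure :: "real \<Rightarrow> real measure" where
  "torus_measure L = restrict_space lborel {0..L}"

definition mode :: "real \<Rightarrow> int \<Rightarrow> real \<Rightarrow> complex" where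
  "mode L n x = cis (2 * pi / L * of_int n * x)"

locale torus =
  fixes L :: real
  assumes L_pos: "L > 0"
begin

abbreviation M :: "real measure" where "M \<equiv> torus_measure L"

abbreviation pair :: "(real \<Rightarrow> complex) \<Rightarrow> (real \<Rightarrow> complex) \<Rightarrow> complex" where
  "pair f g \<equiv> (\<integral>x. f x * g x \<partial>M)"

abbreviation ip :: "(real \<Rightarrow> complex) \<Rightarrow> (real \<Rightarrow> complex) \<Rightarrow> complex" where
  "ip f g \<equiv> (\<integral>x. f x * cnj (g x) \<partial>M)"

abbreviation nrm :: "(real \<Rightarrow> complex) \<Rightarrow> real" where "nrm \<equiv> norm2 (torus_measure L)"

lemma space_M [simp]: "space M = {0..L}"
  by (simp add: torus_measure_def space_restrict_space)

lemma set_integrable_iff_M: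
  fixes f :: "real \<Rightarrow> 'b::{banach, second_countable_topology}"
  shows "set_integrable lborel {0..L} f \<longleftrightarrow> integrable M f"
  by (simp add: torus_measure_def integrable_restrict_space set_integrable_def)

lemma set_integral_eq_M:
  fixes f :: "real \<Rightarrow> 'b::{banach, second_countable_topology}"
  shows "(LINT x:{0..L}|lborel. f x) = (\<integral>x. f x \<partial>M)"
  by (simp add: torus_measure_def integral_restrict_space set_lebesgue_integral_def)

lemma square_integrable_iff_L2: "square_integrable L g \<longleftrightarrow> g \<in> L2 M"
proof -
  have "set_borel_measurable lborel {0..L} g \<longleftrightarrow> g \<in> borel_measurable M"
    by (simp add: torus_measure_def borel_measurable_restrict_space_iff set_borel_measurable_def)
  then show ?thesis
    by (simp add: square_integrable_def set_integrable_iff_M L2_def)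
qed

lemma L2_norm_sq_eq: "L2_norm_sq L g = (nrm g)\<^sup>2"
  by (simp add: L2_norm_sq_def set_integral_eq_M norm2_sq)

lemma pairing_eq: "pairing L f g = pair f g"
  by (simp add: pairing_def set_integral_eq_M)

sublocale finite_measure M
  using L_pos
  by (intro finite_measureI) (simp add: torus_measure_def emeasure_restrict_space space_restrict_space)

lemma measure_M [simp]: "measure M {0..L} = L"
  using L_pos by (simp add: torus_measure_def measure_restrict_space)

lemma continuous_measurable:
  fixes f :: "real \<Rightarrow> 'b::real_normed_vector"
  assumes "continuous_on UNIV f"
  shows "f \<in> borel_measurable M"
  unfolding torus_measure_def
  using borel_measurable_continuous_onI[OF assms] by (auto intro: measurable_restrict_space1)

lemma continuous_integrable:
  fixes f :: "real \<Rightarrow> 'b::{banach, second_countable_topology}"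
  assumes "continuous_on UNIV f"
  shows "integrable M f"
  using borel_integrable_atLeastAtMost'[of 0 L f] assms continuous_on_subset
  by (auto simp flip: set_integrable_iff_M)

lemma continuous_L2:
  assumes "continuous_on UNIV f"
  shows "f \<in> L2 M"
proof -
  have "integrable M (\<lambda>x. (cmod (f x))\<^sup>2)"
    by (intro continuous_integrable continuous_intros assms)
  then show ?thesis using continuous_measurable[OF assms] by (simp add: L2_def)
qed

lemma bounded_L2:
  assumes "f \<in> borel_measurable M" "\<And>x. x \<in> {0..L} \<Longrightarrow> cmod (f x) \<le> B"
  shows "f \<in> L2 M"
proof -
  have "(\<lambda>x. f x * 1) \<in> L2 M"
    using assms by (intro L2_mult_bounded[where B = B] continuous_L2 continuous_intros AE_I2) auto
  then show ?thesis by simp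
qed

lemma norm2_const: "nrm (\<lambda>_. c) = sqrt L * cmod c"
  by (simp add: norm2_def real_sqrt_mult)

lemma norm2_le_sup:
  assumes "\<And>x. x \<in> {0..L} \<Longrightarrow> cmod (f x) \<le> B" and "f \<in> borel_measurable M" and "0 \<le> B"
  shows "nrm f \<le> sqrt L * B"
proof -
  have "nrm f \<le> nrm (\<lambda>_. of_real B)"
    using assms by (intro norm2_mono continuous_L2) auto
  then show ?thesis using assms(3) by (simp add: norm2_const)
qed

lemma integral_FTC:
  fixes F f :: "real \<Rightarrow> complex"
  assumes "\<And>x. (F has_vector_derivative f x) (at x)" "continuous_on UNIV f"
  shows "(\<integral>x. f x \<partial>M) = F L - F 0"
proof -
  have "(\<integral>x. indicator {0..L} x *\<^sub>R f x \<partial>lborel) = F L - F 0"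
  proof (rule integral_FTC_atLeastAtMost)
    show "0 \<le> L" using L_pos by simp
    show "continuous_on {0..L} f" using assms(2) continuous_on_subset by blast
    show "(F has_vector_derivative f x) (at x within {0..L})" for x
      using assms(1) has_vector_derivative_at_within by blast
  qed
  then show ?thesis
    by (simp flip: set_integral_eq_M add: set_lebesgue_integral_def)
qed

subsection \<open>Exponentials and trigonometric polynomials\<close>

lemma mode_0 [simp]: "mode L 0 = (\<lambda>_. 1)"
  by (auto simp: mode_def)

lemma mode_mult: "mode L m x * mode L n x = mode L (m + n) x"
proof -
  have "2 * pi / L * of_int m * x + 2 * pi / L * of_int n * x = 2 * pi / L * of_int (m + n) * x"
    by (simp add: algebra_simps add_divide_distrib)
  then show ?thesis by (simp only: mode_def cis_mult)
qed

lemma cnj_mode: "cnj (mode L n x) = mode L (- n) x"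
  by (simp add: mode_def cis_cnj)

lemma norm_mode [simp]: "cmod (mode L n x) = 1"
  by (simp add: mode_def)

lemma mode_has_derivative:
  "(mode L n has_vector_derivative (\<i> * of_real (2 * pi / L * of_int n)) * mode L n x) (at x)"
proof -
  have "((\<lambda>x. exp (\<i> * of_real (2 * pi / L * of_int n) * of_real x)) has_vector_derivative
      (\<i> * of_real (2 * pi / L * of_int n)) * exp (\<i> * of_real (2 * pi / L * of_int n) * of_real x)) (at x)"
    by (rule has_vector_derivative_real_field) (use L_pos in \<open>auto intro!: derivative_eq_intros\<close>)
  moreover have "mode L n = (\<lambda>x. exp (\<i> * of_real (2 * pi / L * of_int n) * of_real x))"
    by (auto simp: mode_def cis_conv_exp mult_ac)
  ultimately show ?thesis by simp
qed

lemma continuous_mode: "continuous_on A (mode L n)"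
  unfolding mode_def by (intro continuous_intros)

lemma mode_L2: "mode L n \<in> L2 M"
  by (intro continuous_L2 continuous_mode)

lemma mode_periodic: "mode L n (x + L) = mode L n x"
proof -
  have "2 * pi / L * of_int n * (x + L) = 2 * pi / L * of_int n * x + 2 * pi * of_int n"
    using less_imp_neq[OF L_pos] by (simp add: distrib_left)
  moreover have "cis (2 * pi * of_int n) = 1"
    by (rule cis_multiple_2pi) auto
  ultimately show ?thesis
    by (simp only: mode_def cis_mult[symmetric]) simp
qed

lemma integral_mode: "(\<integral>x. mode L n x \<partial>M) = (if n = 0 then of_real L else 0)"
proof (cases "n = 0")
  case False
  define c where "c = \<i> * of_real (2 * pi / L * of_int n)"
  have c: "c \<noteq> 0" using False L_pos by (simp add: c_def)
  have "((\<lambda>x. mode L n x / c) has_vector_derivative (c * mode L n x) / c) (at x)" for x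
    using mode_has_derivative[of n x] unfolding c_def[symmetric]
    by (rule has_vector_derivative_divide)
  then have "(\<integral>x. mode L n x \<partial>M) = mode L n L / c - mode L n 0 / c"
    using c by (intro integral_FTC continuous_mode) simp
  then show ?thesis using False mode_periodic[of n 0] by simp
qed (simp add: scaleR_conv_of_real)

lemma mode_orthogonal:
  "ip (mode L m) (mode L n) = (if m = n then of_real L else 0)"
  by (simp add: cnj_mode mode_mult integral_mode)

inductive_set trig :: "(real \<Rightarrow> complex) set" where
  monomial: "(\<lambda>x. c * mode L n x) \<in> trig"
| add: "p \<in> trig \<Longrightarrow> q \<in> trig \<Longrightarrow> (\<lambda>x. p x + q x) \<in> trig"

lemma trig_const: "(\<lambda>_. c) \<in> trig"
  using monomial[of c 0] by simp

lemma trig_mult: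
  assumes "p \<in> trig" "q \<in> trig"
  shows "(\<lambda>x. p x * q x) \<in> trig"
  using assms
proof (induction p)
  case (monomial c n)
  from this show ?case
  proof (induction q)
    case (monomial d m)
    show ?case
      using trig.monomial[of "c * d" "n + m"] by (simp add: mode_mult[symmetric] mult_ac)
  next
    case (add p q)
    then show ?case using trig.add by (simp add: distrib_left)
  qed
next
  case (add p1 p2)
  then show ?case using trig.add by (simp add: distrib_right)
qed

lemma trig_cmult: "p \<in> trig \<Longrightarrow> (\<lambda>x. c * p x) \<in> trig"
  using trig_mult[OF trig_const] by simp

lemma trig_sum: "(\<And>i. i \<in> I \<Longrightarrow> p i \<in> trig) \<Longrightarrow> (\<lambda>x. \<Sum>i\<in>I. p i x) \<in> trig"
proof (induction I rule: infinite_finite_induct)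
  case (insert i I)
  then show ?case using trig.add[of "p i" "\<lambda>x. \<Sum>i\<in>I. p i x"] by simp
qed (auto simp: trig_const)

lemma trig_real_polynomial:
  fixes q :: "complex \<Rightarrow> real"
  assumes "real_polynomial_function q"
  shows "(\<lambda>x. of_real (q (mode L 1 x))) \<in> trig"
  using assms
proof induction
  case (linear f)
  have eq: "of_real (f z) = of_real (f 1) * ((z + cnj z) / 2) + of_real (f \<i>) * (- (\<i> / 2) * (z - cnj z))" for z
  proof -
    have z: "z = Re z *\<^sub>R 1 + Im z *\<^sub>R \<i>"
      by (simp add: complex_eq_iff)
    have "f z = Re z * f 1 + Im z * f \<i>"
      using linear.hyps by (subst z) (simp only: bounded_linear.linear linear_add linear_scale real_scaleR_def)
    then show ?thesis
      by (simp add: complex_eq_iff)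
  qed
  have "(\<lambda>x. (of_real (f 1) / 2 - \<i> / 2 * of_real (f \<i>)) * mode L 1 x
      + (of_real (f 1) / 2 + \<i> / 2 * of_real (f \<i>)) * mode L (- 1) x) \<in> trig"
    by (intro trig.intros)
  also have "(\<lambda>x. (of_real (f 1) / 2 - \<i> / 2 * of_real (f \<i>)) * mode L 1 x
      + (of_real (f 1) / 2 + \<i> / 2 * of_real (f \<i>)) * mode L (- 1) x) = (\<lambda>x. of_real (f (mode L 1 x)))"
    (is "?l = ?r")
  proof
    show "?l x = ?r x" for x
      using eq[of "mode L 1 x"] by (simp add: cnj_mode field_simps)
  qed
  finally show ?case .
next
  case (add f g)
  then show ?case using trig.add by simp
next
  case (mult f g)
  then show ?case using trig_mult by simp
qed (rule trig_const)

text \<open>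
  The Stone--Weierstrass theorem on the unit circle.  A function that vanishes off the open
  interval becomes a continuous function on the circle: away from \<open>1\<close> it is a function of
  \<open>Arg2pi\<close>, away from \<open>-1\<close> it is a function of \<open>Arg\<close>.
\<close>

lemma trig_approx_continuous:
  fixes h :: "real \<Rightarrow> complex"
  assumes h: "continuous_on UNIV h" and h0: "\<And>x. x \<notin> {0<..<L} \<Longrightarrow> h x = 0" and e: "0 < e"
  obtains p where "p \<in> trig" "\<And>x. x \<in> {0..L} \<Longrightarrow> cmod (h x - p x) < e"
proof -
  define c where "c = L / (2 * pi)"
  have c: "0 < c" "c * (2 * pi) = L" using L_pos by (auto simp: c_def)
  define F where "F z = h (c * Arg2pi z)" for z
  define H where "H x = h x + h (x + L)" for x
  have H: "continuous_on UNIV H"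
    unfolding H_def by (intro continuous_intros continuous_on_compose2[OF h]) auto
  then have isH: "isCont H x" for x by (simp add: continuous_on_eq_continuous_at)
  have F1: "F z = H (c * Arg2pi z)" for z
  proof -
    have "0 \<le> c * Arg2pi z" using c Arg2pi_ge_0[of z] by simp
    then show ?thesis by (simp add: F_def H_def h0)
  qed
  have F2: "F z = H (c * Arg z)" if "z \<noteq> 0" for z
  proof (cases "0 \<le> Arg z")
    case True
    have "Arg2pi z = Arg z"
      using Arg2pi_unique[of "cmod z" "Arg z" z] Arg_eq[OF that] that True Arg_le_pi[of z] pi_gt_zero
      by (smt (verit) zero_less_norm_iff)
    then show ?thesis using F1[of z] by simp
  next
    case False
    have "exp (\<i> * of_real (Arg z + 2 * pi)) = exp (\<i> * of_real (Arg z))"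
      by (simp add: distrib_left exp_add exp_two_pi_i mult_ac)
    then have "Arg2pi z = Arg z + 2 * pi"
      using Arg2pi_unique[of "cmod z" "Arg z + 2 * pi" z] Arg_eq[OF that] that False mpi_less_Arg[of z]
      by (smt (verit) zero_less_norm_iff)
    moreover have "c * Arg z < 0" using False c by (simp add: mult_pos_neg)
    then have "h (c * Arg z) = 0" by (simp add: h0)
    ultimately show ?thesis by (simp add: F_def H_def distrib_left c)
  qed
  have "continuous_on (sphere 0 1) F"
    unfolding continuous_on_eq_continuous_within
  proof
    fix z :: complex assume z: "z \<in> sphere 0 1"
    show "continuous (at z within sphere 0 1) F"
    proof (cases "z \<in> \<real>\<^sub>\<ge>\<^sub>0")
      case False
      have "isCont (\<lambda>z. H (c * Arg2pi z)) z"
        by (intro isCont_o2[OF _ isH] continuous_intros continuous_at_Arg2pi False)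
      then show ?thesis
        unfolding F1[symmetric] by (rule continuous_at_imp_continuous_within)
    next
      case True
      have "z \<noteq> 0" using z by auto
      then have z': "z \<notin> \<real>\<^sub>\<le>\<^sub>0"
        using True by (auto simp: complex_nonneg_Reals_iff complex_nonpos_Reals_iff complex_eq_iff)
      have "isCont (\<lambda>z. H (c * Arg z)) z"
        by (intro isCont_o2[OF _ isH] continuous_intros continuous_at_Arg z')
      then have "continuous (at z within sphere 0 1) (\<lambda>z. H (c * Arg z))"
        by (rule continuous_at_imp_continuous_within)
      moreover have "H (c * Arg z') = F z'" if "z' \<in> sphere 0 1" for z'
        using that by (intro F2[symmetric]) auto
      ultimately show ?thesis
        using z by (metis continuous_transform_within zero_less_one)
    qed
  qed
  then obtain g where g: "polynomial_function g" "\<And>z. z \<in> sphere 0 1 \<Longrightarrow> cmod (F z - g z) < e"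
    using Stone_Weierstrass_polynomial_function[OF compact_sphere _ e, of 0 1 F] by blast
  define p where "p x = g (mode L 1 x)" for x
  have "real_polynomial_function (Re \<circ> g)" "real_polynomial_function (Im \<circ> g)"
    using g(1) bounded_linear_Re bounded_linear_Im by (auto simp: polynomial_function_def)
  from this[THEN trig_real_polynomial]
  have "(\<lambda>x. of_real (Re (p x)) + \<i> * of_real (Im (p x))) \<in> trig"
    by (intro trig.add trig_cmult) (auto simp: p_def)
  then have "p \<in> trig" by (simp flip: complex_eq)
  moreover have "cmod (h x - p x) < e" if x: "x \<in> {0..L}" for x
  proof -
    have "F (mode L 1 x) = h x"
    proof (cases "x = L")
      case True
      have "mode L 1 x = 1" using mode_periodic[of 1 0] True by (simp add: mode_def)
      moreover have "Arg2pi 1 = 0" by (rule Arg2pi_unique[of 1]) auto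
      ultimately show ?thesis using True by (simp add: F_def h0)
    next
      case False
      have "2 * pi * x < 2 * pi * L" using x False by auto
      then have "2 * pi * x / L < 2 * pi" using L_pos by (simp add: divide_less_eq mult_ac)
      then have "Arg2pi (mode L 1 x) = 2 * pi * x / L"
        using x L_pos by (intro Arg2pi_unique[of 1]) (auto simp: mode_def cis_conv_exp)
      then show ?thesis using L_pos by (simp add: F_def c_def)
    qed
    then show ?thesis using g(2)[of "mode L 1 x"] by (simp add: p_def)
  qed
  ultimately show ?thesis using that by blast
qed


subsection \<open>Density of trigonometric polynomials\<close>

lemma trig_continuous: "p \<in> trig \<Longrightarrow> continuous_on A p"
  by (induction p rule: trig.induct) (auto intro!: continuous_intros continuous_mode)

lemma trig_L2: "p \<in> trig \<Longrightarrow> p \<in> L2 M"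
  by (simp add: continuous_L2 trig_continuous)

lemma dominated_convergence_nrm:
  assumes f: "f \<in> borel_measurable M" and s: "\<And>i. s i \<in> borel_measurable M"
    and w: "w \<in> L2 M"
    and lim: "AE x in M. (\<lambda>i. s i x) \<longlonglongrightarrow> f x"
    and bound: "\<And>i x. x \<in> {0..L} \<Longrightarrow> cmod (f x - s i x) \<le> cmod (w x)"
  shows "(\<lambda>i. nrm (\<lambda>x. f x - s i x)) \<longlonglongrightarrow> 0"
proof -
  have "(\<lambda>i. \<integral>x. (cmod (f x - s i x))\<^sup>2 \<partial>M) \<longlonglongrightarrow> (\<integral>x. 0 \<partial>M)"
  proof (rule integral_dominated_convergence[where w = "\<lambda>x. (cmod (w x))\<^sup>2"])
    show "AE x in M. (\<lambda>i. (cmod (f x - s i x))\<^sup>2) \<longlonglongrightarrow> 0"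
      using lim
    proof eventually_elim
      case (elim x)
      have "(\<lambda>i. (cmod (f x - s i x))\<^sup>2) \<longlonglongrightarrow> (cmod (f x - f x))\<^sup>2"
        by (intro tendsto_intros elim)
      then show ?case by simp
    qed
    show "AE x in M. norm ((cmod (f x - s i x))\<^sup>2) \<le> (cmod (w x))\<^sup>2" for i
      using bound by (auto intro!: AE_I2 power_mono)
    show "(\<lambda>x. (cmod (f x - s i x))\<^sup>2) \<in> borel_measurable M" for i
      using f s by measurable
  qed (use L2_integrable[OF w] in auto)
  then have "(\<lambda>i. sqrt (\<integral>x. (cmod (f x - s i x))\<^sup>2 \<partial>M)) \<longlonglongrightarrow> sqrt 0"
    by (intro tendsto_real_sqrt) simp
  then show ?thesis by (simp add: norm2_def)
qed

text \<open>
  A measurable function is an almost everywhere limit of continuous functions; the exceptional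
  Lebesgue null set is enlarged to a Borel null set.
\<close>

lemma AE_pointwise_limit_of_continuous:
  assumes f: "f \<in> borel_measurable M"
  obtains g :: "nat \<Rightarrow> real \<Rightarrow> complex"
  where "\<And>n. continuous_on UNIV (g n)" "AE x in M. (\<lambda>n. g n x) \<longlonglongrightarrow> f x"
proof -
  have "(\<lambda>x. indicator {0..L} x *\<^sub>R f x) \<in> borel_measurable lborel"
    using f by (simp add: torus_measure_def borel_measurable_restrict_space_iff)
  then have "(\<lambda>x. indicator {0..L} x *\<^sub>R f x) measurable_on UNIV"
    by (intro lebesgue_measurable_imp_measurable_on measurable_completion) auto
  then obtain N g where N: "negligible N" and g: "\<And>n. continuous_on UNIV (g n)"
    and lim: "\<And>x. x \<notin> N \<Longrightarrow> (\<lambda>n. g n x) \<longlonglongrightarrow> indicator {0..L} x *\<^sub>R f x"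
    unfolding measurable_on_def by auto
  obtain N' where N': "N' \<in> null_sets lborel" "N \<subseteq> N'"
    using N unfolding negligible_iff_null_sets null_sets_completion_iff2 by blast
  have "AE x in lborel. x \<notin> N'" by (rule AE_not_in) (rule N')
  then have "AE x in lborel. x \<in> {0..L} \<longrightarrow> (\<lambda>n. g n x) \<longlonglongrightarrow> f x"
  proof eventually_elim
    case (elim x)
    then have "x \<notin> N" using N' by blast
    from lim[OF this] show ?case by (auto simp: indicator_def)
  qed
  then have "AE x in M. (\<lambda>n. g n x) \<longlonglongrightarrow> f x"
    unfolding torus_measure_def by (subst AE_restrict_space_iff) auto
  with g that show ?thesis by blast
qed

text \<open>
  The continuous functions that converge to \<open>f\<close> almost everywhere need be neither bounded nor
  periodic.  A radial retraction onto the ball of radius \<open>B\<close> and a cut-off that vanishes at both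
  end points repair this without disturbing the limit, so dominated convergence applies.
\<close>

lemma bounded_approx_trig:
  assumes f: "f \<in> borel_measurable M" and B: "\<And>x. x \<in> {0..L} \<Longrightarrow> cmod (f x) \<le> B" "0 < B"
    and e: "0 < e"
  obtains p where "p \<in> trig" "nrm (\<lambda>x. f x - p x) < e"
proof -
  obtain g where g: "\<And>n. continuous_on UNIV (g n)" and lim: "AE x in M. (\<lambda>n. g n x) \<longlonglongrightarrow> f x"
    using AE_pointwise_limit_of_continuous[OF f] by blast
  define cut where "cut n x = min 1 (real n * max 0 (min x (L - x)))" for n x
  define R where "R z = z / of_real (max 1 (cmod z / B))" for z :: complex
  define h where "h n x = of_real (cut n x) * R (g n x)" for n x
  have R_cont: "continuous_on UNIV R"
    unfolding R_def by (intro continuous_intros) (use B(2) in \<open>auto simp: max_def\<close>)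
  have R_le: "cmod (R z) \<le> B" for z
    using B(2) by (auto simp: R_def norm_divide max_def field_simps)
  have R_id: "R z = z" if "cmod z \<le> B" for z
    using B(2) that by (auto simp: R_def max_def field_simps)
  have cut_cont: "continuous_on UNIV (cut n)" for n
    unfolding cut_def by (intro continuous_intros)
  have cut_bound: "0 \<le> cut n x" "cut n x \<le> 1" for n x by (auto simp: cut_def)
  have h_cont: "continuous_on UNIV (h n)" for n
    unfolding h_def by (intro continuous_intros cut_cont continuous_on_compose2[OF R_cont g]) auto
  have h_le: "cmod (h n x) \<le> B" for n x
    using mult_mono[OF cut_bound(2)[of n x] R_le[of "g n x"]] cut_bound[of n x]
    by (simp add: h_def norm_mult)
  have h_0: "h n x = 0" if "x \<notin> {0<..<L}" for n x
  proof -
    have "max 0 (min x (L - x)) = 0" using that by auto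
    then show ?thesis by (simp add: h_def cut_def)
  qed
  have "AE x in M. x \<noteq> 0 \<and> x \<noteq> L"
  proof -
    have "AE x in lborel. x \<notin> {0, L}" by (rule AE_not_in) (auto intro: finite_imp_null_set_lborel)
    then have "AE x in lborel. x \<in> {0..L} \<longrightarrow> x \<noteq> 0 \<and> x \<noteq> L" by eventually_elim auto
    then show ?thesis unfolding torus_measure_def by (subst AE_restrict_space_iff) auto
  qed
  then have "AE x in M. (\<lambda>n. h n x) \<longlonglongrightarrow> f x"
    using lim AE_space
  proof eventually_elim
    case (elim x)
    define d where "d = min x (L - x)"
    have d: "0 < d" using elim by (auto simp: d_def)
    obtain N where N: "1 < real N * d" using ex_less_of_nat_mult[OF d] by blast
    have "cut n x = 1" if "n \<ge> N" for n
    proof -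
      have "real N * d \<le> real n * d" using that d by (intro mult_right_mono) auto
      then have "1 \<le> real n * d" using N by linarith
      then show ?thesis using d by (simp add: cut_def d_def[symmetric] max_def)
    qed
    then have "eventually (\<lambda>n. cut n x = 1) sequentially"
      by (auto simp: eventually_sequentially)
    then have cut_lim: "(\<lambda>n. cut n x) \<longlonglongrightarrow> 1"
      by (rule tendsto_eventually)
    have "isCont R (f x)" using R_cont by (simp add: continuous_on_eq_continuous_at)
    then have "(\<lambda>n. R (g n x)) \<longlonglongrightarrow> R (f x)" by (rule isCont_tendsto_compose) (use elim in simp)
    then have "(\<lambda>n. h n x) \<longlonglongrightarrow> of_real 1 * R (f x)"
      unfolding h_def by (intro tendsto_intros cut_lim)
    then show ?case using elim B by (simp add: R_id)
  qed
  moreover have "cmod (f x - h n x) \<le> cmod (of_real (2 * B))" if "x \<in> {0..L}" for n x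
    using norm_triangle_ineq4[of "f x" "h n x"] B(1)[OF that] h_le[of n x] B(2) by simp
  ultimately have "(\<lambda>n. nrm (\<lambda>x. f x - h n x)) \<longlonglongrightarrow> 0"
    by (intro dominated_convergence_nrm[where w = "\<lambda>_. of_real (2 * B)"] f continuous_measurable h_cont
        continuous_L2 continuous_intros) auto
  then have "eventually (\<lambda>n. nrm (\<lambda>x. f x - h n x) < e / 2) sequentially"
    using e by (intro order_tendstoD) auto
  then obtain n where n: "nrm (\<lambda>x. f x - h n x) < e / 2"
    by (auto simp: eventually_sequentially)
  define e' where "e' = e / (2 * sqrt L)"
  have e': "0 < e'" using e L_pos by (simp add: e'_def)
  obtain p where p: "p \<in> trig" "\<And>x. x \<in> {0..L} \<Longrightarrow> cmod (h n x - p x) < e'"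
    using trig_approx_continuous[OF h_cont h_0 e'] by blast
  have "nrm (\<lambda>x. h n x - p x) \<le> sqrt L * e'"
    using p e' h_cont trig_continuous[OF p(1)]
    by (intro norm2_le_sup continuous_measurable continuous_intros) (auto intro: less_imp_le)
  also have "\<dots> = e / 2" using L_pos by (simp add: e'_def)
  finally have "nrm (\<lambda>x. h n x - p x) \<le> e / 2" .
  moreover have "f \<in> L2 M" by (rule bounded_L2[OF f B(1)])
  ultimately have "nrm (\<lambda>x. f x - p x) < e"
    using norm2_triangle_diff[of f M "h n" p] n continuous_L2[OF h_cont] trig_L2[OF p(1)] by fastforce
  with p(1) that show ?thesis by blast
qed

lemma L2_approx_trig:
  assumes f: "f \<in> L2 M" and e: "0 < e"
  obtains p where "p \<in> trig" "nrm (\<lambda>x. f x - p x) < e"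
proof -
  define T where "T n x = (if cmod (f x) \<le> real n then f x else 0)" for n x
  have fm: "f \<in> borel_measurable M" by (rule L2_measurable[OF f])
  have Tm: "T n \<in> borel_measurable M" for n
    unfolding T_def using fm by measurable
  have "(\<lambda>n. T n x) \<longlonglongrightarrow> f x" for x
  proof (rule tendsto_eventually)
    obtain N where "cmod (f x) \<le> real N" using real_arch_simple by blast
    then show "eventually (\<lambda>n. T n x = f x) sequentially"
      by (auto simp: T_def eventually_sequentially intro!: exI[of _ N])
  qed
  then have "(\<lambda>n. nrm (\<lambda>x. f x - T n x)) \<longlonglongrightarrow> 0"
    by (intro dominated_convergence_nrm[OF fm Tm f]) (auto simp: T_def)
  then have "eventually (\<lambda>n. nrm (\<lambda>x. f x - T n x) < e / 2) sequentially"
    using e by (intro order_tendstoD) auto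
  then obtain n where n: "nrm (\<lambda>x. f x - T n x) < e / 2"
    by (auto simp: eventually_sequentially)
  obtain p where p: "p \<in> trig" "nrm (\<lambda>x. T n x - p x) < e / 2"
    using bounded_approx_trig[OF Tm, of n "real n + 1" "e / 2"] e by (force simp: T_def)
  have "T n \<in> L2 M" using bounded_L2[OF Tm, of n "real n"] by (auto simp: T_def)
  then have "nrm (\<lambda>x. f x - p x) < e"
    using norm2_triangle_diff[OF f _ trig_L2[OF p(1)], of "T n"] n p(2) by fastforce
  with p(1) that show ?thesis by blast
qed

subsection \<open>Partial sums of Fourier series\<close>

definition fcoeff :: "(real \<Rightarrow> complex) \<Rightarrow> int \<Rightarrow> complex" where
  "fcoeff f n = ip f (mode L n)"

definition psum :: "nat \<Rightarrow> (real \<Rightarrow> complex) \<Rightarrow> real \<Rightarrow> complex" where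
  "psum N f x = (\<Sum>n\<in>{- int N..int N}. fcoeff f n / of_real L * mode L n x)"

lemma psum_trig: "psum N f \<in> trig"
  unfolding psum_def by (intro trig_sum trig.monomial)

lemma mult_cnj_mode_integrable: "f \<in> L2 M \<Longrightarrow> integrable M (\<lambda>x. f x * cnj (mode L n x))"
  by (intro L2_mult_integrable L2_cnj mode_L2)

lemma fcoeff_diff: "f \<in> L2 M \<Longrightarrow> g \<in> L2 M \<Longrightarrow> fcoeff (\<lambda>x. f x - g x) n = fcoeff f n - fcoeff g n"
  by (simp add: fcoeff_def left_diff_distrib mult_cnj_mode_integrable)

lemma fcoeff_sum_modes:
  assumes "finite I"
  shows "fcoeff (\<lambda>x. \<Sum>m\<in>I. c m * mode L m x) n = (if n \<in> I then of_real L * c n else 0)"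
proof -
  have "fcoeff (\<lambda>x. \<Sum>m\<in>I. c m * mode L m x) n =
      (\<integral>x. (\<Sum>m\<in>I. c m * (mode L m x * cnj (mode L n x))) \<partial>M)"
    by (simp add: fcoeff_def sum_distrib_right mult.assoc)
  also have "\<dots> = (\<Sum>m\<in>I. \<integral>x. c m * (mode L m x * cnj (mode L n x)) \<partial>M)"
    by (intro Bochner_Integration.integral_sum integrable_mult_right mult_cnj_mode_integrable mode_L2)
  also have "\<dots> = (\<Sum>m\<in>I. if m = n then of_real L * c n else 0)"
    by (intro sum.cong) (auto simp: mode_orthogonal)
  finally show ?thesis using assms by simp
qed

lemma fcoeff_psum: "n \<in> {- int N..int N} \<Longrightarrow> fcoeff (psum N f) n = fcoeff f n"
  using L_pos by (simp add: psum_def[abs_def] fcoeff_sum_modes del: times_divide_eq_left)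

lemma integral_mult_cnj_sum_modes:
  assumes "f \<in> L2 M"
  shows "(\<integral>x. f x * cnj (\<Sum>n\<in>I. c n * mode L n x) \<partial>M) = (\<Sum>n\<in>I. cnj (c n) * fcoeff f n)"
proof -
  have "(\<integral>x. f x * cnj (\<Sum>n\<in>I. c n * mode L n x) \<partial>M) =
      (\<integral>x. (\<Sum>n\<in>I. cnj (c n) * (f x * cnj (mode L n x))) \<partial>M)"
    by (intro Bochner_Integration.integral_cong) (auto simp: sum_distrib_left mult_ac)
  also have "\<dots> = (\<Sum>n\<in>I. \<integral>x. cnj (c n) * (f x * cnj (mode L n x)) \<partial>M)"
    by (intro Bochner_Integration.integral_sum integrable_mult_right mult_cnj_mode_integrable assms)
  finally show ?thesis by (simp add: fcoeff_def)
qed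

text \<open>The partial sum is the orthogonal projection, hence the best approximation.\<close>

lemma psum_orthogonal:
  assumes f: "f \<in> L2 M"
  shows "(\<integral>x. (f x - psum N f x) * cnj (\<Sum>n\<in>{- int N..int N}. c n * mode L n x) \<partial>M) = 0"
proof -
  have p: "psum N f \<in> L2 M" by (rule trig_L2[OF psum_trig])
  have "fcoeff (\<lambda>x. f x - psum N f x) n = 0" if "n \<in> {- int N..int N}" for n
    using fcoeff_diff[OF f p, of n] fcoeff_psum[OF that, of f] by simp
  then show ?thesis by (simp add: integral_mult_cnj_sum_modes L2_diff f p del: cnj_sum)
qed

lemma Pythagoras_psum:
  assumes f: "f \<in> L2 M"
  shows "(nrm (\<lambda>x. f x - (\<Sum>n\<in>{- int N..int N}. c n * mode L n x)))\<^sup>2 =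
    (nrm (\<lambda>x. f x - psum N f x))\<^sup>2 + (nrm (\<lambda>x. psum N f x - (\<Sum>n\<in>{- int N..int N}. c n * mode L n x)))\<^sup>2"
proof -
  let ?q = "\<lambda>x. \<Sum>n\<in>{- int N..int N}. c n * mode L n x"
  have q: "?q \<in> L2 M" by (intro L2_sum L2_cmult mode_L2)
  have p: "psum N f \<in> L2 M" by (rule trig_L2[OF psum_trig])
  have "psum N f x - ?q x = (\<Sum>n\<in>{- int N..int N}. (fcoeff f n / of_real L - c n) * mode L n x)" for x
    by (simp add: psum_def sum_subtractf left_diff_distrib)
  then have "(\<integral>x. (f x - psum N f x) * cnj (psum N f x - ?q x) \<partial>M) = 0"
    by (simp only: psum_orthogonal[OF f])
  then show ?thesis
    using norm2_add_sq[OF L2_diff[OF f p] L2_diff[OF p q]] by simp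
qed

lemma nrm_psum_sq: "(nrm (psum N f))\<^sup>2 = (\<Sum>n\<in>{- int N..int N}. (cmod (fcoeff f n))\<^sup>2) / L"
proof -
  have p: "psum N f \<in> L2 M" by (rule trig_L2[OF psum_trig])
  have "of_real ((nrm (psum N f))\<^sup>2) = ip (psum N f) (psum N f)"
    by (simp only: integral_mult_cnj)
  also have "\<dots> = (\<Sum>n\<in>{- int N..int N}. cnj (fcoeff f n / of_real L) * fcoeff (psum N f) n)"
    using integral_mult_cnj_sum_modes[OF p, where c = "\<lambda>n. fcoeff f n / of_real L" and I = "{- int N..int N}"]
    by (simp only: psum_def[of N f, symmetric])
  also have "\<dots> = (\<Sum>n\<in>{- int N..int N}. of_real ((cmod (fcoeff f n))\<^sup>2 / L))"
    by (intro sum.cong) (auto simp: fcoeff_psum mult_ac simp flip: complex_norm_square)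
  also have "\<dots> = of_real ((\<Sum>n\<in>{- int N..int N}. (cmod (fcoeff f n))\<^sup>2) / L)"
    by (simp add: sum_divide_distrib)
  finally show ?thesis by (simp only: of_real_eq_iff)
qed

lemma nrm_sq_psum:
  assumes f: "f \<in> L2 M"
  shows "(nrm f)\<^sup>2 = (nrm (\<lambda>x. f x - psum N f x))\<^sup>2 + (nrm (psum N f))\<^sup>2"
  using Pythagoras_psum[OF f, where c = "\<lambda>_. 0" and N = N] by simp

lemma Bessel:
  assumes f: "f \<in> L2 M"
  shows "nrm (psum N f) \<le> nrm f"
  by (rule power2_le_imp_le) (auto simp: nrm_sq_psum[OF f, of N])

lemma trig_sum_modes:
  assumes "p \<in> trig"
  shows "\<exists>N0. \<forall>N\<ge>N0. \<exists>c. p = (\<lambda>x. \<Sum>n\<in>{- int N..int N}. c n * mode L n x)"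
  using assms
proof induction
  case (monomial c n)
  show ?case
  proof (intro exI allI impI)
    fix N :: nat assume "N \<ge> nat \<bar>n\<bar>"
    then have "n \<in> {- int N..int N}" by auto
    then show "(\<lambda>x. c * mode L n x) = (\<lambda>x. \<Sum>m\<in>{- int N..int N}. (if m = n then c else 0) * mode L m x)"
      by (simp add: if_distrib[of "\<lambda>z. z * _"] cong: if_cong)
  qed
next
  case (add p q)
  then obtain N1 N2 where
    1: "\<And>N. N \<ge> N1 \<Longrightarrow> \<exists>c. p = (\<lambda>x. \<Sum>n\<in>{- int N..int N}. c n * mode L n x)" and
    2: "\<And>N. N \<ge> N2 \<Longrightarrow> \<exists>c. q = (\<lambda>x. \<Sum>n\<in>{- int N..int N}. c n * mode L n x)"
    by blast
  show ?case
  proof (intro exI[of _ "max N1 N2"] allI impI)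
    fix N assume N: "N \<ge> max N1 N2"
    obtain c where c: "p = (\<lambda>x. \<Sum>n\<in>{- int N..int N}. c n * mode L n x)" using 1[of N] N by auto
    obtain d where d: "q = (\<lambda>x. \<Sum>n\<in>{- int N..int N}. d n * mode L n x)" using 2[of N] N by auto
    show "\<exists>c. (\<lambda>x. p x + q x) = (\<lambda>x. \<Sum>n\<in>{- int N..int N}. c n * mode L n x)"
      by (rule exI[of _ "\<lambda>n. c n + d n"]) (simp add: c d distrib_right sum.distrib)
  qed
qed

text \<open>
  A trigonometric polynomial close to \<open>f\<close> lies in the range of all projections of large order, and
  these do at least as well.
\<close>

theorem psum_tendsto:
  assumes f: "f \<in> L2 M"
  shows "(\<lambda>N. nrm (\<lambda>x. f x - psum N f x)) \<longlonglongrightarrow> 0"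
proof (rule LIMSEQ_I)
  fix e :: real assume e: "0 < e"
  obtain p where p: "p \<in> trig" "nrm (\<lambda>x. f x - p x) < e" using L2_approx_trig[OF f e] by blast
  obtain N0 where N0: "\<And>N. N \<ge> N0 \<Longrightarrow> \<exists>c. p = (\<lambda>x. \<Sum>n\<in>{- int N..int N}. c n * mode L n x)"
    using trig_sum_modes[OF p(1)] by blast
  have "nrm (\<lambda>x. f x - psum N f x) < e" if N: "N \<ge> N0" for N
  proof -
    obtain c where c: "p = (\<lambda>x. \<Sum>n\<in>{- int N..int N}. c n * mode L n x)" using N0[OF N] by blast
    have "nrm (\<lambda>x. f x - psum N f x) \<le> nrm (\<lambda>x. f x - p x)"
      unfolding c by (rule power2_le_imp_le) (simp_all only: Pythagoras_psum[OF f] norm2_nonneg, simp)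
    then show ?thesis using p(2) by simp
  qed
  then show "\<exists>N0. \<forall>N\<ge>N0. norm (nrm (\<lambda>x. f x - psum N f x) - 0) < e"
    by (intro exI[of _ N0]) simp
qed

lemma nrm_psum_tendsto:
  assumes f: "f \<in> L2 M"
  shows "(\<lambda>N. nrm (psum N f)) \<longlonglongrightarrow> nrm f"
proof -
  have "(\<lambda>N. nrm f - nrm (psum N f)) \<longlonglongrightarrow> 0"
  proof (rule Lim_null_comparison[OF _ psum_tendsto[OF f]])
    show "\<forall>\<^sub>F N in sequentially. norm (nrm f - nrm (psum N f)) \<le> nrm (\<lambda>x. f x - psum N f x)"
      using norm2_reverse_triangle[OF f trig_L2[OF psum_trig]] by simp
  qed
  from tendsto_diff[OF tendsto_const[of "nrm f"] this] show ?thesis by simp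
qed

end

section \<open>The Sobolev space\<close>

text \<open>
  The derivative is an argument because \<^const>\<open>weak_deriv\<close> is only a choice up to null sets and hence
  need not be additive.
\<close>

definition has_wderiv :: "real \<Rightarrow> (real \<Rightarrow> complex) \<Rightarrow> (real \<Rightarrow> complex) \<Rightarrow> bool" where
  "has_wderiv L u g \<longleftrightarrow> continuous_on UNIV u \<and> (\<forall>x. u (x + L) = u x) \<and> is_weak_deriv L u g"

definition h1 :: "real \<Rightarrow> (real \<Rightarrow> complex) \<Rightarrow> real" where
  "h1 L u = sqrt (H1_norm_sq L u)"

lemma H1_iff: "u \<in> H1 L \<longleftrightarrow> (\<exists>g. has_wderiv L u g)"
  by (auto simp: H1_def has_wderiv_def)

lemma has_wderiv_weak_deriv: "u \<in> H1 L \<Longrightarrow> has_wderiv L u (weak_deriv L u)"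
  unfolding H1_def has_wderiv_def weak_deriv_def by (auto intro: someI[of "is_weak_deriv L u"])

context torus
begin

subsection \<open>Test functions\<close>

lemma test_continuous: "torus_test L \<phi> \<Longrightarrow> continuous_on A (\<phi> n)"
  unfolding torus_test_def
  by (meson continuous_at_imp_continuous_on has_vector_derivative_continuous)

lemma test_periodic:
  assumes "torus_test L \<phi>"
  shows "\<phi> n (x + L) = \<phi> n x"
proof (induction n arbitrary: x)
  case 0
  then show ?case using assms by (simp add: torus_test_def)
next
  case (Suc n)
  have "(\<phi> n has_vector_derivative \<phi> (Suc n) (x + L)) (at (x + L))"
    using assms by (simp add: torus_test_def)
  then have "((\<phi> n \<circ> (\<lambda>x. x + L)) has_vector_derivative 1 *\<^sub>R \<phi> (Suc n) (x + L)) (at x)"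
    by (intro vector_diff_chain_at) (auto intro!: derivative_eq_intros)
  moreover have "\<phi> n \<circ> (\<lambda>x. x + L) = \<phi> n" using Suc by auto
  ultimately have "(\<phi> n has_vector_derivative \<phi> (Suc n) (x + L)) (at x)" by simp
  moreover have "(\<phi> n has_vector_derivative \<phi> (Suc n) x) (at x)"
    using assms by (simp add: torus_test_def)
  ultimately show ?case by (rule vector_derivative_unique_at)
qed

lemma test_shift: "torus_test L \<phi> \<Longrightarrow> torus_test L (\<lambda>n. \<phi> (Suc n))"
  using test_periodic by (auto simp: torus_test_def)

lemma test_cnj:
  assumes "torus_test L \<phi>"
  shows "torus_test L (\<lambda>n x. cnj (\<phi> n x))"
  using assms by (auto simp: torus_test_def intro: has_vector_derivative_cnj)

lemma test_L2: "torus_test L \<phi> \<Longrightarrow> \<phi> n \<in> L2 M"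
  by (intro continuous_L2 test_continuous)

lemma integral_test_deriv:
  assumes "torus_test L \<phi>"
  shows "(\<integral>x. \<phi> (Suc n) x \<partial>M) = 0"
proof -
  have "(\<integral>x. \<phi> (Suc n) x \<partial>M) = \<phi> n L - \<phi> n 0"
    using assms by (intro integral_FTC test_continuous) (auto simp: torus_test_def)
  then show ?thesis using test_periodic[OF assms, of n 0] by simp
qed

text \<open>
  The eigenvalue of the derivative on the \<open>n\<close>-th exponential.
\<close>

definition wave_number :: "int \<Rightarrow> complex" where
  "wave_number n = \<i> * of_real (2 * pi / L * of_int n)"

lemma sum_modes_test:
  "torus_test L (\<lambda>j x. \<Sum>n\<in>I. c n * wave_number n ^ j * mode L n x)"
  unfolding torus_test_def
proof (intro conjI allI)
  fix j x
  have "((\<lambda>x. \<Sum>n\<in>I. (c n * wave_number n ^ j) * mode L n x) has_vector_derivative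
      (\<Sum>n\<in>I. (c n * wave_number n ^ j) * (wave_number n * mode L n x))) (at x)"
    unfolding wave_number_def
    by (intro has_vector_derivative_sum has_vector_derivative_mult_right mode_has_derivative)
  then show "((\<lambda>x. \<Sum>n\<in>I. c n * wave_number n ^ j * mode L n x) has_vector_derivative
      (\<Sum>n\<in>I. c n * wave_number n ^ Suc j * mode L n x)) (at x)"
    by (simp add: mult_ac)
qed (simp add: mode_periodic)

subsection \<open>Weak derivatives\<close>

lemma wderiv_continuous: "has_wderiv L u g \<Longrightarrow> continuous_on A u"
  unfolding has_wderiv_def using continuous_on_subset by blast

lemma wderiv_L2: "has_wderiv L u g \<Longrightarrow> u \<in> L2 M"
  by (intro continuous_L2 wderiv_continuous)

lemma wderiv_L2': "has_wderiv L u g \<Longrightarrow> g \<in> L2 M"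
  by (simp add: has_wderiv_def is_weak_deriv_def square_integrable_iff_L2)

lemma wderiv_test:
  assumes "has_wderiv L u g" "torus_test L \<phi>"
  shows "(pair u (\<phi> (Suc n))) = - pair g (\<phi> n)"
proof -
  have "torus_test L (\<lambda>j. \<phi> (j + n))"
  proof (induction n)
    case (Suc n)
    from test_shift[OF this] show ?case by simp
  qed (use assms(2) in simp)
  from assms(1) this have "pairing L u (\<phi> (1 + n)) = - pairing L g (\<phi> (0 + n))"
    unfolding has_wderiv_def is_weak_deriv_def by blast
  then show ?thesis by (simp add: pairing_eq)
qed

lemma has_wderivI:
  assumes "continuous_on UNIV u" "\<And>x. u (x + L) = u x" "g \<in> L2 M"
    and "\<And>\<phi>. torus_test L \<phi> \<Longrightarrow> (pair u (\<phi> 1)) = - pair g (\<phi> 0)"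
  shows "has_wderiv L u g"
  using assms by (auto simp: has_wderiv_def is_weak_deriv_def pairing_eq square_integrable_iff_L2)

lemma wderiv_add:
  assumes u: "has_wderiv L u g" and v: "has_wderiv L v h"
  shows "has_wderiv L (\<lambda>x. u x + v x) (\<lambda>x. g x + h x)"
proof (rule has_wderivI)
  show "continuous_on UNIV (\<lambda>x. u x + v x)"
    by (intro continuous_intros wderiv_continuous[OF u] wderiv_continuous[OF v])
  show "u (x + L) + v (x + L) = u x + v x" for x
    using u v by (simp add: has_wderiv_def)
  show "(\<lambda>x. g x + h x) \<in> L2 M" by (intro L2_add wderiv_L2'[OF u] wderiv_L2'[OF v])
  fix \<phi> assume \<phi>: "torus_test L \<phi>"
  show "(\<integral>x. (u x + v x) * \<phi> 1 x \<partial>M) = - (\<integral>x. (g x + h x) * \<phi> 0 x \<partial>M)"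
    using wderiv_test[OF u \<phi>, of 0] wderiv_test[OF v \<phi>, of 0]
    by (simp add: distrib_right L2_mult_integrable wderiv_L2[OF u] wderiv_L2[OF v]
        wderiv_L2'[OF u] wderiv_L2'[OF v] test_L2[OF \<phi>])
qed

lemma wderiv_cmult:
  assumes u: "has_wderiv L u g"
  shows "has_wderiv L (\<lambda>x. c * u x) (\<lambda>x. c * g x)"
proof (rule has_wderivI)
  show "continuous_on UNIV (\<lambda>x. c * u x)"
    by (intro continuous_intros wderiv_continuous[OF u])
  show "(\<lambda>x. c * g x) \<in> L2 M" by (intro L2_cmult wderiv_L2'[OF u])
  show "c * u (x + L) = c * u x" for x
    using u by (simp add: has_wderiv_def)
  fix \<phi> assume \<phi>: "torus_test L \<phi>"
  show "(\<integral>x. (c * u x) * \<phi> 1 x \<partial>M) = - (\<integral>x. (c * g x) * \<phi> 0 x \<partial>M)"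
    using wderiv_test[OF u \<phi>, of 0] by (simp add: mult.assoc)
qed

lemma wderiv_diff:
  assumes "has_wderiv L u g" "has_wderiv L v h"
  shows "has_wderiv L (\<lambda>x. u x - v x) (\<lambda>x. g x - h x)"
  using wderiv_add[OF assms(1) wderiv_cmult[OF assms(2), of "-1"]] by simp

lemma wderiv_cnj:
  assumes u: "has_wderiv L u g"
  shows "has_wderiv L (\<lambda>x. cnj (u x)) (\<lambda>x. cnj (g x))"
proof (rule has_wderivI)
  show "continuous_on UNIV (\<lambda>x. cnj (u x))"
    by (intro continuous_intros wderiv_continuous[OF u])
  show "(\<lambda>x. cnj (g x)) \<in> L2 M" by (intro L2_cnj wderiv_L2'[OF u])
  show "cnj (u (x + L)) = cnj (u x)" for x
    using u by (simp add: has_wderiv_def)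
  fix \<phi> assume \<phi>: "torus_test L \<phi>"
  have "cnj (ip u (\<phi> 1)) = cnj (- ip g (\<phi> 0))"
    using wderiv_test[OF u test_cnj[OF \<phi>], of 0] by simp
  then show "(\<integral>x. cnj (u x) * \<phi> 1 x \<partial>M) = - (\<integral>x. cnj (g x) * \<phi> 0 x \<partial>M)"
    by (simp flip: Bochner_Integration.integral_cnj)
qed

lemma wderiv_Re:
  assumes u: "has_wderiv L u g"
  shows "has_wderiv L (\<lambda>x. of_real (Re (u x))) (\<lambda>x. of_real (Re (g x)))"
proof -
  have eq: "complex_of_real (Re z) = 1 / 2 * (z + cnj z)" for z by (simp add: complex_eq_iff)
  show ?thesis
    unfolding eq by (intro wderiv_cmult wderiv_add wderiv_cnj u)
qed

lemma wderiv_Im: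
  assumes u: "has_wderiv L u g"
  shows "has_wderiv L (\<lambda>x. of_real (Im (u x))) (\<lambda>x. of_real (Im (g x)))"
  using wderiv_Re[OF wderiv_cmult[OF u, of "- \<i>"]] by simp

lemma wderiv_const: "has_wderiv L (\<lambda>_. c) (\<lambda>_. 0)"
proof (rule has_wderivI)
  show "(\<lambda>_. 0) \<in> L2 M" by (intro continuous_L2 continuous_intros)
  show "(\<integral>x. c * \<phi> 1 x \<partial>M) = - (\<integral>x. 0 * \<phi> 0 x \<partial>M)" if "torus_test L \<phi>" for \<phi>
    using integral_test_deriv[OF that, of 0] by simp
qed auto

lemma fcoeff_wderiv:
  assumes u: "has_wderiv L u g"
  shows "fcoeff g n = wave_number n * fcoeff u n"
proof -
  have t: "torus_test L (\<lambda>j x. wave_number (- n) ^ j * mode L (- n) x)"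
    using sum_modes_test[of "\<lambda>_. 1" "{- n}"] by simp
  have "(\<integral>x. wave_number (- n) * (u x * mode L (- n) x) \<partial>M) = - (pair g (mode L (- n)))"
    using wderiv_test[OF u t, of 0] by (simp add: mult_ac)
  moreover have "wave_number (- n) = - wave_number n" by (simp add: wave_number_def)
  ultimately show ?thesis by (simp add: fcoeff_def cnj_mode)
qed

text \<open>The weak derivative of \<open>u\<close> has the same partial sums as the termwise derivative of the series of \<open>u\<close>.\<close>

definition psum_test :: "nat \<Rightarrow> (real \<Rightarrow> complex) \<Rightarrow> nat \<Rightarrow> real \<Rightarrow> complex" where
  "psum_test N u j x = (\<Sum>n\<in>{- int N..int N}. fcoeff u n / of_real L * wave_number n ^ j * mode L n x)"

lemma torus_test_psum: "torus_test L (psum_test N u)"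
  unfolding psum_test_def[abs_def] by (rule sum_modes_test)

lemma psum_test_0: "psum_test N u 0 = psum N u"
  by (auto simp: psum_test_def psum_def)

lemma psum_test_1: "has_wderiv L u g \<Longrightarrow> psum_test N u (Suc 0) = psum N g"
  by (auto simp: psum_test_def psum_def fcoeff_wderiv intro!: ext sum.cong)

text \<open>
  Two weak derivatives have the same Fourier coefficients.
\<close>

lemma wderiv_unique:
  assumes "has_wderiv L u g" "has_wderiv L u h"
  shows "nrm (\<lambda>x. g x - h x) = 0"
proof -
  have "fcoeff g = fcoeff h"
    using fcoeff_wderiv[OF assms(1)] fcoeff_wderiv[OF assms(2)] by auto
  then have gh: "psum N g = psum N h" for N by (auto simp: psum_def)
  have "(\<lambda>N. nrm (\<lambda>x. g x - psum N g x) + nrm (\<lambda>x. h x - psum N h x)) \<longlonglongrightarrow> 0 + 0"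
    by (intro tendsto_add psum_tendsto wderiv_L2'[OF assms(1)] wderiv_L2'[OF assms(2)])
  moreover have "nrm (\<lambda>x. g x - h x) \<le> nrm (\<lambda>x. g x - psum N g x) + nrm (\<lambda>x. h x - psum N h x)" for N
    using norm2_triangle_diff[OF wderiv_L2'[OF assms(1)] trig_L2[OF psum_trig] wderiv_L2'[OF assms(2)], of N g]
    by (simp add: gh norm2_diff_commute[of _ h])
  ultimately have "nrm (\<lambda>x. g x - h x) \<le> 0"
    by (intro LIMSEQ_le_const[where a = "nrm (\<lambda>x. g x - h x)"]) auto
  then show ?thesis using norm2_nonneg[of M "\<lambda>x. g x - h x"] by linarith
qed

lemma H1_norm_sq_eq:
  assumes u: "has_wderiv L u g"
  shows "H1_norm_sq L u = (nrm u)\<^sup>2 + (nrm g)\<^sup>2"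
proof -
  have w: "has_wderiv L u (weak_deriv L u)"
    using u by (intro has_wderiv_weak_deriv) (auto simp: H1_iff)
  have "nrm (weak_deriv L u) = nrm g"
    using norm2_reverse_triangle[OF wderiv_L2'[OF w] wderiv_L2'[OF u]] wderiv_unique[OF w u] by simp
  then show ?thesis by (simp add: H1_norm_sq_def L2_norm_sq_eq)
qed

lemma h1_eq: "has_wderiv L u g \<Longrightarrow> h1 L u = sqrt ((nrm u)\<^sup>2 + (nrm g)\<^sup>2)"
  by (simp add: h1_def H1_norm_sq_eq)

lemma h1_nonneg: "0 \<le> h1 L u"
  by (simp add: h1_def H1_norm_sq_def L2_norm_sq_eq)

lemma h1_sq: "(h1 L u)\<^sup>2 = H1_norm_sq L u"
  by (simp add: h1_def H1_norm_sq_def L2_norm_sq_eq)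

lemma nrm_le_h1: "has_wderiv L u g \<Longrightarrow> nrm u \<le> h1 L u"
  and nrm_wderiv_le_h1: "has_wderiv L u g \<Longrightarrow> nrm g \<le> h1 L u"
  by (auto simp: h1_eq intro!: real_le_rsqrt)

lemma h1_cmult: "has_wderiv L u g \<Longrightarrow> h1 L (\<lambda>x. c * u x) = cmod c * h1 L u"
  by (simp add: h1_eq h1_eq[OF wderiv_cmult] norm2_cmult power_mult_distrib real_sqrt_mult
      flip: distrib_left)

lemma h1_triangle:
  assumes u: "u \<in> H1 L" and v: "v \<in> H1 L"
  shows "h1 L (\<lambda>x. u x + v x) \<le> h1 L u + h1 L v"
proof -
  obtain g h where g: "has_wderiv L u g" and h: "has_wderiv L v h"
    using u v by (auto simp: H1_iff)
  have "h1 L (\<lambda>x. u x + v x) \<le> sqrt ((nrm u + nrm v)\<^sup>2 + (nrm g + nrm h)\<^sup>2)"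
    unfolding h1_eq[OF wderiv_add[OF g h]]
    by (intro real_sqrt_le_mono add_mono power_mono norm2_triangle norm2_nonneg
        wderiv_L2[OF g] wderiv_L2[OF h] wderiv_L2'[OF g] wderiv_L2'[OF h])
  also have "\<dots> \<le> h1 L u + h1 L v"
    unfolding h1_eq[OF g] h1_eq[OF h] by (rule real_sqrt_sum_squares_triangle_ineq)
  finally show ?thesis .
qed

lemma H1_diff: "u \<in> H1 L \<Longrightarrow> v \<in> H1 L \<Longrightarrow> (\<lambda>x. u x - v x) \<in> H1 L"
  by (auto simp: H1_iff dest: wderiv_diff)

lemma h1_minus_commute: "u \<in> H1 L \<Longrightarrow> v \<in> H1 L \<Longrightarrow> h1 L (\<lambda>x. u x - v x) = h1 L (\<lambda>x. v x - u x)"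
  by (auto simp: H1_iff h1_eq[OF wderiv_diff] norm2_diff_commute[of M u v] dest: wderiv_diff)
    (metis h1_eq norm2_diff_commute wderiv_diff)

lemma h1_triangle_diff:
  assumes u: "u \<in> H1 L" and v: "v \<in> H1 L" and w: "w \<in> H1 L"
  shows "h1 L (\<lambda>x. u x - w x) \<le> h1 L (\<lambda>x. u x - v x) + h1 L (\<lambda>x. v x - w x)"
  using h1_triangle[OF H1_diff[OF u v] H1_diff[OF v w]] by simp

subsection \<open>Density of test functions and its consequences\<close>

lemma integral_mult_tendsto:
  assumes f: "f \<in> L2 M" and g: "g \<in> L2 M" and G: "\<And>N. G N \<in> L2 M"
    and lim: "(\<lambda>N. nrm (\<lambda>x. g x - G N x)) \<longlonglongrightarrow> 0"
  shows "(\<lambda>N. \<integral>x. f x * G N x \<partial>M) \<longlonglongrightarrow> (pair f g)"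
proof -
  have "(\<lambda>N. (pair f (G N)) - pair f g) \<longlonglongrightarrow> 0"
  proof (rule Lim_null_comparison)
    show "\<forall>\<^sub>F N in sequentially. norm (pair f (G N) - pair f g)
        \<le> nrm f * nrm (\<lambda>x. g x - G N x)"
    proof (intro always_eventually allI)
      fix N
      have "pair f (G N) - pair f g = (\<integral>x. f x * (G N x - g x) \<partial>M)"
        by (simp add: right_diff_distrib L2_mult_integrable f g G)
      then show "norm (pair f (G N) - pair f g) \<le> nrm f * nrm (\<lambda>x. g x - G N x)"
        using Cauchy_Schwarz_L2[OF f L2_diff[OF G g], of N] norm2_diff_commute[of M g "G N"] by simp
    qed
    show "(\<lambda>N. nrm f * nrm (\<lambda>x. g x - G N x)) \<longlonglongrightarrow> 0"
      using tendsto_mult_left[OF lim, of "nrm f"] by simp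
  qed
  then show ?thesis by (simp only: Lim_null[of _ "\<integral>x. f x * g x \<partial>M"])
qed

lemma psum_wderiv_tendsto:
  assumes "has_wderiv L u g"
  shows "(\<lambda>N. nrm (\<lambda>x. u x - psum_test N u 0 x)) \<longlonglongrightarrow> 0"
    and "(\<lambda>N. nrm (\<lambda>x. g x - psum_test N u (Suc 0) x)) \<longlonglongrightarrow> 0"
  using psum_tendsto[OF wderiv_L2[OF assms]] psum_tendsto[OF wderiv_L2'[OF assms]]
  by (simp_all add: psum_test_0 psum_test_1[OF assms])

text \<open>
  The definition of weak derivatives is the case where one factor is a test function; the partial
  sums of the other factor converge together with their derivatives.
\<close>

lemma integration_by_parts:
  assumes u: "has_wderiv L u g" and v: "has_wderiv L v h"
  shows "pair u h = - pair g v"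
proof -
  note T = torus_test_psum[of _ v]
  have "(\<lambda>N. \<integral>x. u x * psum_test N v (Suc 0) x \<partial>M) \<longlonglongrightarrow> (pair u h)"
    by (intro integral_mult_tendsto psum_wderiv_tendsto(2)[OF v] wderiv_L2[OF u] wderiv_L2'[OF v] test_L2 T)
  moreover have "(\<lambda>N. - pair g (psum_test N v 0)) \<longlonglongrightarrow> - pair g v"
    by (intro tendsto_minus integral_mult_tendsto psum_wderiv_tendsto(1)[OF v] wderiv_L2'[OF u]
        wderiv_L2[OF v] test_L2 T)
  ultimately show ?thesis
    unfolding wderiv_test[OF u T] by (rule LIMSEQ_unique)
qed

lemma nrm_0_imp_0:
  assumes f: "continuous_on UNIV f" and "nrm f = 0" "x \<in> {0..L}"
  shows "f x = 0"
proof -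
  have cont: "continuous_on UNIV (\<lambda>x. (cmod (f x))\<^sup>2)" by (intro continuous_intros f)
  have "(\<integral>x. (cmod (f x))\<^sup>2 \<partial>M) = 0" using assms(2) norm2_sq[of M f] by simp
  then have "((\<lambda>x. (cmod (f x))\<^sup>2) has_integral 0) {0..L}"
    using set_borel_integral_eq_integral[of "{0..L}" "\<lambda>x. (cmod (f x))\<^sup>2"] continuous_integrable[OF cont]
    by (simp add: set_integrable_iff_M set_integral_eq_M has_integral_iff)
  then have "(cmod (f x))\<^sup>2 = 0"
    using cont continuous_on_subset assms(3) L_pos
    by (intro has_integral_0_cbox_imp_0[of 0 L "\<lambda>x. (cmod (f x))\<^sup>2"]) auto
  then show ?thesis by simp
qed

text \<open>
  Any two values of \<open>\<phi>\<close> differ by at most the integral of the modulus of its derivative.  Taking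
  the norm over the second point turns this into a bound on a single value.
\<close>

lemma test_sup_bound:
  assumes \<phi>: "torus_test L \<phi>" and x: "x \<in> {0..L}"
  shows "cmod (\<phi> 0 x) \<le> nrm (\<phi> 0) / sqrt L + sqrt L * nrm (\<phi> 1)"
proof -
  have diff: "cmod (\<phi> 0 b - \<phi> 0 a) \<le> sqrt L * nrm (\<phi> 1)" if ab: "0 \<le> a" "a \<le> b" "b \<le> L" for a b
  proof -
    define I where "I = (\<lambda>t. of_real (indicator {a..b} t) :: complex)"
    have I: "I \<in> borel_measurable M"
      unfolding I_def torus_measure_def by (rule measurable_restrict_space1) measurable
    have I1: "cmod (I t) \<le> 1" for t by (simp add: I_def indicator_def)
    have "\<phi> 0 b - \<phi> 0 a = (\<integral>t. indicator {a..b} t *\<^sub>R \<phi> 1 t \<partial>lborel)"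
    proof (rule integral_FTC_atLeastAtMost[symmetric])
      show "continuous_on {a..b} (\<phi> 1)" by (rule test_continuous[OF \<phi>])
      show "(\<phi> 0 has_vector_derivative \<phi> 1 x) (at x within {a..b})" for x
        using \<phi> by (auto simp: torus_test_def intro: has_vector_derivative_at_within)
    qed (use ab in auto)
    also have "\<dots> = (LINT t:{0..L}|lborel. I t * \<phi> 1 t)"
      unfolding set_lebesgue_integral_def
      by (intro Bochner_Integration.integral_cong) (use ab in \<open>auto simp: I_def indicator_def\<close>)
    also have "\<dots> = (\<integral>t. I t * \<phi> 1 t \<partial>M)" by (rule set_integral_eq_M)
    finally have "cmod (\<phi> 0 b - \<phi> 0 a) \<le> nrm I * nrm (\<phi> 1)"
      using Cauchy_Schwarz_L2[OF bounded_L2[OF I I1] test_L2[OF \<phi>]] by simp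
    moreover have "nrm I \<le> sqrt L * 1" by (rule norm2_le_sup) (use I I1 in auto)
    ultimately show ?thesis using mult_right_mono[of "nrm I" "sqrt L" "nrm (\<phi> 1)"] by simp
  qed
  have "cmod (\<phi> 0 x - \<phi> 0 y) \<le> sqrt L * nrm (\<phi> 1)" if "y \<in> {0..L}" for y
    using diff[of x y] diff[of y x] x that by (cases "x \<le> y") (auto simp: norm_minus_commute)
  then have "nrm (\<lambda>y. \<phi> 0 x - \<phi> 0 y) \<le> sqrt L * (sqrt L * nrm (\<phi> 1))"
    by (intro norm2_le_sup continuous_measurable continuous_intros test_continuous[OF \<phi>])
      (use L_pos in auto)
  moreover have "nrm (\<lambda>_. \<phi> 0 x) \<le> nrm (\<lambda>y. \<phi> 0 x - \<phi> 0 y) + nrm (\<phi> 0)"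
    using norm2_triangle[OF L2_diff[OF continuous_L2[of "\<lambda>_. \<phi> 0 x"] test_L2[OF \<phi>]] test_L2[OF \<phi>], of 0 0]
    by simp
  ultimately have "sqrt L * cmod (\<phi> 0 x) \<le> nrm (\<phi> 0) + sqrt L * (sqrt L * nrm (\<phi> 1))"
    by (simp add: norm2_const)
  then have "sqrt L * cmod (\<phi> 0 x) \<le> sqrt L * (nrm (\<phi> 0) / sqrt L + sqrt L * nrm (\<phi> 1))"
    using L_pos by (simp add: distrib_left)
  then show ?thesis using L_pos by simp
qed

definition Sob :: real where "Sob = 1 / sqrt L + sqrt L"

lemma Sob_pos: "0 < Sob"
  using L_pos by (simp add: Sob_def add_pos_pos)

text \<open>
  By Bessel's inequality the bound for test functions holds for all partial sums with one constant
  \<open>B\<close>.  So \<open>u\<close> exceeds \<open>B\<close> by no more than its distance to a partial sum, and the norm of the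
  excess vanishes in the limit.
\<close>

lemma Sobolev:
  assumes "u \<in> H1 L"
  shows "cmod (u x) \<le> Sob * h1 L u"
proof -
  obtain g where u: "has_wderiv L u g" using assms by (auto simp: H1_iff)
  define B where "B = nrm u / sqrt L + sqrt L * nrm g"
  define f where "f x = complex_of_real (max 0 (cmod (u x) - B))" for x
  have f: "continuous_on UNIV f"
    unfolding f_def by (intro continuous_intros wderiv_continuous[OF u])
  have "nrm f \<le> nrm (\<lambda>x. u x - psum N u x)" for N
  proof (rule norm2_mono)
    show "(\<lambda>x. u x - psum N u x) \<in> L2 M" by (intro L2_diff wderiv_L2[OF u] trig_L2 psum_trig)
    show "f \<in> borel_measurable M" by (rule continuous_measurable[OF f])
    fix x assume "x \<in> space M"
    then have "cmod (psum N u x) \<le> nrm (psum N u) / sqrt L + sqrt L * nrm (psum N g)"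
      using test_sup_bound[OF torus_test_psum, of x N u] by (simp add: psum_test_0 psum_test_1[OF u])
    also have "\<dots> \<le> B"
      unfolding B_def using L_pos Bessel[OF wderiv_L2[OF u], of N] Bessel[OF wderiv_L2'[OF u], of N]
      by (intro add_mono divide_right_mono mult_left_mono) auto
    finally have "cmod (psum N u x) \<le> B" .
    then show "cmod (f x) \<le> cmod (u x - psum N u x)"
      using norm_triangle_ineq2[of "u x" "psum N u x"] norm_ge_zero[of "u x - psum N u x"]
      by (simp add: f_def)
  qed
  then have "nrm f \<le> 0"
    by (intro LIMSEQ_le_const[OF psum_tendsto[OF wderiv_L2[OF u]]]) auto
  then have "nrm f = 0" using norm2_nonneg[of M f] by linarith
  then have f0: "f x = 0" if "x \<in> {0..L}" for x using nrm_0_imp_0[OF f _ that] by blast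
  have bound: "cmod (u x) \<le> B" if "x \<in> {0..L}" for x
    using f0[OF that] by (simp add: f_def max_def split: if_splits)
  have "B \<le> Sob * h1 L u"
    unfolding B_def Sob_def distrib_right using nrm_le_h1[OF u] nrm_wderiv_le_h1[OF u] L_pos
    by (intro add_mono) (auto simp: divide_right_mono)
  moreover have "cmod (u x) \<le> B"
  proof -
    have per: "u (y + of_int n * L) = u y" for y n
    proof (induction n rule: int_induct[where k = 0])
      case (step1 n)
      then show ?case using u[unfolded has_wderiv_def] by (simp add: distrib_right flip: add.assoc)
    next
      case (step2 n)
      have "u (y + of_int (n - 1) * L) = u (y + of_int (n - 1) * L + L)"
        using u[unfolded has_wderiv_def] by simp
      also have "y + of_int (n - 1) * L + L = y + of_int n * L" by (simp add: left_diff_distrib)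
      finally show ?case using step2 by simp
    qed simp
    define n where "n = \<lfloor>x / L\<rfloor>"
    have "of_int n \<le> x / L" "x / L < of_int n + 1" by (auto simp: n_def)
    then have "of_int n * L \<le> x" "x < (of_int n + 1) * L"
      using L_pos by (simp_all add: pos_le_divide_eq pos_divide_less_eq)
    then have "x + of_int (- n) * L \<in> {0..L}" by (simp add: distrib_right)
    from bound[OF this] show ?thesis by (simp only: per)
  qed
  ultimately show ?thesis by linarith
qed

text \<open>
  For partial sums this compares coefficients: differentiation multiplies the \<open>n\<close>-th one by a
  number of modulus at least \<open>2 \<pi> / L\<close> unless \<open>n = 0\<close>, and the coefficient of index \<open>0\<close> is the mean.
\<close>

lemma Wirtinger:
  assumes u: "has_wderiv L u g"
  shows "(2 * pi / L)\<^sup>2 * ((nrm u)\<^sup>2 - (cmod (\<integral>x. u x \<partial>M))\<^sup>2 / L) \<le> (nrm g)\<^sup>2"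
proof (rule LIMSEQ_le)
  show "(\<lambda>N. (2 * pi / L)\<^sup>2 * ((nrm (psum N u))\<^sup>2 - (cmod (\<integral>x. u x \<partial>M))\<^sup>2 / L))
      \<longlonglongrightarrow> (2 * pi / L)\<^sup>2 * ((nrm u)\<^sup>2 - (cmod (\<integral>x. u x \<partial>M))\<^sup>2 / L)"
    by (intro tendsto_intros nrm_psum_tendsto wderiv_L2[OF u])
  show "(\<lambda>N. (nrm (psum N g))\<^sup>2) \<longlonglongrightarrow> (nrm g)\<^sup>2"
    by (intro tendsto_intros nrm_psum_tendsto wderiv_L2'[OF u])
  have "(2 * pi / L)\<^sup>2 * ((nrm (psum N u))\<^sup>2 - (cmod (\<integral>x. u x \<partial>M))\<^sup>2 / L) \<le> (nrm (psum N g))\<^sup>2" for N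
  proof -
    let ?I = "{- int N..int N}"
    have u0: "(\<integral>x. u x \<partial>M) = fcoeff u 0" by (simp add: fcoeff_def)
    have "(2 * pi / L)\<^sup>2 * ((nrm (psum N u))\<^sup>2 - (cmod (fcoeff u 0))\<^sup>2 / L)
        = (\<Sum>n\<in>?I - {0}. (2 * pi / L)\<^sup>2 * (cmod (fcoeff u n))\<^sup>2) / L"
      by (simp add: nrm_psum_sq sum.remove[of ?I 0] sum_distrib_left flip: diff_divide_distrib)
    also have "\<dots> \<le> (\<Sum>n\<in>?I - {0}. (cmod (fcoeff g n))\<^sup>2) / L"
    proof (intro divide_right_mono sum_mono)
      fix n assume n: "n \<in> ?I - {0}"
      have "1 \<le> (of_int n :: real)\<^sup>2"
        using n abs_le_square_iff[of 1 "of_int n :: real"] by force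
      then have "(2 * pi / L)\<^sup>2 * 1 \<le> (2 * pi / L)\<^sup>2 * (of_int n)\<^sup>2" by (intro mult_left_mono) auto
      also have "\<dots> = (cmod (wave_number n))\<^sup>2"
        by (simp add: wave_number_def norm_mult norm_divide power_mult_distrib power_divide)
      finally show "(2 * pi / L)\<^sup>2 * (cmod (fcoeff u n))\<^sup>2 \<le> (cmod (fcoeff g n))\<^sup>2"
        by (simp add: fcoeff_wderiv[OF u] norm_mult power_mult_distrib mult_right_mono)
    qed (use L_pos in auto)
    also have "\<dots> \<le> (\<Sum>n\<in>?I. (cmod (fcoeff g n))\<^sup>2) / L"
      by (intro divide_right_mono sum_mono2) (use L_pos in auto)
    finally show ?thesis by (simp add: u0 nrm_psum_sq)
  qed
  then show "\<exists>N. \<forall>n\<ge>N. (2 * pi / L)\<^sup>2 * ((nrm (psum n u))\<^sup>2 - (cmod (\<integral>x. u x \<partial>M))\<^sup>2 / L) \<le> (nrm (psum n g))\<^sup>2"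
    by blast
qed

end

section \<open>Linear Schroedinger equations with a source\<close>

lemma has_vector_derivative_iff_quotient:
  fixes f :: "real \<Rightarrow> complex"
  shows "(f has_vector_derivative D) (at t) \<longleftrightarrow>
    ((\<lambda>s. (f s - f t) / of_real (s - t)) \<longlongrightarrow> D) (at t)"
proof -
  have "((\<lambda>s. (f s - f t) / of_real (s - t)) \<longlongrightarrow> D) (at t) \<longleftrightarrow>
      ((\<lambda>s. (f s - f t) / of_real (s - t) - D) \<longlongrightarrow> 0) (at t)"
    by (rule Lim_null)
  also have "\<dots> \<longleftrightarrow> ((\<lambda>s. norm ((f s - f t) / of_real (s - t) - D)) \<longlongrightarrow> 0) (at t)"
    by (rule tendsto_norm_zero_iff[symmetric])
  also have "\<dots> \<longleftrightarrow> ((\<lambda>s. norm (f s - (f t + (s - t) *\<^sub>R D)) / norm (s - t)) \<longlongrightarrow> 0) (at t)"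
  proof (rule tendsto_cong)
    show "\<forall>\<^sub>F s in at t. norm ((f s - f t) / of_real (s - t) - D) =
        norm (f s - (f t + (s - t) *\<^sub>R D)) / norm (s - t)"
      unfolding eventually_at_filter
    proof (intro always_eventually allI impI)
      fix s assume "s \<noteq> t"
      then have "(f s - f t) / of_real (s - t) - D = (f s - (f t + (s - t) *\<^sub>R D)) / of_real (s - t)"
        by (simp add: field_simps scaleR_conv_of_real flip: of_real_diff)
      then show "norm ((f s - f t) / of_real (s - t) - D) =
          norm (f s - (f t + (s - t) *\<^sub>R D)) / norm (s - t)"
        by (simp add: norm_divide flip: of_real_diff)
    qed
  qed
  also have "\<dots> \<longleftrightarrow> (f has_vector_derivative D) (at t)"
    by (simp add: has_vector_derivative_def has_derivative_iff_norm bounded_linear_scaleR_left diff_diff_eq)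
  finally show ?thesis by simp
qed

lemma vector_derivative_bound:
  fixes f :: "real \<Rightarrow> complex"
  assumes S: "convex S" "x \<in> S" "y \<in> S"
    and f: "\<And>s. s \<in> S \<Longrightarrow> (f has_vector_derivative f' s) (at s)" "\<And>s. s \<in> S \<Longrightarrow> norm (f' s) \<le> B"
  shows "norm (f x - f y) \<le> B * \<bar>x - y\<bar>"
proof -
  have "norm (f x - f y) \<le> B * norm (x - y)"
  proof (rule differentiable_bound[OF S(1)])
    show "(f has_derivative (\<lambda>h. h *\<^sub>R f' s)) (at s within S)" if "s \<in> S" for s
      using f(1)[OF that] unfolding has_vector_derivative_def by (rule has_derivative_at_withinI)
    show "onorm (\<lambda>h. h *\<^sub>R f' s) \<le> B" if "s \<in> S" for s
      by (rule onorm_le) (use f(2)[OF that] in \<open>simp add: mult.commute[of B] mult_left_mono\<close>)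
  qed (use S in auto)
  then show ?thesis by simp
qed

context torus
begin

text \<open>
  The equation \<open>\<i> u\<^sub>t + \<beta> u'' + 2 \<i> \<beta> \<kappa> u' + F - \<beta> \<kappa>\<^sup>2 u = 0\<close>, solved for \<open>u\<^sub>t\<close> and tested against
  \<open>v\<close>.  One of the two derivatives has been moved to \<open>v\<close>, so that only first derivatives \<open>g\<close> and
  \<open>h\<close> of \<open>u\<close> and \<open>v\<close> occur and the expression is continuous on the Sobolev space.
\<close>

definition rhs ::
  "real \<Rightarrow> real \<Rightarrow> (real \<Rightarrow> complex) \<Rightarrow> (real \<Rightarrow> complex) \<Rightarrow> (real \<Rightarrow> complex) \<Rightarrow>
    (real \<Rightarrow> complex) \<Rightarrow> (real \<Rightarrow> complex) \<Rightarrow> complex" where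
  "rhs \<beta> \<kappa> u g F v h =
     - \<i> * (of_real \<beta> * pair g h - 2 * of_real \<beta> * \<i> * of_real \<kappa> * pair g v
       - pair F v + of_real (\<beta> * \<kappa>\<^sup>2) * pair u v)"

definition rhs_const :: "real \<Rightarrow> real \<Rightarrow> real" where
  "rhs_const \<beta> \<kappa> = 1 + \<bar>\<beta>\<bar> * (1 + 2 * \<bar>\<kappa>\<bar> + \<kappa>\<^sup>2)"

lemma rhs_const_pos: "0 < rhs_const \<beta> \<kappa>"
  unfolding rhs_const_def by (intro add_pos_nonneg mult_nonneg_nonneg add_nonneg_nonneg) auto

lemma rhs_bound:
  assumes "u \<in> L2 M" "g \<in> L2 M" "F \<in> L2 M" "v \<in> L2 M" "h \<in> L2 M"
  shows "cmod (rhs \<beta> \<kappa> u g F v h) \<le> rhs_const \<beta> \<kappa> * (nrm u + nrm g + nrm F) * (nrm v + nrm h)"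
proof -
  define K where "K = (nrm u + nrm g + nrm F) * (nrm v + nrm h)"
  have CS: "cmod (pair p q) \<le> K"
    if "p \<in> L2 M" "q \<in> L2 M" "nrm p \<le> nrm u + nrm g + nrm F" "nrm q \<le> nrm v + nrm h" for p q
    using Cauchy_Schwarz_L2[OF that(1,2)] mult_mono[OF that(3,4)] by (simp add: K_def)
  have gh: "cmod (pair g h) \<le> K" and gv: "cmod (pair g v) \<le> K"
    and Fv: "cmod (pair F v) \<le> K" and uv: "cmod (pair u v) \<le> K"
    by (rule CS; use assms in simp)+
  have "cmod (rhs \<beta> \<kappa> u g F v h) \<le> \<bar>\<beta>\<bar> * cmod (pair g h)
      + 2 * \<bar>\<beta>\<bar> * \<bar>\<kappa>\<bar> * cmod (pair g v) + cmod (pair F v)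
      + \<bar>\<beta>\<bar> * \<kappa>\<^sup>2 * cmod (pair u v)"
  proof -
    have tri: "cmod (p - q - r + s) \<le> cmod p + cmod q + cmod r + cmod s" for p q r s
      using norm_triangle_ineq[of "p - q - r" s] norm_triangle_ineq4[of "p - q" r]
        norm_triangle_ineq4[of p q] by linarith
    have "cmod (rhs \<beta> \<kappa> u g F v h) = cmod (of_real \<beta> * pair g h
        - 2 * of_real \<beta> * \<i> * of_real \<kappa> * pair g v
        - pair F v + of_real (\<beta> * \<kappa>\<^sup>2) * pair u v)"
      unfolding rhs_def by (subst norm_mult) simp
    also have "\<dots> \<le> cmod (of_real \<beta> * pair g h)
        + cmod (2 * of_real \<beta> * \<i> * of_real \<kappa> * pair g v)
        + cmod (pair F v) + cmod (of_real (\<beta> * \<kappa>\<^sup>2) * pair u v)"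
      by (rule tri)
    finally show ?thesis by (simp add: norm_mult norm_power)
  qed
  also have "\<dots> \<le> \<bar>\<beta>\<bar> * K + 2 * \<bar>\<beta>\<bar> * \<bar>\<kappa>\<bar> * K + K + \<bar>\<beta>\<bar> * \<kappa>\<^sup>2 * K"
    by (intro add_mono mult_left_mono gh gv Fv uv) auto
  also have "\<dots> = rhs_const \<beta> \<kappa> * K" by (simp add: rhs_const_def algebra_simps)
  finally show ?thesis by (simp add: K_def mult_ac)
qed

lemma rhs_diff_left:
  assumes "u \<in> L2 M" "g \<in> L2 M" "F \<in> L2 M" "u' \<in> L2 M" "g' \<in> L2 M" "F' \<in> L2 M" "v \<in> L2 M" "h \<in> L2 M"
  shows "rhs \<beta> \<kappa> u g F v h - rhs \<beta> \<kappa> u' g' F' v h =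
    rhs \<beta> \<kappa> (\<lambda>x. u x - u' x) (\<lambda>x. g x - g' x) (\<lambda>x. F x - F' x) v h"
  using assms by (simp add: rhs_def left_diff_distrib L2_mult_integrable) (simp add: algebra_simps)

lemma rhs_tendsto:
  assumes "u \<in> L2 M" "g \<in> L2 M" "F \<in> L2 M" "v \<in> L2 M" "h \<in> L2 M"
    and "\<And>s. V s \<in> L2 M" "\<And>s. H s \<in> L2 M"
    and lim: "((\<lambda>s. nrm (\<lambda>x. V s x - v x)) \<longlongrightarrow> 0) Q" "((\<lambda>s. nrm (\<lambda>x. H s x - h x)) \<longlongrightarrow> 0) Q"
  shows "((\<lambda>s. rhs \<beta> \<kappa> u g F (V s) (H s)) \<longlongrightarrow> rhs \<beta> \<kappa> u g F v h) Q"
proof -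
  have "rhs \<beta> \<kappa> u g F (V s) (H s) - rhs \<beta> \<kappa> u g F v h =
      rhs \<beta> \<kappa> u g F (\<lambda>x. V s x - v x) (\<lambda>x. H s x - h x)" for s
    using assms by (simp add: rhs_def right_diff_distrib L2_mult_integrable) (simp add: algebra_simps)
  moreover have "((\<lambda>s. rhs \<beta> \<kappa> u g F (\<lambda>x. V s x - v x) (\<lambda>x. H s x - h x)) \<longlongrightarrow> 0) Q"
  proof (rule Lim_null_comparison)
    show "\<forall>\<^sub>F s in Q. norm (rhs \<beta> \<kappa> u g F (\<lambda>x. V s x - v x) (\<lambda>x. H s x - h x)) \<le>
        rhs_const \<beta> \<kappa> * (nrm u + nrm g + nrm F) * (nrm (\<lambda>x. V s x - v x) + nrm (\<lambda>x. H s x - h x))"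
      by (intro always_eventually allI rhs_bound L2_diff assms)
    show "((\<lambda>s. rhs_const \<beta> \<kappa> * (nrm u + nrm g + nrm F) *
        (nrm (\<lambda>x. V s x - v x) + nrm (\<lambda>x. H s x - h x))) \<longlongrightarrow> 0) Q"
      using tendsto_mult_left[OF tendsto_add[OF lim]] by simp
  qed
  ultimately show ?thesis by (simp only: Lim_null[of _ "rhs \<beta> \<kappa> u g F v h"])
qed

text \<open>Both sides are continuous in \<open>v\<close> and \<open>h\<close>, and the partial sums of \<open>v\<close> are test functions.\<close>

lemma test_estimate_extends:
  assumes f: "f \<in> L2 M" and L2: "u \<in> L2 M" "g \<in> L2 M" "F \<in> L2 M"
    and test: "\<And>\<phi>. torus_test L \<phi> \<Longrightarrow>
      cmod (pair f (\<phi> 0) - c * rhs \<beta> \<kappa> u g F (\<phi> 0) (\<phi> 1)) \<le> B * (nrm (\<phi> 0) + nrm (\<phi> 1))"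
    and v: "has_wderiv L v h"
  shows "cmod (pair f v - c * rhs \<beta> \<kappa> u g F v h) \<le> B * (nrm v + nrm h)"
proof (rule LIMSEQ_le)
  note T = torus_test_psum[of _ v]
  note lim = psum_wderiv_tendsto[OF v]
  have lim': "(\<lambda>N. nrm (\<lambda>x. psum_test N v 0 x - v x)) \<longlonglongrightarrow> 0"
    "(\<lambda>N. nrm (\<lambda>x. psum_test N v (Suc 0) x - h x)) \<longlonglongrightarrow> 0"
    using lim by (simp_all add: norm2_diff_commute[of M v] norm2_diff_commute[of M h])
  show "(\<lambda>N. cmod ((pair f (psum_test N v 0))
        - c * rhs \<beta> \<kappa> u g F (psum_test N v 0) (psum_test N v (Suc 0)))) \<longlonglongrightarrow>
      cmod (pair f v - c * rhs \<beta> \<kappa> u g F v h)"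
    by (intro tendsto_intros integral_mult_tendsto rhs_tendsto lim lim' f L2 test_L2 T
        wderiv_L2[OF v] wderiv_L2'[OF v])
  show "(\<lambda>N. B * (nrm (psum_test N v 0) + nrm (psum_test N v (Suc 0)))) \<longlonglongrightarrow> B * (nrm v + nrm h)"
    unfolding psum_test_0 psum_test_1[OF v]
    by (intro tendsto_intros nrm_psum_tendsto wderiv_L2[OF v] wderiv_L2'[OF v])
  show "\<exists>N. \<forall>n\<ge>N. cmod ((pair f (psum_test n v 0))
        - c * rhs \<beta> \<kappa> u g F (psum_test n v 0) (psum_test n v (Suc 0)))
      \<le> B * (nrm (psum_test n v 0) + nrm (psum_test n v (Suc 0)))"
    using test[OF T] by auto
qed

text \<open>
  A curve \<open>a\<close> in \<open>H\<^sup>1\<close> with space derivative \<open>A\<close> that solves the equation with source \<open>F\<close> in the sense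
  of distributions.  Both components of the nonlinear system have this form, with the cubic terms as
  the source and with opposite signs of \<open>\<kappa>\<close>.
\<close>

definition schroedinger ::
  "real \<Rightarrow> real \<Rightarrow> (real \<Rightarrow> real \<Rightarrow> complex) \<Rightarrow> (real \<Rightarrow> real \<Rightarrow> complex) \<Rightarrow>
    (real \<Rightarrow> real \<Rightarrow> complex) \<Rightarrow> bool" where
  "schroedinger \<beta> \<kappa> a A F \<longleftrightarrow>
     (\<forall>t. has_wderiv L (a t) (A t)) \<and> (\<forall>t. F t \<in> L2 M) \<and>
     (\<forall>t. ((\<lambda>s. nrm (\<lambda>x. a s x - a t x)) \<longlongrightarrow> 0) (at t)) \<and>
     (\<forall>t. ((\<lambda>s. nrm (\<lambda>x. A s x - A t x)) \<longlongrightarrow> 0) (at t)) \<and>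
     (\<forall>t. ((\<lambda>s. nrm (\<lambda>x. F s x - F t x)) \<longlongrightarrow> 0) (at t)) \<and>
     (\<forall>\<phi> t. torus_test L \<phi> \<longrightarrow>
       ((\<lambda>s. \<integral>x. a s x * \<phi> 0 x \<partial>M) has_vector_derivative
         rhs \<beta> \<kappa> (a t) (A t) (F t) (\<phi> 0) (\<phi> 1)) (at t))"

context
  fixes \<beta> \<kappa> a A F
  assumes eq: "schroedinger \<beta> \<kappa> a A F"
begin

lemma schroedinger_wderiv: "has_wderiv L (a t) (A t)"
  and schroedinger_source: "F t \<in> L2 M"
  and schroedinger_cont: "((\<lambda>s. nrm (\<lambda>x. a s x - a t x)) \<longlongrightarrow> 0) (at t)"
    "((\<lambda>s. nrm (\<lambda>x. A s x - A t x)) \<longlongrightarrow> 0) (at t)"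
    "((\<lambda>s. nrm (\<lambda>x. F s x - F t x)) \<longlongrightarrow> 0) (at t)"
  and schroedinger_test: "torus_test L \<phi> \<Longrightarrow> ((\<lambda>s. \<integral>x. a s x * \<phi> 0 x \<partial>M) has_vector_derivative
         rhs \<beta> \<kappa> (a t) (A t) (F t) (\<phi> 0) (\<phi> 1)) (at t)"
  using eq by (auto simp: schroedinger_def)

lemma schroedinger_L2: "a t \<in> L2 M" "A t \<in> L2 M"
  using wderiv_L2[OF schroedinger_wderiv] wderiv_L2'[OF schroedinger_wderiv] by auto

text \<open>
  The time derivative exists in the norm of the dual of \<open>H\<^sup>1\<close>: the error is uniform in \<open>v\<close>.  For a
  test function \<open>\<phi>\<close> the mean value inequality is applied to the pairing with \<open>\<phi>\<close> minus its
  linearization at \<open>t\<close>; the derivative of the difference is small because \<open>a\<close>, \<open>A\<close> and \<open>F\<close> are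
  continuous in time.
\<close>

lemma schroedinger_time_derivative:
  assumes e: "0 < e"
  obtains d where "0 < d" "\<And>s v h. \<bar>s - t\<bar> < d \<Longrightarrow> has_wderiv L v h \<Longrightarrow>
    cmod ((\<integral>x. (a s x - a t x) * v x \<partial>M) - of_real (s - t) * rhs \<beta> \<kappa> (a t) (A t) (F t) v h)
      \<le> e * \<bar>s - t\<bar> * (nrm v + nrm h)"
proof -
  note L2 = schroedinger_L2 schroedinger_source
  define w where "w s = rhs_const \<beta> \<kappa> * (nrm (\<lambda>x. a s x - a t x) + nrm (\<lambda>x. A s x - A t x)
    + nrm (\<lambda>x. F s x - F t x))" for s
  have "(w \<longlongrightarrow> rhs_const \<beta> \<kappa> * (0 + 0 + 0)) (at t)"
    unfolding w_def by (intro tendsto_intros schroedinger_cont)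
  then have "\<forall>\<^sub>F s in at t. w s < e" using e by (intro order_tendstoD) auto
  then obtain d where d: "0 < d" "\<And>s. s \<noteq> t \<Longrightarrow> dist s t < d \<Longrightarrow> w s < e"
    unfolding eventually_at by auto
  have "w t = 0" by (simp add: w_def norm2_def)
  then have w: "w s \<le> e" if "\<bar>s - t\<bar> < d" for s
    using d(2)[of s] that e by (cases "s = t") (auto simp: dist_real_def)
  show ?thesis
  proof (rule that[OF d(1)])
    fix s v h assume s: "\<bar>s - t\<bar> < d" and v: "has_wderiv L v h"
    show "cmod ((\<integral>x. (a s x - a t x) * v x \<partial>M) - of_real (s - t) * rhs \<beta> \<kappa> (a t) (A t) (F t) v h)
        \<le> e * \<bar>s - t\<bar> * (nrm v + nrm h)"
    proof (rule test_estimate_extends[OF L2_diff[OF L2(1) L2(1)] L2 _ v])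
      fix \<phi> assume \<phi>: "torus_test L \<phi>"
      let ?R = "\<lambda>r. rhs \<beta> \<kappa> (a r) (A r) (F r) (\<phi> 0) (\<phi> 1)"
      let ?m = "\<lambda>r. (pair (a r) (\<phi> 0)) - of_real r * ?R t"
      have "norm (?m s - ?m t) \<le> (e * (nrm (\<phi> 0) + nrm (\<phi> 1))) * \<bar>s - t\<bar>"
      proof (rule vector_derivative_bound[where S = "ball t d" and f' = "\<lambda>r. ?R r - ?R t"])
        fix r assume r: "r \<in> ball t d"
        have "((\<lambda>r. of_real r * ?R t) has_vector_derivative ?R t) (at r)"
          by (auto intro!: derivative_eq_intros has_vector_derivative_real_field)
        then show "(?m has_vector_derivative ?R r - ?R t) (at r)"
          by (intro has_vector_derivative_diff schroedinger_test[OF \<phi>])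
        have "norm (?R r - ?R t) \<le> w r * (nrm (\<phi> 0) + nrm (\<phi> 1))"
          unfolding w_def
          by (subst rhs_diff_left) (intro rhs_bound L2_diff L2 test_L2[OF \<phi>])+
        also have "\<dots> \<le> e * (nrm (\<phi> 0) + nrm (\<phi> 1))"
          using w[of r] r by (intro mult_right_mono) (auto simp: dist_real_def)
        finally show "norm (?R r - ?R t) \<le> e * (nrm (\<phi> 0) + nrm (\<phi> 1))" .
      qed (use s d in \<open>auto simp: dist_real_def\<close>)
      moreover have "?m s - ?m t = (\<integral>x. (a s x - a t x) * \<phi> 0 x \<partial>M) - of_real (s - t) * ?R t"
        by (simp add: left_diff_distrib L2_mult_integrable L2 test_L2[OF \<phi>])
      ultimately show "cmod ((\<integral>x. (a s x - a t x) * \<phi> 0 x \<partial>M) - of_real (s - t) * ?R t)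
          \<le> e * \<bar>s - t\<bar> * (nrm (\<phi> 0) + nrm (\<phi> 1))"
        by (simp add: mult_ac)
    qed
  qed
qed

lemma schroedinger_Lipschitz:
  assumes K: "\<And>s. s \<in> {p..q} \<Longrightarrow> nrm (a s) + nrm (A s) + nrm (F s) \<le> K"
    and s: "s \<in> {p..q}" and t: "t \<in> {p..q}" and v: "has_wderiv L v h"
  shows "cmod (\<integral>x. (a s x - a t x) * v x \<partial>M) \<le> rhs_const \<beta> \<kappa> * K * \<bar>s - t\<bar> * (nrm v + nrm h)"
proof -
  note L2 = schroedinger_L2 schroedinger_source
  have "cmod ((\<integral>x. (a s x - a t x) * v x \<partial>M) - 0 * rhs \<beta> \<kappa> (a t) (A t) (F t) v h)
      \<le> rhs_const \<beta> \<kappa> * K * \<bar>s - t\<bar> * (nrm v + nrm h)"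
  proof (rule test_estimate_extends[OF L2_diff[OF L2(1) L2(1)] L2 _ v])
    fix \<phi> assume \<phi>: "torus_test L \<phi>"
    let ?m = "\<lambda>r. (pair (a r) (\<phi> 0))"
    have "norm (?m s - ?m t) \<le> (rhs_const \<beta> \<kappa> * K * (nrm (\<phi> 0) + nrm (\<phi> 1))) * \<bar>s - t\<bar>"
    proof (rule vector_derivative_bound[where S = "{p..q}", OF _ s t schroedinger_test[OF \<phi>]])
      fix r assume r: "r \<in> {p..q}"
      have "norm (rhs \<beta> \<kappa> (a r) (A r) (F r) (\<phi> 0) (\<phi> 1))
          \<le> rhs_const \<beta> \<kappa> * (nrm (a r) + nrm (A r) + nrm (F r)) * (nrm (\<phi> 0) + nrm (\<phi> 1))"
        by (intro rhs_bound L2 test_L2[OF \<phi>])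
      also have "\<dots> \<le> rhs_const \<beta> \<kappa> * K * (nrm (\<phi> 0) + nrm (\<phi> 1))"
        using K[OF r] rhs_const_pos[of \<beta> \<kappa>] by (intro mult_right_mono mult_left_mono) auto
      finally show "norm (rhs \<beta> \<kappa> (a r) (A r) (F r) (\<phi> 0) (\<phi> 1))
          \<le> rhs_const \<beta> \<kappa> * K * (nrm (\<phi> 0) + nrm (\<phi> 1))" .
    qed auto
    moreover have "?m s - ?m t = (\<integral>x. (a s x - a t x) * \<phi> 0 x \<partial>M)"
      by (simp add: left_diff_distrib L2_mult_integrable L2 test_L2[OF \<phi>])
    ultimately show "cmod ((\<integral>x. (a s x - a t x) * \<phi> 0 x \<partial>M) - 0 * rhs \<beta> \<kappa> (a t) (A t) (F t) (\<phi> 0) (\<phi> 1))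
        \<le> rhs_const \<beta> \<kappa> * K * \<bar>s - t\<bar> * (nrm (\<phi> 0) + nrm (\<phi> 1))"
      by (simp add: mult_ac)
  qed
  then show ?thesis by simp
qed

text \<open>
  Uniformity in \<open>v\<close> makes it harmless that \<open>v\<close> moves with time.
\<close>

lemma schroedinger_quotient_tendsto:
  assumes v: "\<And>s. has_wderiv L (v s) (h s)"
    and lim: "((\<lambda>s. nrm (\<lambda>x. v s x - v t x)) \<longlongrightarrow> 0) (at t)" "((\<lambda>s. nrm (\<lambda>x. h s x - h t x)) \<longlongrightarrow> 0) (at t)"
  shows "((\<lambda>s. (\<integral>x. (a s x - a t x) * v s x \<partial>M) / of_real (s - t)) \<longlongrightarrow>
    rhs \<beta> \<kappa> (a t) (A t) (F t) (v t) (h t)) (at t)"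
proof -
  note L2 = schroedinger_L2 schroedinger_source
  note vL2 = wderiv_L2[OF v] wderiv_L2'[OF v]
  let ?R = "\<lambda>s. rhs \<beta> \<kappa> (a t) (A t) (F t) (v s) (h s)"
  let ?q = "\<lambda>s. (\<integral>x. (a s x - a t x) * v s x \<partial>M) / of_real (s - t)"
  define K where "K = nrm (v t) + nrm (h t) + 2"
  have K: "0 < K" by (simp add: K_def add_nonneg_pos)
  have "\<forall>\<^sub>F s in at t. nrm (\<lambda>x. v s x - v t x) < 1" "\<forall>\<^sub>F s in at t. nrm (\<lambda>x. h s x - h t x) < 1"
    using lim by (auto intro: order_tendstoD)
  then have K_bound: "\<forall>\<^sub>F s in at t. nrm (v s) + nrm (h s) \<le> K"
  proof eventually_elim
    case (elim s)
    then show ?case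
      using norm2_reverse_triangle[OF vL2(1) vL2(1), of s t] norm2_reverse_triangle[OF vL2(2) vL2(2), of s t]
      by (simp add: K_def)
  qed
  have "((\<lambda>s. ?q s - ?R s) \<longlongrightarrow> 0) (at t)"
  proof (rule tendstoI)
    fix e :: real assume e: "0 < e"
    define e' where "e' = e / (2 * K)"
    have e': "0 < e'" using e K by (simp add: e'_def)
    obtain d where d: "0 < d" "\<And>s v h. \<bar>s - t\<bar> < d \<Longrightarrow> has_wderiv L v h \<Longrightarrow>
        cmod ((\<integral>x. (a s x - a t x) * v x \<partial>M) - of_real (s - t) * rhs \<beta> \<kappa> (a t) (A t) (F t) v h)
          \<le> e' * \<bar>s - t\<bar> * (nrm v + nrm h)"
      using schroedinger_time_derivative[OF e'] by blast
    have "\<forall>\<^sub>F s in at t. \<bar>s - t\<bar> < d \<and> s \<noteq> t"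
      using d(1) by (auto simp: eventually_at dist_real_def intro!: exI[of _ d])
    then show "\<forall>\<^sub>F s in at t. dist (?q s - ?R s) 0 < e"
      using K_bound
    proof eventually_elim
      case (elim s)
      then have pos: "0 < \<bar>s - t\<bar>" by simp
      have "?q s - ?R s = ((\<integral>x. (a s x - a t x) * v s x \<partial>M) - of_real (s - t) * ?R s) / of_real (s - t)"
        using elim by (simp add: field_simps flip: of_real_diff)
      then have "cmod (?q s - ?R s)
          = cmod ((\<integral>x. (a s x - a t x) * v s x \<partial>M) - of_real (s - t) * ?R s) / \<bar>s - t\<bar>"
        by (simp add: norm_divide flip: of_real_diff)
      also have "\<dots> \<le> (e' * \<bar>s - t\<bar> * (nrm (v s) + nrm (h s))) / \<bar>s - t\<bar>"
        using d(2)[OF _ v[of s]] elim by (intro divide_right_mono) auto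
      also have "\<dots> = e' * (nrm (v s) + nrm (h s))" using pos by simp
      also have "\<dots> \<le> e' * K" using elim e' by (intro mult_left_mono) auto
      also have "\<dots> < e" using e K by (simp add: e'_def)
      finally show ?case by simp
    qed
  qed
  moreover have "(?R \<longlongrightarrow> ?R t) (at t)"
    by (intro rhs_tendsto L2 vL2 lim)
  ultimately have "((\<lambda>s. (?q s - ?R s) + ?R s) \<longlongrightarrow> 0 + ?R t) (at t)"
    by (rule tendsto_add)
  then show ?thesis by simp
qed

end

text \<open>
  The linear part of the equation is skew-adjoint, so that it cancels from the derivative of an
  inner product of two solutions.  With \<open>b = a\<close> this gives the conservation of mass, with a time
  shift of \<open>a\<close> for \<open>b\<close> the conservation of energy.
\<close>

lemma schroedinger_product_derivative:
  assumes a: "schroedinger \<beta> \<kappa> a A F" and b: "schroedinger \<beta> \<kappa> b B G"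
  shows "((\<lambda>t. \<integral>x. a t x * cnj (b t x) \<partial>M) has_vector_derivative
    \<i> * (ip (F t) (b t) - ip (a t) (G t))) (at t)"
  unfolding has_vector_derivative_iff_quotient
proof -
  note aL2 = schroedinger_L2[OF a] schroedinger_source[OF a]
  note bL2 = schroedinger_L2[OF b] schroedinger_source[OF b]
  note aW = schroedinger_wderiv[OF a] and bW = schroedinger_wderiv[OF b]
  have cnj_lim: "((\<lambda>s. nrm (\<lambda>x. cnj (f s x) - cnj (f t x))) \<longlongrightarrow> 0) (at t)"
    if "((\<lambda>s. nrm (\<lambda>x. f s x - f t x)) \<longlongrightarrow> 0) (at t)" for f t
    using that norm2_cnj[of M "\<lambda>x. f s x - f t x" for s] by simp
  have "((\<lambda>s. (\<integral>x. (a s x - a t x) * cnj (b s x) \<partial>M) / of_real (s - t)) \<longlongrightarrow>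
      rhs \<beta> \<kappa> (a t) (A t) (F t) (\<lambda>x. cnj (b t x)) (\<lambda>x. cnj (B t x))) (at t)"
    by (intro schroedinger_quotient_tendsto[OF a] wderiv_cnj bW cnj_lim schroedinger_cont[OF b])
  moreover have "((\<lambda>s. cnj ((\<integral>x. (b s x - b t x) * cnj (a t x) \<partial>M) / of_real (s - t))) \<longlongrightarrow>
      cnj (rhs \<beta> \<kappa> (b t) (B t) (G t) (\<lambda>x. cnj (a t x)) (\<lambda>x. cnj (A t x)))) (at t)"
    by (intro tendsto_cnj schroedinger_quotient_tendsto[OF b, where v = "\<lambda>_ x. cnj (a t x)"] wderiv_cnj aW)
      (simp_all add: norm2_def)
  ultimately have "((\<lambda>s. (\<integral>x. (a s x - a t x) * cnj (b s x) \<partial>M) / of_real (s - t)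
      + cnj ((\<integral>x. (b s x - b t x) * cnj (a t x) \<partial>M) / of_real (s - t))) \<longlongrightarrow>
      rhs \<beta> \<kappa> (a t) (A t) (F t) (\<lambda>x. cnj (b t x)) (\<lambda>x. cnj (B t x))
      + cnj (rhs \<beta> \<kappa> (b t) (B t) (G t) (\<lambda>x. cnj (a t x)) (\<lambda>x. cnj (A t x)))) (at t)"
    by (rule tendsto_add)
  moreover have "(\<integral>x. (a s x - a t x) * cnj (b s x) \<partial>M) / of_real (s - t)
      + cnj ((\<integral>x. (b s x - b t x) * cnj (a t x) \<partial>M) / of_real (s - t))
      = (ip (a s) (b s) - ip (a t) (b t)) / of_real (s - t)" for s
  proof -
    have "cnj (\<integral>x. (b s x - b t x) * cnj (a t x) \<partial>M) = (\<integral>x. a t x * cnj (b s x) - a t x * cnj (b t x) \<partial>M)"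
      by (simp add: algebra_simps flip: Bochner_Integration.integral_cnj)
    then show ?thesis
      by (simp add: left_diff_distrib L2_mult_integrable aL2 bL2 L2_cnj flip: add_divide_distrib)
  qed
  moreover have "rhs \<beta> \<kappa> (a t) (A t) (F t) (\<lambda>x. cnj (b t x)) (\<lambda>x. cnj (B t x))
      + cnj (rhs \<beta> \<kappa> (b t) (B t) (G t) (\<lambda>x. cnj (a t x)) (\<lambda>x. cnj (A t x)))
      = \<i> * (ip (F t) (b t) - ip (a t) (G t))"
  proof -
    have c: "cnj (ip f g) = ip g f" for f g
      by (simp add: mult.commute flip: Bochner_Integration.integral_cnj)
    have parts: "ip (a t) (B t) = - ip (A t) (b t)"
      by (rule integration_by_parts[OF aW wderiv_cnj[OF bW]])
    show ?thesis
      by (simp add: rhs_def c parts) (simp add: algebra_simps)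
  qed
  ultimately show "((\<lambda>s. (ip (a s) (b s) - ip (a t) (b t)) / of_real (s - t))
      \<longlongrightarrow> \<i> * (ip (F t) (b t) - ip (a t) (G t))) (at t)"
    by simp
qed

end

section \<open>Functions of time\<close>

text \<open>
  The Heine--Cantor theorem for a curve whose target is only known through the distances
  \<open>D s t\<close> of its points.  It will be applied to a solution as a curve in \<open>H\<^sup>1\<close>.
\<close>

lemma pseudometric_path_uniformly_continuous:
  fixes D :: "real \<Rightarrow> real \<Rightarrow> real"
  assumes tri: "\<And>r s t. D r t \<le> D r s + D s t" and sym: "\<And>s t. D s t = D t s"
    and D0: "\<And>t. D t t = 0"
    and cont: "\<And>t. ((\<lambda>s. D s t) \<longlongrightarrow> 0) (at t)" and e: "0 < e"
  obtains d where "0 < d" "\<And>s t. s \<in> {p..q} \<Longrightarrow> \<bar>t - s\<bar> < d \<Longrightarrow> D t s < e"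
proof -
  have "\<exists>d>0. \<forall>s. \<bar>s - t\<bar> < d \<longrightarrow> D s t < e / 2" for t
  proof -
    have "\<forall>\<^sub>F s in at t. D s t < e / 2" using cont e by (intro order_tendstoD) auto
    then obtain d where "0 < d" "\<And>s. s \<noteq> t \<Longrightarrow> dist s t < d \<Longrightarrow> D s t < e / 2"
      unfolding eventually_at by auto
    then show ?thesis using D0[of t] e by (intro exI[of _ d]) (metis dist_real_def half_gt_zero)
  qed
  then obtain w where w: "\<And>t. 0 < w t" "\<And>s t. \<bar>s - t\<bar> < w t \<Longrightarrow> D s t < e / 2" by metis
  have "{p..q} \<subseteq> \<Union> (range (\<lambda>t. ball t (w t)))" 
  proof
    fix t assume "t \<in> {p..q}"
    have "t \<in> ball t (w t)" using w(1) by simp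
    then show "t \<in> \<Union> (range (\<lambda>t. ball t (w t)))" by blast
  qed
  then obtain d where d: "0 < d" "\<And>x. x \<in> {p..q} \<Longrightarrow> \<exists>G\<in>range (\<lambda>t. ball t (w t)). ball x d \<subseteq> G"
    by (rule Heine_Borel_lemma[OF compact_Icc]) auto
  show ?thesis
  proof (rule that[OF d(1)])
    fix s t assume s: "s \<in> {p..q}" and t: "\<bar>t - s\<bar> < d"
    obtain r where "ball s d \<subseteq> ball r (w r)" using d(2)[OF s] by auto
    moreover have "s \<in> ball s d" "t \<in> ball s d" using d(1) t by (auto simp: dist_real_def)
    ultimately have "s \<in> ball r (w r)" "t \<in> ball r (w r)" by blast+
    then have "\<bar>s - r\<bar> < w r" "\<bar>t - r\<bar> < w r" by (auto simp: dist_real_def)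
    then show "D t s < e" using w(2)[of s r] w(2)[of t r] tri[of t s r] sym[of r s] by simp
  qed
qed

text \<open>
  The energy is quadratic in first derivatives, while the time derivative of a solution only lies in
  the dual of \<open>H\<^sup>1\<close>; so it cannot be differentiated term by term.  The substitute is a correlation
  \<open>J h t\<close> of the solution at \<open>t + h\<close> and \<open>t\<close>, in which no space derivative occurs.  Its quotient by
  \<open>h\<close> tends to a function \<open>e\<close> that contains the kinetic energy, and its derivative in \<open>t\<close> is, up to a
  remainder of order smaller than \<open>h\<close>, half a difference of the potential energy \<open>g\<close>.  After
  subtraction of a moving average of \<open>g\<close> the quotient has small derivative, and the limit is
  constant.
\<close>

lemma conservation_by_time_shift:
  fixes J :: "real \<Rightarrow> real \<Rightarrow> real"
  assumes J: "\<And>h t. (J h has_real_derivative (g (t + h) - g t) / 2 - r h t) (at t)"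
    and g: "continuous_on UNIV g"
    and lim: "\<And>t. ((\<lambda>h. J h t / h) \<longlongrightarrow> e t) (at 0)"
    and small: "\<And>p q \<epsilon>. 0 < \<epsilon> \<Longrightarrow> \<exists>d>0. \<forall>h t. 0 < h \<longrightarrow> h < d \<longrightarrow> t \<in> {p..q} \<longrightarrow> \<bar>r h t\<bar> \<le> \<epsilon> * h"
  shows "e s - g s / 2 = e t - g t / 2"
proof -
  have main: "e q - g q / 2 = e p - g p / 2" if pq: "p < q" for p q
  proof -
    obtain P where P: "\<And>x. x \<in> {p - 1..q + 1} \<Longrightarrow> (P has_vector_derivative g x) (at x within {p - 1..q + 1})"
      using antiderivative_continuous[of "p - 1" "q + 1" g] g continuous_on_subset by blast
    have P: "(P has_real_derivative g x) (at x)" if "x \<in> {p - 1<..<q + 1}" for x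
    proof -
      have "(P has_vector_derivative g x) (at x within {p - 1<..<q + 1})"
        using that by (intro has_vector_derivative_within_subset[OF P]) auto
      then show ?thesis
        using that by (simp add: at_within_open[OF that] has_real_derivative_iff_has_vector_derivative)
    qed
    define \<Psi> where "\<Psi> h t = J h t / h - (P (t + h) - P t) / h / 2" for h t
    have lim\<Psi>: "((\<lambda>h. \<Psi> h t) \<longlongrightarrow> e t - g t / 2) (at_right 0)" if "t \<in> {p..q}" for t
    proof -
      have "((\<lambda>h. (P (t + h) - P t) / h) \<longlongrightarrow> g t) (at 0)"
        using P[of t] that by (simp add: DERIV_def)
      then have "((\<lambda>h. \<Psi> h t) \<longlongrightarrow> e t - g t / 2) (at 0)"
        unfolding \<Psi>_def by (intro tendsto_intros lim) auto
      then show ?thesis by (rule tendsto_within_subset) auto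
    qed
    have bound: "\<bar>(e q - g q / 2) - (e p - g p / 2)\<bar> \<le> \<epsilon> * (q - p)" if \<epsilon>: "0 < \<epsilon>" for \<epsilon>
    proof (rule tendsto_upperbound)
      show "((\<lambda>h. \<bar>\<Psi> h q - \<Psi> h p\<bar>) \<longlongrightarrow> \<bar>(e q - g q / 2) - (e p - g p / 2)\<bar>) (at_right 0)"
        using pq by (intro tendsto_intros lim\<Psi>) auto
      obtain d where d: "0 < d" "\<And>h t. 0 < h \<Longrightarrow> h < d \<Longrightarrow> t \<in> {p..q} \<Longrightarrow> \<bar>r h t\<bar> \<le> \<epsilon> * h"
        using small[OF \<epsilon>] by blast
      have "\<bar>\<Psi> h q - \<Psi> h p\<bar> \<le> \<epsilon> * (q - p)" if h: "0 < h" "h < min d 1" for h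
      proof -
        have "norm (\<Psi> h q - \<Psi> h p) \<le> \<epsilon> * norm (q - p)"
        proof (rule field_differentiable_bound[where S = "{p..q}" and f' = "\<lambda>t. - r h t / h"])
          fix t assume t: "t \<in> {p..q}"
          have "((\<lambda>t. P (t + h)) has_real_derivative g (t + h)) (at t)"
            using P[of "t + h"] t h DERIV_shift[of P "g (t + h)" t h] by (simp add: add.commute)
          moreover have "(P has_real_derivative g t) (at t)" using t by (intro P) auto
          ultimately have "(\<Psi> h has_real_derivative
              ((g (t + h) - g t) / 2 - r h t) / h - (g (t + h) - g t) / h / 2) (at t)"
            unfolding \<Psi>_def by (intro DERIV_diff DERIV_cdivide J)
          also have "((g (t + h) - g t) / 2 - r h t) / h - (g (t + h) - g t) / h / 2 = - r h t / h"
            by (simp add: diff_divide_distrib)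
          finally show "(\<Psi> h has_field_derivative - r h t / h) (at t within {p..q})"
            by (rule has_field_derivative_at_within)
          show "norm (- r h t / h) \<le> \<epsilon>"
            using d(2)[of h t] h t by (simp add: divide_le_eq)
        qed (use pq in auto)
        then show ?thesis using pq by simp
      qed
      then show "\<forall>\<^sub>F h in at_right 0. \<bar>\<Psi> h q - \<Psi> h p\<bar> \<le> \<epsilon> * (q - p)"
        using d(1) by (auto simp: eventually_at_right_field intro!: exI[of _ "min d 1"])
    qed auto
    have "\<bar>(e q - g q / 2) - (e p - g p / 2)\<bar> \<le> 0"
    proof (rule field_le_epsilon)
      fix \<epsilon> :: real assume "0 < \<epsilon>"
      then show "\<bar>(e q - g q / 2) - (e p - g p / 2)\<bar> \<le> 0 + \<epsilon>"
        using bound[of "\<epsilon> / (q - p)"] pq by simp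
    qed
    then show ?thesis by simp
  qed
  then show ?thesis using main[of s t] main[of t s] by (cases s t rule: linorder_cases) auto
qed

section \<open>Conservation of mass and energy\<close>

text \<open>
  The factor by which the cubic term multiplies a component; \<open>p\<close> is its self-interaction constant
  and \<open>q\<close> the coupling constant.
\<close>

definition potential :: "real \<Rightarrow> real \<Rightarrow> complex \<Rightarrow> complex \<Rightarrow> real" where
  "potential p q z w = p * (cmod z)\<^sup>2 + q * (cmod w)\<^sup>2"

lemma potential_bound:
  assumes "cmod z \<le> B" "cmod w \<le> B"
  shows "\<bar>potential p q z w\<bar> \<le> (\<bar>p\<bar> + \<bar>q\<bar>) * B\<^sup>2"
proof -
  have "\<bar>potential p q z w\<bar> \<le> \<bar>p\<bar> * (cmod z)\<^sup>2 + \<bar>q\<bar> * (cmod w)\<^sup>2"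
    unfolding potential_def by (rule order_trans[OF abs_triangle_ineq]) (simp add: abs_mult)
  also have "\<dots> \<le> \<bar>p\<bar> * B\<^sup>2 + \<bar>q\<bar> * B\<^sup>2"
    using assms by (intro add_mono mult_left_mono power_mono) auto
  finally show ?thesis by (simp add: distrib_right)
qed

lemma cmod_sq_mult_diff_bound:
  assumes "cmod x \<le> B" "cmod x' \<le> B" "cmod y \<le> B" "cmod y' \<le> B"
  shows "cmod (of_real ((cmod x')\<^sup>2) * x - of_real ((cmod y')\<^sup>2) * y)
    \<le> 2 * B\<^sup>2 * (cmod (x - y) + cmod (x' - y'))"
proof -
  have B: "0 \<le> B" using assms(1) norm_ge_zero order_trans by blast
  have "of_real ((cmod x')\<^sup>2) * x - of_real ((cmod y')\<^sup>2) * y =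
      of_real ((cmod x')\<^sup>2) * (x - y) + of_real ((cmod x' - cmod y') * (cmod x' + cmod y')) * y"
    by (simp add: algebra_simps power2_eq_square)
  then have "cmod (of_real ((cmod x')\<^sup>2) * x - of_real ((cmod y')\<^sup>2) * y) \<le>
      (cmod x')\<^sup>2 * cmod (x - y) + \<bar>cmod x' - cmod y'\<bar> * (cmod x' + cmod y') * cmod y"
    by (metis (no_types, lifting) norm_triangle_ineq norm_mult norm_of_real abs_mult abs_power2
        abs_of_nonneg add_nonneg_nonneg norm_ge_zero)
  also have "\<dots> \<le> B\<^sup>2 * cmod (x - y) + cmod (x' - y') * (B + B) * B"
    using assms B by (intro add_mono mult_mono power_mono norm_triangle_ineq3) auto
  also have "\<dots> \<le> 2 * B\<^sup>2 * (cmod (x - y) + cmod (x' - y'))"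
  proof -
    have "0 \<le> B\<^sup>2 * cmod (x - y)" by simp
    then show ?thesis by (simp add: power2_eq_square algebra_simps)
  qed
  finally show ?thesis .
qed

lemma potential_mult_diff_bound:
  assumes "cmod x \<le> B" "cmod x' \<le> B" "cmod y \<le> B" "cmod y' \<le> B"
  shows "cmod (of_real (potential p q x x') * x - of_real (potential p q y y') * y)
    \<le> 4 * (\<bar>p\<bar> + \<bar>q\<bar>) * B\<^sup>2 * (cmod (x - y) + cmod (x' - y'))"
proof -
  have "of_real (potential p q x x') * x - of_real (potential p q y y') * y =
      of_real p * (of_real ((cmod x)\<^sup>2) * x - of_real ((cmod y)\<^sup>2) * y)
      + of_real q * (of_real ((cmod x')\<^sup>2) * x - of_real ((cmod y')\<^sup>2) * y)"
    by (simp add: potential_def algebra_simps)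
  then have "cmod (of_real (potential p q x x') * x - of_real (potential p q y y') * y) \<le>
      \<bar>p\<bar> * cmod (of_real ((cmod x)\<^sup>2) * x - of_real ((cmod y)\<^sup>2) * y)
      + \<bar>q\<bar> * cmod (of_real ((cmod x')\<^sup>2) * x - of_real ((cmod y')\<^sup>2) * y)"
    by (metis (no_types, lifting) norm_triangle_ineq norm_mult norm_of_real)
  also have "\<dots> \<le> \<bar>p\<bar> * (2 * B\<^sup>2 * (cmod (x - y) + cmod (x - y)))
      + \<bar>q\<bar> * (2 * B\<^sup>2 * (cmod (x - y) + cmod (x' - y')))"
    using assms by (intro add_mono mult_left_mono cmod_sq_mult_diff_bound) auto
  also have "\<dots> \<le> \<bar>p\<bar> * (4 * B\<^sup>2 * (cmod (x - y) + cmod (x' - y')))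
      + \<bar>q\<bar> * (4 * B\<^sup>2 * (cmod (x - y) + cmod (x' - y')))"
  proof (intro add_mono mult_left_mono)
    show "2 * B\<^sup>2 * (cmod (x - y) + cmod (x - y)) \<le> 4 * B\<^sup>2 * (cmod (x - y) + cmod (x' - y'))"
      "2 * B\<^sup>2 * (cmod (x - y) + cmod (x' - y')) \<le> 4 * B\<^sup>2 * (cmod (x - y) + cmod (x' - y'))"
      by (simp_all add: algebra_simps)
  qed auto
  also have "\<dots> = 4 * (\<bar>p\<bar> + \<bar>q\<bar>) * B\<^sup>2 * (cmod (x - y) + cmod (x' - y'))"
    by (simp add: algebra_simps)
  finally show ?thesis .
qed

context torus
begin

lemma schroedinger_shift:
  assumes "schroedinger \<beta> \<kappa> a A F"
  shows "schroedinger \<beta> \<kappa> (\<lambda>t. a (t + h)) (\<lambda>t. A (t + h)) (\<lambda>t. F (t + h))"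
proof -
  have lim: "((\<lambda>s. nrm (\<lambda>x. f (s + h) x - f (t + h) x)) \<longlongrightarrow> 0) (at t)"
    if "\<And>t. ((\<lambda>s. nrm (\<lambda>x. f s x - f t x)) \<longlongrightarrow> 0) (at t)" for f t
    using LIM_offset[OF that[of "t + h"], of h] by simp
  have deriv: "((\<lambda>s. f (s + h)) has_vector_derivative D) (at t)"
    if "(f has_vector_derivative D) (at (t + h))" for f :: "real \<Rightarrow> complex" and D t
  proof -
    have "((f \<circ> (\<lambda>s. s + h)) has_vector_derivative 1 *\<^sub>R D) (at t)"
      using that by (intro vector_diff_chain_at) (auto intro!: derivative_eq_intros)
    then show ?thesis by (simp add: o_def)
  qed
  show ?thesis
    using assms unfolding schroedinger_def by (auto intro!: lim deriv)
qed

text \<open>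
  This is \<open>\<beta>\<close> times the squared norm of \<open>a' + \<i> \<kappa> a\<close>, up to a multiple of the mass of \<open>a\<close>.
\<close>

definition kinetic :: "real \<Rightarrow> real \<Rightarrow> (real \<Rightarrow> complex) \<Rightarrow> real" where
  "kinetic \<beta> \<kappa> a = \<beta> * ((nrm (weak_deriv L a))\<^sup>2 + 2 * \<kappa> * Im (ip (weak_deriv L a) a))"

definition quartic :: "real \<Rightarrow> real \<Rightarrow> real \<Rightarrow> complex \<Rightarrow> complex \<Rightarrow> real" where
  "quartic \<alpha> \<gamma> \<delta> z w = \<alpha> * (cmod z)^4 + 2 * \<delta> * (cmod z)\<^sup>2 * (cmod w)\<^sup>2 + \<gamma> * (cmod w)^4"

definition energy :: "real \<Rightarrow> real \<Rightarrow> real \<Rightarrow> real \<Rightarrow> real \<Rightarrow> state \<Rightarrow> real" where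
  "energy \<beta> k \<alpha> \<gamma> \<delta> v = kinetic \<beta> k (fst v) + kinetic \<beta> (- k) (snd v)
    - (\<integral>x. quartic \<alpha> \<gamma> \<delta> (fst v x) (snd v x) \<partial>M) / 2"

lemma distE_eq: "distE L u v = sqrt ((h1 L (\<lambda>x. fst u x - fst v x))\<^sup>2 + (h1 L (\<lambda>x. snd u x - snd v x))\<^sup>2)"
  by (simp add: distE_def h1_sq)

lemma h1_le_distE: "h1 L (\<lambda>x. fst u x - fst v x) \<le> distE L u v" "h1 L (\<lambda>x. snd u x - snd v x) \<le> distE L u v"
  by (auto simp: distE_eq intro!: real_le_rsqrt)

context
  fixes \<beta> k \<alpha> \<gamma> \<delta> :: real and u :: "real \<Rightarrow> state"
  assumes sol: "nls_solution L \<beta> k \<alpha> \<gamma> \<delta> u"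
begin

abbreviation "a1 t \<equiv> fst (u t)"
abbreviation "a2 t \<equiv> snd (u t)"
abbreviation "A1 t \<equiv> weak_deriv L (fst (u t))"
abbreviation "A2 t \<equiv> weak_deriv L (snd (u t))"
abbreviation "n1 t x \<equiv> potential \<alpha> \<delta> (a1 t x) (a2 t x)"
abbreviation "n2 t x \<equiv> potential \<gamma> \<delta> (a2 t x) (a1 t x)"
abbreviation "F1 t x \<equiv> of_real (n1 t x) * a1 t x"
abbreviation "F2 t x \<equiv> of_real (n2 t x) * a2 t x"

definition path_dist :: "real \<Rightarrow> real \<Rightarrow> real" where
  "path_dist s t = h1 L (\<lambda>x. a1 s x - a1 t x) + h1 L (\<lambda>x. a2 s x - a2 t x)"

lemma sol_H1: "a1 t \<in> H1 L" "a2 t \<in> H1 L"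
  using sol by (auto simp: nls_solution_def phase_space_def mem_Times_iff)

lemma sol_wderiv: "has_wderiv L (a1 t) (A1 t)" "has_wderiv L (a2 t) (A2 t)"
  by (intro has_wderiv_weak_deriv sol_H1)+

lemma sol_cont: "continuous_on X (a1 t)" "continuous_on X (a2 t)"
  by (intro wderiv_continuous[OF sol_wderiv(1)] wderiv_continuous[OF sol_wderiv(2)])+

lemma path_dist_nonneg: "0 \<le> path_dist s t"
  by (simp add: path_dist_def h1_nonneg)

lemma path_dist_self: "path_dist t t = 0"
  by (simp add: path_dist_def h1_eq[OF wderiv_const] norm2_def)

lemma path_dist_sym: "path_dist s t = path_dist t s"
  unfolding path_dist_def using h1_minus_commute[OF sol_H1(1) sol_H1(1)] h1_minus_commute[OF sol_H1(2) sol_H1(2)]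
  by metis

lemma path_dist_triangle: "path_dist r t \<le> path_dist r s + path_dist s t"
  unfolding path_dist_def using h1_triangle_diff[OF sol_H1(1)[of r] sol_H1(1)[of s] sol_H1(1)[of t]]
    h1_triangle_diff[OF sol_H1(2)[of r] sol_H1(2)[of s] sol_H1(2)[of t]] by linarith

lemma path_dist_tendsto: "((\<lambda>s. path_dist s t) \<longlongrightarrow> 0) (at t)"
proof (rule Lim_null_comparison)
  show "\<forall>\<^sub>F s in at t. norm (path_dist s t) \<le> 2 * distE L (u s) (u t)"
  proof (intro always_eventually allI)
    show "norm (path_dist s t) \<le> 2 * distE L (u s) (u t)" for s
      using path_dist_nonneg[of s t] h1_le_distE[of "u s" "u t"] by (simp add: path_dist_def)
  qed
  have "((\<lambda>s. distE L (u s) (u t)) \<longlongrightarrow> 0) (at t)"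
    using sol by (simp add: nls_solution_def)
  then show "((\<lambda>s. 2 * distE L (u s) (u t)) \<longlongrightarrow> 0) (at t)"
    using tendsto_mult_left[of _ 0 _ 2] by force
qed

lemma path_dist_bounds:
  "h1 L (\<lambda>x. a1 s x - a1 t x) \<le> path_dist s t" "h1 L (\<lambda>x. a2 s x - a2 t x) \<le> path_dist s t"
  "nrm (\<lambda>x. a1 s x - a1 t x) \<le> path_dist s t" "nrm (\<lambda>x. a2 s x - a2 t x) \<le> path_dist s t"
  "nrm (\<lambda>x. A1 s x - A1 t x) \<le> path_dist s t" "nrm (\<lambda>x. A2 s x - A2 t x) \<le> path_dist s t"
proof -
  note w1 = wderiv_diff[OF sol_wderiv(1)[of s] sol_wderiv(1)[of t]]
  note w2 = wderiv_diff[OF sol_wderiv(2)[of s] sol_wderiv(2)[of t]]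
  show 1: "h1 L (\<lambda>x. a1 s x - a1 t x) \<le> path_dist s t" and 2: "h1 L (\<lambda>x. a2 s x - a2 t x) \<le> path_dist s t"
    by (simp_all add: path_dist_def h1_nonneg)
  show "nrm (\<lambda>x. a1 s x - a1 t x) \<le> path_dist s t" "nrm (\<lambda>x. A1 s x - A1 t x) \<le> path_dist s t"
    using nrm_le_h1[OF w1] nrm_wderiv_le_h1[OF w1] 1 by linarith+
  show "nrm (\<lambda>x. a2 s x - a2 t x) \<le> path_dist s t" "nrm (\<lambda>x. A2 s x - A2 t x) \<le> path_dist s t"
    using nrm_le_h1[OF w2] nrm_wderiv_le_h1[OF w2] 2 by linarith+
qed

lemma path_dist_sup: "cmod (a1 s x - a1 t x) \<le> Sob * path_dist s t" "cmod (a2 s x - a2 t x) \<le> Sob * path_dist s t"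
  using order_trans[OF Sobolev[OF H1_diff[OF sol_H1(1) sol_H1(1)]] mult_left_mono[OF path_dist_bounds(1)]]
    order_trans[OF Sobolev[OF H1_diff[OF sol_H1(2) sol_H1(2)]] mult_left_mono[OF path_dist_bounds(2)]] Sob_pos
  by (auto intro: less_imp_le)

text \<open>The \<open>H\<^sup>1\<close> distance to the state at time \<open>p\<close> is continuous in time.\<close>

lemma sol_bounded:
  obtains B where "0 < B"
    "\<And>t x. t \<in> {p..q} \<Longrightarrow> cmod (a1 t x) \<le> B" "\<And>t x. t \<in> {p..q} \<Longrightarrow> cmod (a2 t x) \<le> B"
    "\<And>t. t \<in> {p..q} \<Longrightarrow> nrm (a1 t) \<le> B" "\<And>t. t \<in> {p..q} \<Longrightarrow> nrm (a2 t) \<le> B"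
    "\<And>t. t \<in> {p..q} \<Longrightarrow> nrm (A1 t) \<le> B" "\<And>t. t \<in> {p..q} \<Longrightarrow> nrm (A2 t) \<le> B"
proof -
  have "isCont (\<lambda>t. path_dist t p) t" for t
  proof -
    have "((\<lambda>s. path_dist s p - path_dist t p) \<longlongrightarrow> 0) (at t)"
    proof (rule Lim_null_comparison[OF _ path_dist_tendsto[of t]])
      have "norm (path_dist s p - path_dist t p) \<le> path_dist s t" for s
        using path_dist_triangle[of s p t] path_dist_triangle[of t p s] path_dist_sym[of s t] by simp
      then show "\<forall>\<^sub>F s in at t. norm (path_dist s p - path_dist t p) \<le> path_dist s t" by simp
    qed
    then show ?thesis by (simp add: isCont_def Lim_null[of _ "path_dist t p"])
  qed
  then have "continuous_on {p..q} (\<lambda>t. path_dist t p)"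
    by (simp add: continuous_at_imp_continuous_on)
  then have "bounded ((\<lambda>t. path_dist t p) ` {p..q})"
    by (intro compact_imp_bounded compact_continuous_image) auto
  then obtain C where C: "\<And>t. t \<in> {p..q} \<Longrightarrow> path_dist t p \<le> C"
    unfolding bounded_iff by (metis imageI real_norm_def abs_le_D1)
  define B where "B = \<bar>C\<bar> + Sob * \<bar>C\<bar> + Sob * h1 L (a1 p) + Sob * h1 L (a2 p)
    + nrm (a1 p) + nrm (a2 p) + nrm (A1 p) + nrm (A2 p) + 1"
  have nn: "0 \<le> Sob * \<bar>C\<bar>" "0 \<le> Sob * h1 L (a1 p)" "0 \<le> Sob * h1 L (a2 p)"
    "0 \<le> nrm (a1 p)" "0 \<le> nrm (a2 p)" "0 \<le> nrm (A1 p)" "0 \<le> nrm (A2 p)"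
    using Sob_pos h1_nonneg by simp_all
  have sup: "Sob * path_dist t p \<le> Sob * \<bar>C\<bar>" if "t \<in> {p..q}" for t
    using C[OF that] Sob_pos by (intro mult_left_mono) auto
  have tri: "cmod z \<le> cmod (z - w) + cmod w" for z w
    using norm_triangle_ineq[of "z - w" w] by simp
  note L2s = wderiv_L2[OF sol_wderiv(1)] wderiv_L2[OF sol_wderiv(2)]
    wderiv_L2'[OF sol_wderiv(1)] wderiv_L2'[OF sol_wderiv(2)]
  show ?thesis
  proof
    show "0 < B" unfolding B_def using nn abs_ge_zero[of C] by linarith
    fix t assume t: "t \<in> {p..q}"
    show "cmod (a1 t x) \<le> B" "cmod (a2 t x) \<le> B" for x
      using tri[of "a1 t x" "a1 p x"] tri[of "a2 t x" "a2 p x"] path_dist_sup[of t x p] sup[OF t]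
        Sobolev[OF sol_H1(1), of p x] Sobolev[OF sol_H1(2), of p x] nn abs_ge_zero[of C]
      unfolding B_def by linarith+
    show "nrm (a1 t) \<le> B" "nrm (a2 t) \<le> B" "nrm (A1 t) \<le> B" "nrm (A2 t) \<le> B"
      using norm2_reverse_triangle[OF L2s(1) L2s(1), of t p] norm2_reverse_triangle[OF L2s(2) L2s(2), of t p]
        norm2_reverse_triangle[OF L2s(3) L2s(3), of t p] norm2_reverse_triangle[OF L2s(4) L2s(4), of t p]
        path_dist_bounds[of t p] C[OF t] nn abs_ge_self[of C] unfolding B_def by linarith+
  qed
qed

lemma source_tendsto:
  fixes f g :: "real \<Rightarrow> real \<Rightarrow> complex"
  assumes cont: "\<And>t. continuous_on UNIV (f t)" "\<And>t. continuous_on UNIV (g t)"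
    and sup: "\<And>s t x. cmod (f s x - f t x) \<le> Sob * path_dist s t" "\<And>s t x. cmod (g s x - g t x) \<le> Sob * path_dist s t"
    and B: "\<And>s x. s \<in> {t - 1..t + 1} \<Longrightarrow> cmod (f s x) \<le> B" "\<And>s x. s \<in> {t - 1..t + 1} \<Longrightarrow> cmod (g s x) \<le> B"
  shows "((\<lambda>s. nrm (\<lambda>x. of_real (potential p q (f s x) (g s x)) * f s x
    - of_real (potential p q (f t x) (g t x)) * f t x)) \<longlongrightarrow> 0) (at t)"
proof (rule Lim_null_comparison)
  define C where "C = 4 * (\<bar>p\<bar> + \<bar>q\<bar>) * B\<^sup>2 * (2 * Sob)"
  have C: "0 \<le> C" using Sob_pos by (simp add: C_def)
  show "((\<lambda>s. sqrt L * (C * path_dist s t)) \<longlongrightarrow> 0) (at t)"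
    using tendsto_mult_left[OF tendsto_mult_left[OF path_dist_tendsto]] by fastforce
  have "\<forall>\<^sub>F s in at t. s \<in> {t - 1..t + 1}"
    unfolding eventually_at by (intro exI[of _ 1]) (auto simp: dist_real_def)
  then show "\<forall>\<^sub>F s in at t. norm (nrm (\<lambda>x. of_real (potential p q (f s x) (g s x)) * f s x
    - of_real (potential p q (f t x) (g t x)) * f t x)) \<le> sqrt L * (C * path_dist s t)"
  proof eventually_elim
    case (elim s)
    have "nrm (\<lambda>x. of_real (potential p q (f s x) (g s x)) * f s x
        - of_real (potential p q (f t x) (g t x)) * f t x) \<le> sqrt L * (C * path_dist s t)"
    proof (rule norm2_le_sup)
      show "(\<lambda>x. of_real (potential p q (f s x) (g s x)) * f s x
        - of_real (potential p q (f t x) (g t x)) * f t x) \<in> borel_measurable M"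
        unfolding potential_def by (intro continuous_measurable continuous_intros cont)
      fix x
      have "cmod (of_real (potential p q (f s x) (g s x)) * f s x - of_real (potential p q (f t x) (g t x)) * f t x)
          \<le> 4 * (\<bar>p\<bar> + \<bar>q\<bar>) * B\<^sup>2 * (cmod (f s x - f t x) + cmod (g s x - g t x))"
        using elim B[of s x] B[of t x] by (intro potential_mult_diff_bound) auto
      also have "\<dots> \<le> 4 * (\<bar>p\<bar> + \<bar>q\<bar>) * B\<^sup>2 * (Sob * path_dist s t + Sob * path_dist s t)"
        by (intro mult_left_mono add_mono sup) auto
      finally show "cmod (of_real (potential p q (f s x) (g s x)) * f s x
          - of_real (potential p q (f t x) (g t x)) * f t x) \<le> C * path_dist s t"
        by (simp add: C_def algebra_simps)
    qed (simp add: C path_dist_nonneg)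
    then show ?case by simp
  qed
qed

lemma nls_imp_rhs:
  assumes v: "has_wderiv L v h" and \<phi>: "torus_test L \<phi>"
    and "\<i> * d + of_real \<beta> * pair v (\<phi> 2) - 2 * of_real \<beta> * \<i> * of_real \<kappa> * pair v (\<phi> 1)
      + pair F (\<phi> 0) - of_real (\<beta> * \<kappa>\<^sup>2) * pair v (\<phi> 0) = 0"
  shows "d = rhs \<beta> \<kappa> v h F (\<phi> 0) (\<phi> 1)"
proof -
  have *: "pair v (\<phi> 2) = - pair h (\<phi> 1)" "pair v (\<phi> 1) = - pair h (\<phi> 0)"
    using wderiv_test[OF v \<phi>, of 1] wderiv_test[OF v \<phi>, of 0] by (simp_all add: numeral_2_eq_2)
  define p q r s where "p = pair h (\<phi> 1)" and "q = pair h (\<phi> 0)"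
    and "r = pair F (\<phi> 0)" and "s = pair v (\<phi> 0)"
  have "\<i> * d = of_real \<beta> * p - 2 * of_real \<beta> * \<i> * of_real \<kappa> * q - r + of_real (\<beta> * \<kappa>\<^sup>2) * s"
    using assms(3) unfolding * p_def[symmetric] q_def[symmetric] r_def[symmetric] s_def[symmetric]
    by (simp add: algebra_simps)
  then have "- \<i> * (\<i> * d) = rhs \<beta> \<kappa> v h F (\<phi> 0) (\<phi> 1)"
    by (simp add: rhs_def p_def q_def r_def s_def)
  then show ?thesis by (simp flip: mult.assoc)
qed

lemma components_schroedinger: "schroedinger \<beta> k a1 A1 F1" "schroedinger \<beta> (- k) a2 A2 F2"
proof -
  have lim: "((\<lambda>s. nrm (\<lambda>x. f s x - f t x)) \<longlongrightarrow> 0) (at t)"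
    if "\<And>s t. nrm (\<lambda>x. f s x - f t x) \<le> path_dist s t" for f t
    by (rule Lim_null_comparison[OF _ path_dist_tendsto[of t]]) (use that in simp)
  have F: "F1 t \<in> L2 M" "F2 t \<in> L2 M" for t
    unfolding potential_def by (intro continuous_L2 continuous_intros sol_cont)+
  have Flim: "((\<lambda>s. nrm (\<lambda>x. F1 s x - F1 t x)) \<longlongrightarrow> 0) (at t)"
    "((\<lambda>s. nrm (\<lambda>x. F2 s x - F2 t x)) \<longlongrightarrow> 0) (at t)" for t
  proof -
    obtain B where B: "\<And>s x. s \<in> {t - 1..t + 1} \<Longrightarrow> cmod (a1 s x) \<le> B"
      "\<And>s x. s \<in> {t - 1..t + 1} \<Longrightarrow> cmod (a2 s x) \<le> B"
      using sol_bounded[of "t - 1" "t + 1"] by metis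
    show "((\<lambda>s. nrm (\<lambda>x. F1 s x - F1 t x)) \<longlongrightarrow> 0) (at t)"
      by (rule source_tendsto[OF sol_cont path_dist_sup B]) auto
    show "((\<lambda>s. nrm (\<lambda>x. F2 s x - F2 t x)) \<longlongrightarrow> 0) (at t)"
      by (rule source_tendsto[OF sol_cont(2,1) path_dist_sup(2,1) B(2,1)]) auto
  qed
  have test: "((\<lambda>s. \<integral>x. a1 s x * \<phi> 0 x \<partial>M) has_vector_derivative
         rhs \<beta> k (a1 t) (A1 t) (F1 t) (\<phi> 0) (\<phi> 1)) (at t)"
    "((\<lambda>s. \<integral>x. a2 s x * \<phi> 0 x \<partial>M) has_vector_derivative
         rhs \<beta> (- k) (a2 t) (A2 t) (F2 t) (\<phi> 0) (\<phi> 1)) (at t)" if \<phi>: "torus_test L \<phi>" for \<phi> t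
  proof -
    obtain d1 d2 where d:
      "((\<lambda>s. \<integral>x. a1 s x * \<phi> 0 x \<partial>M) has_vector_derivative d1) (at t)"
      "((\<lambda>s. \<integral>x. a2 s x * \<phi> 0 x \<partial>M) has_vector_derivative d2) (at t)"
      "\<i> * d1 + of_real \<beta> * pair (a1 t) (\<phi> 2) - 2 * of_real \<beta> * \<i> * of_real k * pair (a1 t) (\<phi> 1)
        + (\<integral>x. of_real (\<alpha> * (cmod (a1 t x))\<^sup>2 + \<delta> * (cmod (a2 t x))\<^sup>2) * a1 t x * \<phi> 0 x \<partial>M)
        - of_real (\<beta> * k\<^sup>2) * pair (a1 t) (\<phi> 0) = 0"
      "\<i> * d2 + of_real \<beta> * pair (a2 t) (\<phi> 2) + 2 * of_real \<beta> * \<i> * of_real k * pair (a2 t) (\<phi> 1)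
        + (\<integral>x. of_real (\<delta> * (cmod (a1 t x))\<^sup>2 + \<gamma> * (cmod (a2 t x))\<^sup>2) * a2 t x * \<phi> 0 x \<partial>M)
        - of_real (\<beta> * k\<^sup>2) * pair (a2 t) (\<phi> 0) = 0"
      using sol \<phi> unfolding nls_solution_def Let_def pairing_eq by blast
    have "d1 = rhs \<beta> k (a1 t) (A1 t) (F1 t) (\<phi> 0) (\<phi> 1)"
      using d(3) by (intro nls_imp_rhs[OF sol_wderiv(1) \<phi>]) (simp add: potential_def)
    with d(1) show "((\<lambda>s. \<integral>x. a1 s x * \<phi> 0 x \<partial>M) has_vector_derivative
         rhs \<beta> k (a1 t) (A1 t) (F1 t) (\<phi> 0) (\<phi> 1)) (at t)" by simp
    have "d2 = rhs \<beta> (- k) (a2 t) (A2 t) (F2 t) (\<phi> 0) (\<phi> 1)"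
      using d(4) by (intro nls_imp_rhs[OF sol_wderiv(2) \<phi>]) (simp add: potential_def add.commute)
    with d(2) show "((\<lambda>s. \<integral>x. a2 s x * \<phi> 0 x \<partial>M) has_vector_derivative
         rhs \<beta> (- k) (a2 t) (A2 t) (F2 t) (\<phi> 0) (\<phi> 1)) (at t)" by simp
  qed
  show "schroedinger \<beta> k a1 A1 F1" "schroedinger \<beta> (- k) a2 A2 F2"
    unfolding schroedinger_def using sol_wderiv F Flim test
      lim[OF path_dist_bounds(3)] lim[OF path_dist_bounds(4)] lim[OF path_dist_bounds(5)] lim[OF path_dist_bounds(6)]
    by blast+
qed


lemma mass_conservation:
  assumes "schroedinger \<beta> \<kappa> a A F" and F: "\<And>t x. F t x = of_real (n t x) * a t x"
  shows "nrm (a t) = nrm (a 0)"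
proof -
  define m where "m t = ip (a t) (a t)" for t
  have "(m has_vector_derivative 0) (at t within UNIV)" for t
  proof -
    have "F t x * cnj (a t x) = a t x * cnj (F t x)" for x by (simp add: F)
    then show ?thesis
      using schroedinger_product_derivative[OF assms(1) assms(1), of t] by (simp add: m_def[abs_def])
  qed
  then obtain c where "\<And>t. m t = c"
    using has_vector_derivative_zero_constant[of UNIV m] by (metis UNIV_I convex_UNIV)
  then have "m t = m 0" by simp
  then have "complex_of_real ((nrm (a t))\<^sup>2) = of_real ((nrm (a 0))\<^sup>2)"
    by (simp only: m_def integral_mult_cnj)
  then have "(nrm (a t))\<^sup>2 = (nrm (a 0))\<^sup>2" by (simp only: of_real_eq_iff)
  then show ?thesis using power2_eq_imp_eq norm2_nonneg by blast
qed

lemma sol_mass: "nrm (a1 t) = nrm (a1 0)" "nrm (a2 t) = nrm (a2 0)"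
  by (rule mass_conservation[OF components_schroedinger(1), where n = "\<lambda>t x. n1 t x"], rule refl)
    (rule mass_conservation[OF components_schroedinger(2), where n = "\<lambda>t x. n2 t x"], rule refl)

text \<open>
  The pointwise identity behind the energy law: the symmetry of the coupling matrix turns the
  nonlinear terms into a difference of the quartic potential, up to a term that is quadratic in
  the increments.
\<close>

lemma quartic_identity:
  fixes z w z' w' :: complex
  shows "(potential \<alpha> \<delta> z w - potential \<alpha> \<delta> z' w') * Re (z * cnj z')
      + (potential \<gamma> \<delta> w z - potential \<gamma> \<delta> w' z') * Re (w * cnj w')
    = (quartic \<alpha> \<gamma> \<delta> z w - quartic \<alpha> \<gamma> \<delta> z' w') / 2
      - ((potential \<alpha> \<delta> z w - potential \<alpha> \<delta> z' w') * (cmod (z - z'))\<^sup>2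
        + (potential \<gamma> \<delta> w z - potential \<gamma> \<delta> w' z') * (cmod (w - w'))\<^sup>2) / 2"
proof -
  have Re: "Re (p * cnj q) = ((cmod p)\<^sup>2 + (cmod q)\<^sup>2 - (cmod (p - q))\<^sup>2) / 2" for p q
    by (simp add: cmod_power2) (simp add: power2_eq_square algebra_simps)
  have 4: "(cmod p)^4 = ((cmod p)\<^sup>2)\<^sup>2" for p by simp
  have real: "(\<alpha> * a + \<delta> * b - (\<alpha> * a' + \<delta> * b')) * ((a + a' - c) / 2)
      + (\<gamma> * b + \<delta> * a - (\<gamma> * b' + \<delta> * a')) * ((b + b' - d) / 2)
    = (\<alpha> * a\<^sup>2 + 2 * \<delta> * a * b + \<gamma> * b\<^sup>2 - (\<alpha> * a'\<^sup>2 + 2 * \<delta> * a' * b' + \<gamma> * b'\<^sup>2)) / 2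
      - ((\<alpha> * a + \<delta> * b - (\<alpha> * a' + \<delta> * b')) * c + (\<gamma> * b + \<delta> * a - (\<gamma> * b' + \<delta> * a')) * d) / 2"
    for a b a' b' c d :: real
    by (simp add: power2_eq_square field_simps)
  show ?thesis
    unfolding Re quartic_def potential_def 4 by (rule real)
qed

definition remainder :: "real \<Rightarrow> real \<Rightarrow> real" where
  "remainder h t = (\<integral>x.
    (n1 (t + h) x - n1 t x)
      * (cmod (a1 (t + h) x - a1 t x))\<^sup>2
    + (n2 (t + h) x - n2 t x)
      * (cmod (a2 (t + h) x - a2 t x))\<^sup>2 \<partial>M) / 2"

definition correlation :: "real \<Rightarrow> real \<Rightarrow> real" where
  "correlation h t = Im (ip (a1 (t + h)) (a1 t)) + Im (ip (a2 (t + h)) (a2 t))"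

definition potential_energy :: "real \<Rightarrow> real" where
  "potential_energy t = (\<integral>x. quartic \<alpha> \<gamma> \<delta> (a1 t x) (a2 t x) \<partial>M)"

lemma quartic_integrable: "integrable M (\<lambda>x. quartic \<alpha> \<gamma> \<delta> (a1 t x) (a2 t x))"
  unfolding quartic_def by (intro continuous_integrable continuous_intros sol_cont)

lemma correlation_derivative:
  "(correlation h has_real_derivative (potential_energy (t + h) - potential_energy t) / 2 - remainder h t) (at t)"
proof -
    have d: "((\<lambda>t. Im (ip (f (t + h)) (f t))) has_real_derivative
      (\<integral>x. (n (t + h) x - n t x) * Re (f (t + h) x * cnj (f t x)) \<partial>M)) (at t)"
    if f: "schroedinger \<beta> \<kappa> f A (\<lambda>t x. of_real (n t x) * f t x)" for \<kappa> f A n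
  proof -
    note L2 = wderiv_L2[OF schroedinger_wderiv[OF f]] schroedinger_source[OF f]
    have i: "integrable M (\<lambda>x. (of_real (n (t + h) x) * f (t + h) x) * cnj (f t x))"
      "integrable M (\<lambda>x. f (t + h) x * cnj (of_real (n t x) * f t x))"
      by (intro L2_mult_integrable L2_cnj L2)+
    have eq: "(of_real (n (t + h) x) * f (t + h) x) * cnj (f t x) - f (t + h) x * cnj (of_real (n t x) * f t x)
        = of_real (n (t + h) x - n t x) * (f (t + h) x * cnj (f t x))" for x
      by (simp add: algebra_simps)
    have "((\<lambda>t. \<integral>x. f (t + h) x * cnj (f t x) \<partial>M) has_vector_derivative
        \<i> * ((\<integral>x. (of_real (n (t + h) x) * f (t + h) x) * cnj (f t x) \<partial>M)
          - (\<integral>x. f (t + h) x * cnj (of_real (n t x) * f t x) \<partial>M))) (at t)"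
      by (rule schroedinger_product_derivative[OF schroedinger_shift[OF f] f])
    then have "((\<lambda>t. Im (ip (f (t + h)) (f t))) has_vector_derivative
        Im (\<i> * ((\<integral>x. (of_real (n (t + h) x) * f (t + h) x) * cnj (f t x) \<partial>M)
          - (\<integral>x. f (t + h) x * cnj (of_real (n t x) * f t x) \<partial>M)))) (at t)"
      by (rule bounded_linear.has_vector_derivative[OF bounded_linear_Im])
    moreover have "Im (\<i> * ((\<integral>x. (of_real (n (t + h) x) * f (t + h) x) * cnj (f t x) \<partial>M)
          - (\<integral>x. f (t + h) x * cnj (of_real (n t x) * f t x) \<partial>M)))
        = (\<integral>x. (n (t + h) x - n t x) * Re (f (t + h) x * cnj (f t x)) \<partial>M)"
    proof -
      have "Im (\<i> * ((\<integral>x. (of_real (n (t + h) x) * f (t + h) x) * cnj (f t x) \<partial>M)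
          - (\<integral>x. f (t + h) x * cnj (of_real (n t x) * f t x) \<partial>M)))
          = Re (\<integral>x. (of_real (n (t + h) x) * f (t + h) x) * cnj (f t x)
            - f (t + h) x * cnj (of_real (n t x) * f t x) \<partial>M)"
        by (subst Bochner_Integration.integral_diff[OF i]) simp
      also have "\<dots> = (\<integral>x. Re (of_real (n (t + h) x - n t x) * (f (t + h) x * cnj (f t x))) \<partial>M)"
        unfolding eq[symmetric] by (rule integral_Re[symmetric]) (rule Bochner_Integration.integrable_diff[OF i])
      finally show ?thesis by (simp only: Re_complex_of_real Im_complex_of_real times_complex.sel) simp
    qed
    ultimately show ?thesis by (simp add: has_real_derivative_iff_has_vector_derivative)
  qed
  have "(correlation h has_real_derivative
      (\<integral>x. (n1 (t + h) x - n1 t x) * Re (a1 (t + h) x * cnj (a1 t x)) \<partial>M)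
      + (\<integral>x. (n2 (t + h) x - n2 t x) * Re (a2 (t + h) x * cnj (a2 t x)) \<partial>M)) (at t)"
    unfolding correlation_def[abs_def]
    by (intro DERIV_add d[OF components_schroedinger(1)] d[OF components_schroedinger(2)])
  also have "(\<integral>x. (n1 (t + h) x - n1 t x) * Re (a1 (t + h) x * cnj (a1 t x)) \<partial>M)
      + (\<integral>x. (n2 (t + h) x - n2 t x) * Re (a2 (t + h) x * cnj (a2 t x)) \<partial>M)
      = (\<integral>x. (n1 (t + h) x - n1 t x) * Re (a1 (t + h) x * cnj (a1 t x))
        + (n2 (t + h) x - n2 t x) * Re (a2 (t + h) x * cnj (a2 t x)) \<partial>M)"
    unfolding potential_def
    by (intro Bochner_Integration.integral_add[symmetric] continuous_integrable continuous_intros sol_cont)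
  also have "\<dots> = (\<integral>x. (quartic \<alpha> \<gamma> \<delta> (a1 (t + h) x) (a2 (t + h) x) - quartic \<alpha> \<gamma> \<delta> (a1 t x) (a2 t x)) / 2
      - ((n1 (t + h) x - n1 t x) * (cmod (a1 (t + h) x - a1 t x))\<^sup>2
        + (n2 (t + h) x - n2 t x) * (cmod (a2 (t + h) x - a2 t x))\<^sup>2) / 2 \<partial>M)"
    by (simp only: quartic_identity)
  also have "\<dots> = (potential_energy (t + h) - potential_energy t) / 2 - remainder h t"
  proof -
    have "integrable M (\<lambda>x. (n1 (t + h) x - n1 t x) * (cmod (a1 (t + h) x - a1 t x))\<^sup>2
        + (n2 (t + h) x - n2 t x) * (cmod (a2 (t + h) x - a2 t x))\<^sup>2)"
      unfolding potential_def by (intro continuous_integrable continuous_intros sol_cont)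
    then show ?thesis
      by (simp add: potential_energy_def remainder_def quartic_integrable)
  qed
  finally show ?thesis .
qed

text \<open>
  The remainder is bounded by a multiple of the squared \<open>L\<^sup>2\<close> norm of the increment over time \<open>h\<close>.  Paired with
  itself, the increment is of order \<open>h\<close> in the dual of \<open>H\<^sup>1\<close> and tends to \<open>0\<close> in \<open>H\<^sup>1\<close>, uniformly
  on compact time intervals.
\<close>

lemma remainder_small:
  assumes \<epsilon>: "0 < \<epsilon>"
  shows "\<exists>d>0. \<forall>h t. 0 < h \<longrightarrow> h < d \<longrightarrow> t \<in> {p..q} \<longrightarrow> \<bar>remainder h t\<bar> \<le> \<epsilon> * h"
proof -
  obtain B where B: "0 < B"
    "\<And>t x. t \<in> {p..q + 1} \<Longrightarrow> cmod (a1 t x) \<le> B" "\<And>t x. t \<in> {p..q + 1} \<Longrightarrow> cmod (a2 t x) \<le> B"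
    "\<And>t. t \<in> {p..q + 1} \<Longrightarrow> nrm (a1 t) \<le> B" "\<And>t. t \<in> {p..q + 1} \<Longrightarrow> nrm (a2 t) \<le> B"
    "\<And>t. t \<in> {p..q + 1} \<Longrightarrow> nrm (A1 t) \<le> B" "\<And>t. t \<in> {p..q + 1} \<Longrightarrow> nrm (A2 t) \<le> B"
    using sol_bounded[of p "q + 1"] by blast
  define N where "N = (\<bar>\<alpha>\<bar> + \<bar>\<gamma>\<bar> + \<bar>\<delta>\<bar>) * B\<^sup>2"
  have N: "0 \<le> N" by (simp add: N_def)
  have pot: "\<bar>n1 t x\<bar> \<le> N" "\<bar>n2 t x\<bar> \<le> N"
    if "t \<in> {p..q + 1}" for t x
  proof -
    have "(\<bar>\<alpha>\<bar> + \<bar>\<delta>\<bar>) * B\<^sup>2 \<le> N" "(\<bar>\<gamma>\<bar> + \<bar>\<delta>\<bar>) * B\<^sup>2 \<le> N"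
      unfolding N_def by (intro mult_right_mono; simp)+
    then show "\<bar>n1 t x\<bar> \<le> N" "\<bar>n2 t x\<bar> \<le> N"
      using potential_bound[OF B(2)[OF that] B(3)[OF that], of \<alpha> \<delta>] potential_bound[OF B(3)[OF that] B(2)[OF that], of \<gamma> \<delta>]
      by (meson order_trans)+
  qed
  define K where "K = 2 * B + sqrt L * (N * B)"
  have K0: "0 \<le> K" using B(1) N L_pos by (simp add: K_def)
  have K: "nrm (a1 t) + nrm (A1 t) + nrm (F1 t) \<le> K" "nrm (a2 t) + nrm (A2 t) + nrm (F2 t) \<le> K"
    if t: "t \<in> {p..q + 1}" for t
  proof -
    have "nrm (F1 t) \<le> sqrt L * (N * B)" "nrm (F2 t) \<le> sqrt L * (N * B)"
    proof (safe intro!: norm2_le_sup)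
      show "F1 t \<in> borel_measurable M" "F2 t \<in> borel_measurable M"
        unfolding potential_def by (intro continuous_measurable continuous_intros sol_cont)+
      show "cmod (F1 t x) \<le> N * B" "cmod (F2 t x) \<le> N * B" for x
        unfolding norm_mult norm_of_real using t N by (intro mult_mono pot B(2,3); simp)+
    qed (use N B(1) in auto)
    then show "nrm (a1 t) + nrm (A1 t) + nrm (F1 t) \<le> K" "nrm (a2 t) + nrm (A2 t) + nrm (F2 t) \<le> K"
      using B(4-7)[OF t] by (simp_all add: K_def)
  qed
  define C where "C = rhs_const \<beta> k * K * 2"
  have C: "0 \<le> C" using K0 rhs_const_pos[of \<beta> k] by (simp add: C_def)
  have incr: "(nrm (\<lambda>x. a1 (t + h) x - a1 t x))\<^sup>2 \<le> C * h * path_dist (t + h) t"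
    "(nrm (\<lambda>x. a2 (t + h) x - a2 t x))\<^sup>2 \<le> C * h * path_dist (t + h) t"
    if h: "0 < h" "h < 1" and t: "t \<in> {p..q}" for h t
  proof -
    have incr': "(nrm (\<lambda>x. f (t + h) x - f t x))\<^sup>2 \<le> C * h * path_dist (t + h) t"
      if f: "schroedinger \<beta> \<kappa> f A F" and \<kappa>: "rhs_const \<beta> \<kappa> = rhs_const \<beta> k"
        and K: "\<And>t. t \<in> {p..q + 1} \<Longrightarrow> nrm (f t) + nrm (A t) + nrm (F t) \<le> K"
        and fD: "nrm (\<lambda>x. f (t + h) x - f t x) \<le> path_dist (t + h) t" "nrm (\<lambda>x. A (t + h) x - A t x) \<le> path_dist (t + h) t"
      for \<kappa> f A F
    proof -
      note w = wderiv_diff[OF schroedinger_wderiv[OF f, of "t + h"] schroedinger_wderiv[OF f, of t]]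
      have "(nrm (\<lambda>x. f (t + h) x - f t x))\<^sup>2 = cmod (\<integral>x. (f (t + h) x - f t x) * cnj (f (t + h) x - f t x) \<partial>M)"
        by (subst integral_mult_cnj) (simp only: norm_of_real abs_power2 abs_norm_cancel abs_of_nonneg norm2_nonneg)
      also have "\<dots> \<le> rhs_const \<beta> \<kappa> * K * \<bar>t + h - t\<bar>
          * (nrm (\<lambda>x. cnj (f (t + h) x - f t x)) + nrm (\<lambda>x. cnj (A (t + h) x - A t x)))"
        using h t by (intro schroedinger_Lipschitz[OF f K, of p "q + 1"] wderiv_cnj w) auto
      also have "\<dots> \<le> rhs_const \<beta> \<kappa> * K * \<bar>t + h - t\<bar> * (path_dist (t + h) t + path_dist (t + h) t)"
        unfolding norm2_cnj using fD K0 rhs_const_pos[of \<beta> \<kappa>] by (intro mult_left_mono add_mono) auto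
      finally show ?thesis using h by (simp add: C_def \<kappa> mult_ac)
    qed
    show "(nrm (\<lambda>x. a1 (t + h) x - a1 t x))\<^sup>2 \<le> C * h * path_dist (t + h) t"
      by (rule incr'[OF components_schroedinger(1) _ K(1) path_dist_bounds(3) path_dist_bounds(5)]) auto
    show "(nrm (\<lambda>x. a2 (t + h) x - a2 t x))\<^sup>2 \<le> C * h * path_dist (t + h) t"
      by (rule incr'[OF components_schroedinger(2) _ K(2) path_dist_bounds(4) path_dist_bounds(6)]) (auto simp: rhs_const_def)
  qed
  have rem: "\<bar>remainder h t\<bar> \<le> 2 * N * (C * h * path_dist (t + h) t)"
    if h: "0 < h" "h < 1" and t: "t \<in> {p..q}" for h t
  proof -
    let ?f = "\<lambda>x. (n1 (t + h) x - n1 t x)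
        * (cmod (a1 (t + h) x - a1 t x))\<^sup>2
      + (n2 (t + h) x - n2 t x)
        * (cmod (a2 (t + h) x - a2 t x))\<^sup>2"
    let ?g = "\<lambda>x. 2 * N * (cmod (a1 (t + h) x - a1 t x))\<^sup>2 + 2 * N * (cmod (a2 (t + h) x - a2 t x))\<^sup>2"
    have tt: "t \<in> {p..q + 1}" "t + h \<in> {p..q + 1}" using h t by auto
    have "\<bar>?f x\<bar> \<le> ?g x" for x
    proof -
      have "\<bar>n1 (t + h) x - n1 t x\<bar> \<le> 2 * N"
        "\<bar>n2 (t + h) x - n2 t x\<bar> \<le> 2 * N"
        using pot[OF tt(1), of x] pot[OF tt(2), of x] by linarith+
      then show ?thesis
        by (intro order_trans[OF abs_triangle_ineq] add_mono) (simp_all add: abs_mult mult_right_mono)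
    qed
    moreover have "integrable M ?f" "integrable M ?g"
      unfolding potential_def by (intro continuous_integrable continuous_intros sol_cont)+
    ultimately have "(\<integral>x. \<bar>?f x\<bar> \<partial>M) \<le> (\<integral>x. ?g x \<partial>M)"
      by (intro integral_mono integrable_abs)
    then have "\<bar>\<integral>x. ?f x \<partial>M\<bar> \<le> (\<integral>x. ?g x \<partial>M)"
      using integral_abs_bound[of M ?f] by linarith
    also have "\<dots> = 2 * N * (nrm (\<lambda>x. a1 (t + h) x - a1 t x))\<^sup>2 + 2 * N * (nrm (\<lambda>x. a2 (t + h) x - a2 t x))\<^sup>2"
    proof -
      have "integrable M (\<lambda>x. (cmod (a1 (t + h) x - a1 t x))\<^sup>2)" "integrable M (\<lambda>x. (cmod (a2 (t + h) x - a2 t x))\<^sup>2)"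
        by (intro continuous_integrable continuous_intros sol_cont)+
      then show ?thesis by (simp add: norm2_sq)
    qed
    also have "\<dots> \<le> 2 * N * (C * h * path_dist (t + h) t) + 2 * N * (C * h * path_dist (t + h) t)"
      using N by (intro add_mono mult_left_mono incr h t) auto
    finally show ?thesis unfolding remainder_def by linarith
  qed
  define \<epsilon>' where "\<epsilon>' = \<epsilon> / (2 * N * C + 1)"
  have NC: "0 \<le> 2 * N * C" using N C by simp
  then have NC1: "0 < 2 * N * C + 1" by linarith
  then have \<epsilon>': "0 < \<epsilon>'" unfolding \<epsilon>'_def using \<epsilon> by (intro divide_pos_pos)
  obtain d where d: "0 < d" "\<And>s t. s \<in> {p..q} \<Longrightarrow> \<bar>t - s\<bar> < d \<Longrightarrow> path_dist t s < \<epsilon>'"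
    using pseudometric_path_uniformly_continuous[of path_dist, OF path_dist_triangle path_dist_sym path_dist_self path_dist_tendsto \<epsilon>'] by metis
  show ?thesis
  proof (intro exI[of _ "min d 1"] conjI allI impI)
    fix h t assume h: "0 < h" "h < min d 1" and t: "t \<in> {p..q}"
    have "\<bar>remainder h t\<bar> \<le> (2 * N * C) * (h * path_dist (t + h) t)" using rem[of h t] h t by (simp add: mult_ac)
    also have "\<dots> \<le> (2 * N * C) * (h * \<epsilon>')"
      using d(2)[OF t, of "t + h"] h NC by (intro mult_left_mono) auto
    also have "\<dots> \<le> (2 * N * C + 1) * (h * \<epsilon>')"
      using h \<epsilon>' by (intro mult_right_mono) auto
    also have "\<dots> = \<epsilon> * h" using NC1 by (simp add: \<epsilon>'_def)
    finally show "\<bar>remainder h t\<bar> \<le> \<epsilon> * h" .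
  qed (use d in auto)
qed

lemma Re_source_pairing:
  "Re (ip (F1 t) (a1 t)) + Re (ip (F2 t) (a2 t)) = potential_energy t"
proof -
  have "Re (\<integral>x. of_real (n x) * f x * cnj (f x) \<partial>M) = (\<integral>x. n x * (cmod (f x))\<^sup>2 \<partial>M)" for n f
  proof -
    have "(\<integral>x. of_real (n x) * f x * cnj (f x) \<partial>M) = (\<integral>x. complex_of_real (n x * (cmod (f x))\<^sup>2) \<partial>M)"
      by (intro Bochner_Integration.integral_cong) (auto simp: mult.assoc simp flip: complex_norm_square)
    then show ?thesis by (simp only: integral_complex_of_real Re_complex_of_real)
  qed
  then have "Re (ip (F1 t) (a1 t)) + Re (ip (F2 t) (a2 t))
      = (\<integral>x. n1 t x * (cmod (a1 t x))\<^sup>2 \<partial>M)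
        + (\<integral>x. n2 t x * (cmod (a2 t x))\<^sup>2 \<partial>M)" by simp
  also have "\<dots> = (\<integral>x. n1 t x * (cmod (a1 t x))\<^sup>2
        + n2 t x * (cmod (a2 t x))\<^sup>2 \<partial>M)"
    unfolding potential_def
    by (intro Bochner_Integration.integral_add[symmetric] continuous_integrable continuous_intros sol_cont)
  also have "\<dots> = potential_energy t"
    unfolding potential_energy_def
    by (intro Bochner_Integration.integral_cong)
      (auto simp: potential_def quartic_def algebra_simps power4_eq_xxxx power2_eq_square)
  finally show ?thesis .
qed

lemma potential_energy_continuous: "continuous_on UNIV potential_energy"
proof -
  have c: "((\<lambda>s. \<integral>x. F s x * cnj (f s x) \<partial>M) \<longlongrightarrow> (ip (F t) (f t))) (at t)"
    if f: "schroedinger \<beta> \<kappa> f A F" for \<kappa> f A F t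
  proof -
    note L2 = schroedinger_L2(1)[OF f] schroedinger_source[OF f]
    let ?e = "\<lambda>s. nrm (\<lambda>x. F s x - F t x) * (nrm (f t) + nrm (\<lambda>x. f s x - f t x))
      + nrm (F t) * nrm (\<lambda>x. f s x - f t x)"
    have "norm (ip (F s) (f s) - ip (F t) (f t)) \<le> ?e s" for s
    proof -
      have eq: "ip (F s) (f s) - ip (F t) (f t)
          = (\<integral>x. (F s x - F t x) * cnj (f s x) \<partial>M) + (\<integral>x. F t x * cnj (f s x - f t x) \<partial>M)"
        by (simp add: left_diff_distrib right_diff_distrib L2_mult_integrable L2 L2_cnj)
      have "norm (ip (F s) (f s) - ip (F t) (f t)) \<le> nrm (\<lambda>x. F s x - F t x) * nrm (f s) + nrm (F t) * nrm (\<lambda>x. f s x - f t x)"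
        using Cauchy_Schwarz_L2[OF L2_diff[OF L2(2) L2(2)] L2_cnj[OF L2(1)], of s t s]
          Cauchy_Schwarz_L2[OF L2(2) L2_cnj[OF L2_diff[OF L2(1) L2(1)]], of t s t]
        unfolding norm2_cnj eq by (intro order_trans[OF norm_triangle_ineq] add_mono)
      also have "\<dots> \<le> ?e s"
        using norm2_reverse_triangle[OF L2(1) L2(1), of s t] by (intro add_mono mult_left_mono) auto
      finally show ?thesis .
    qed
    then have ev: "\<forall>\<^sub>F s in at t. norm (ip (F s) (f s) - ip (F t) (f t)) \<le> ?e s"
      by (intro always_eventually allI)
    have "(?e \<longlongrightarrow> 0 * (nrm (f t) + 0) + nrm (F t) * 0) (at t)"
      by (intro tendsto_add tendsto_mult tendsto_const schroedinger_cont[OF f])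
    then have "(?e \<longlongrightarrow> 0) (at t)" by simp
    from Lim_null_comparison[OF ev this] have "((\<lambda>s. (ip (F s) (f s)) - ip (F t) (f t)) \<longlongrightarrow> 0) (at t)"
      .
    then show ?thesis by (simp only: Lim_null[of _ "\<integral>x. F t x * cnj (f t x) \<partial>M"])
  qed
  have "((\<lambda>s. Re (ip (F1 s) (a1 s)) + Re (ip (F2 s) (a2 s))) \<longlongrightarrow>
      Re (ip (F1 t) (a1 t)) + Re (ip (F2 t) (a2 t))) (at t)" for t
    by (intro tendsto_intros c[OF components_schroedinger(1)] c[OF components_schroedinger(2)])
  then show ?thesis
    unfolding Re_source_pairing by (simp add: continuous_on_eq_continuous_at isCont_def)
qed

text \<open>
  At \<open>h = 0\<close> the correlation is the imaginary part of the mass, which vanishes.  So the limit is the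
  time derivative of the solution paired with the solution itself, and the equation turns it into
  kinetic energy and potential energy.
\<close>

lemma correlation_quotient:
  "((\<lambda>h. correlation h t / h) \<longlongrightarrow>
    potential_energy t - kinetic \<beta> k (a1 t) - kinetic \<beta> (- k) (a2 t)
      - \<beta> * k\<^sup>2 * ((nrm (a1 t))\<^sup>2 + (nrm (a2 t))\<^sup>2)) (at 0)"
proof -
  have q: "((\<lambda>h. Im (ip (f (t + h)) (f t)) / h) \<longlongrightarrow>
      Re (ip (F t) (f t)) - kinetic \<beta> \<kappa> (f t) - \<beta> * \<kappa>\<^sup>2 * (nrm (f t))\<^sup>2) (at 0)"
    if f: "schroedinger \<beta> \<kappa> f (\<lambda>t. weak_deriv L (f t)) F" for \<kappa> f F
  proof -
    note L2 = wderiv_L2[OF schroedinger_wderiv[OF f]]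
    let ?R = "rhs \<beta> \<kappa> (f t) (weak_deriv L (f t)) (F t) (\<lambda>x. cnj (f t x)) (\<lambda>x. cnj (weak_deriv L (f t) x))"
    have "((\<lambda>s. (\<integral>x. (f s x - f t x) * cnj (f t x) \<partial>M) / of_real (s - t)) \<longlongrightarrow> ?R) (at t)"
      by (intro schroedinger_quotient_tendsto[OF f, where v = "\<lambda>_ x. cnj (f t x)"] wderiv_cnj schroedinger_wderiv[OF f])
        (simp_all add: norm2_def)
    from tendsto_Im[OF LIM_offset_zero[OF this]]
    have "((\<lambda>h. Im ((\<integral>x. (f (t + h) x - f t x) * cnj (f t x) \<partial>M) / of_real h)) \<longlongrightarrow> Im ?R) (at 0)"
      by simp
    moreover have "Im ((\<integral>x. (f (t + h) x - f t x) * cnj (f t x) \<partial>M) / of_real h)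
        = Im (ip (f (t + h)) (f t)) / h" for h
    proof -
      have "(\<integral>x. (f (t + h) x - f t x) * cnj (f t x) \<partial>M)
          = (ip (f (t + h)) (f t)) - ip (f t) (f t)"
        by (simp add: left_diff_distrib L2_mult_integrable L2 L2_cnj)
      then show ?thesis by (simp add: integral_mult_cnj Im_divide_of_real)
    qed
    moreover have "Im ?R = Re (ip (F t) (f t)) - kinetic \<beta> \<kappa> (f t) - \<beta> * \<kappa>\<^sup>2 * (nrm (f t))\<^sup>2"
    proof -
      define p q where "p = (ip (weak_deriv L (f t)) (f t))" and "q = ip (F t) (f t)"
      have "Im ?R = - Re (of_real \<beta> * of_real ((nrm (weak_deriv L (f t)))\<^sup>2) - 2 * of_real \<beta> * \<i> * of_real \<kappa> * p
         - q + of_real (\<beta> * \<kappa>\<^sup>2) * of_real ((nrm (f t))\<^sup>2))"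
        unfolding rhs_def integral_mult_cnj p_def[symmetric] q_def[symmetric] by simp
      then show ?thesis
        unfolding kinetic_def p_def[symmetric] q_def[symmetric] by (simp add: algebra_simps flip: of_real_power)
    qed
    ultimately show ?thesis by (simp only:)
  qed
  have "((\<lambda>h. Im (ip (a1 (t + h)) (a1 t)) / h + Im (ip (a2 (t + h)) (a2 t)) / h) \<longlongrightarrow>
      (Re (ip (F1 t) (a1 t)) - kinetic \<beta> k (a1 t) - \<beta> * k\<^sup>2 * (nrm (a1 t))\<^sup>2)
      + (Re (ip (F2 t) (a2 t)) - kinetic \<beta> (- k) (a2 t) - \<beta> * (- k)\<^sup>2 * (nrm (a2 t))\<^sup>2)) (at 0)"
    by (intro tendsto_add q[OF components_schroedinger(1)] q[OF components_schroedinger(2)])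
  moreover have "(Re (ip (F1 t) (a1 t)) - kinetic \<beta> k (a1 t) - \<beta> * k\<^sup>2 * (nrm (a1 t))\<^sup>2)
      + (Re (ip (F2 t) (a2 t)) - kinetic \<beta> (- k) (a2 t) - \<beta> * (- k)\<^sup>2 * (nrm (a2 t))\<^sup>2)
      = potential_energy t - kinetic \<beta> k (a1 t) - kinetic \<beta> (- k) (a2 t)
      - \<beta> * k\<^sup>2 * ((nrm (a1 t))\<^sup>2 + (nrm (a2 t))\<^sup>2)"
    using Re_source_pairing[of t] by (simp add: algebra_simps)
  ultimately show ?thesis by (simp only: correlation_def add_divide_distrib)
qed

theorem energy_conservation: "energy \<beta> k \<alpha> \<gamma> \<delta> (u t) = energy \<beta> k \<alpha> \<gamma> \<delta> (u 0)"
  using conservation_by_time_shift[OF correlation_derivative potential_energy_continuous correlation_quotient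
      remainder_small, of t 0]
  by (simp add: energy_def potential_energy_def sol_mass[of t] field_simps)

end

end

section \<open>Coercivity of the energy near the constant state\<close>

definition coupling_form :: "real \<Rightarrow> real \<Rightarrow> real \<Rightarrow> real \<Rightarrow> real \<Rightarrow> real" where
  "coupling_form \<alpha> \<gamma> \<delta> x y = \<alpha> * x\<^sup>2 + 2 * \<delta> * x * y + \<gamma> * y\<^sup>2"

text \<open>\<open>C_minus\<close> is \<open>- 2\<close> times the largest eigenvalue of the matrix with entries \<open>\<alpha> \<zeta>1\<^sup>2\<close>, \<open>\<delta> \<zeta>1 \<zeta>2\<close>, \<open>\<gamma> \<zeta>2\<^sup>2\<close>.\<close>

lemma coupling_form_le_C_minus:
  "2 * coupling_form \<alpha> \<gamma> \<delta> (\<zeta>1 * x) (\<zeta>2 * y) \<le> - C_minus \<alpha> \<gamma> \<delta> \<zeta>1 \<zeta>2 * (x\<^sup>2 + y\<^sup>2)"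
proof -
  define a b c where "a = \<alpha> * \<zeta>1\<^sup>2" and "b = \<delta> * \<zeta>1 * \<zeta>2" and "c = \<gamma> * \<zeta>2\<^sup>2"
  define s where "s = sqrt ((a - c)\<^sup>2 + (2 * b)\<^sup>2)"
  have "(\<alpha> * \<zeta>1\<^sup>2 + \<gamma> * \<zeta>2\<^sup>2)\<^sup>2 - 4 * \<zeta>1\<^sup>2 * \<zeta>2\<^sup>2 * (\<alpha> * \<gamma> - \<delta>\<^sup>2) = (a - c)\<^sup>2 + (2 * b)\<^sup>2"
    by (simp add: a_def b_def c_def power2_eq_square algebra_simps)
  then have C: "- C_minus \<alpha> \<gamma> \<delta> \<zeta>1 \<zeta>2 = a + c + s"
    by (simp add: C_minus_def s_def a_def c_def)
  have "((a - c) * (x\<^sup>2 - y\<^sup>2) + 2 * b * (2 * x * y))\<^sup>2 \<le>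
      ((a - c)\<^sup>2 + (2 * b)\<^sup>2) * ((x\<^sup>2 - y\<^sup>2)\<^sup>2 + (2 * x * y)\<^sup>2)"
  proof -
    have "((a - c)\<^sup>2 + (2 * b)\<^sup>2) * ((x\<^sup>2 - y\<^sup>2)\<^sup>2 + (2 * x * y)\<^sup>2)
        - ((a - c) * (x\<^sup>2 - y\<^sup>2) + 2 * b * (2 * x * y))\<^sup>2
        = ((a - c) * (2 * x * y) - 2 * b * (x\<^sup>2 - y\<^sup>2))\<^sup>2"
      by (simp add: power2_eq_square algebra_simps)
    then show ?thesis by (smt (verit) zero_le_power2)
  qed
  also have "(x\<^sup>2 - y\<^sup>2)\<^sup>2 + (2 * x * y)\<^sup>2 = (x\<^sup>2 + y\<^sup>2)\<^sup>2"
    by (simp add: power2_eq_square algebra_simps)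
  finally have "((a - c) * (x\<^sup>2 - y\<^sup>2) + 2 * b * (2 * x * y))\<^sup>2 \<le> (s * (x\<^sup>2 + y\<^sup>2))\<^sup>2"
    by (simp add: power_mult_distrib s_def)
  then have "(a - c) * (x\<^sup>2 - y\<^sup>2) + 2 * b * (2 * x * y) \<le> s * (x\<^sup>2 + y\<^sup>2)"
    by (rule power2_le_imp_le) (simp add: s_def)
  moreover have "2 * coupling_form \<alpha> \<gamma> \<delta> (\<zeta>1 * x) (\<zeta>2 * y)
      = (a + c) * (x\<^sup>2 + y\<^sup>2) + ((a - c) * (x\<^sup>2 - y\<^sup>2) + 2 * b * (2 * x * y))"
    by (simp add: coupling_form_def a_def b_def c_def power2_eq_square algebra_simps)
  ultimately show ?thesis unfolding C by (simp add: distrib_right)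
qed

lemma coupling_form_bound:
  assumes "\<bar>x\<bar> \<le> c" "\<bar>y\<bar> \<le> c"
  shows "\<bar>coupling_form \<alpha> \<gamma> \<delta> x y\<bar> \<le> (\<bar>\<alpha>\<bar> + 2 * \<bar>\<delta>\<bar> + \<bar>\<gamma>\<bar>) * c\<^sup>2"
proof -
  have "\<bar>coupling_form \<alpha> \<gamma> \<delta> x y\<bar> \<le> \<bar>\<alpha>\<bar> * \<bar>x\<bar>\<^sup>2 + 2 * \<bar>\<delta>\<bar> * (\<bar>x\<bar> * \<bar>y\<bar>) + \<bar>\<gamma>\<bar> * \<bar>y\<bar>\<^sup>2"
    unfolding coupling_form_def
    by (intro order_trans[OF abs_triangle_ineq] add_mono) (simp_all add: abs_mult)
  also have "\<dots> \<le> \<bar>\<alpha>\<bar> * c\<^sup>2 + 2 * \<bar>\<delta>\<bar> * (c * c) + \<bar>\<gamma>\<bar> * c\<^sup>2"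
    using assms by (intro add_mono mult_left_mono mult_mono power_mono) auto
  finally show ?thesis by (simp add: power2_eq_square algebra_simps)
qed

text \<open>
  The density increment is \<open>2 \<zeta> Re z + \<bar>z\<bar>\<^sup>2\<close>; only its linear part is controlled by the
  eigenvalue, the rest is of third and fourth order.
\<close>

lemma coupling_form_density_upper:
  fixes z w :: complex and \<zeta>1 \<zeta>2 \<alpha> \<gamma> \<delta> :: real
  assumes W: "cmod z \<le> W" "cmod w \<le> W"
  shows "coupling_form \<alpha> \<gamma> \<delta> (2 * \<zeta>1 * Re z + (cmod z)\<^sup>2) (2 * \<zeta>2 * Re w + (cmod w)\<^sup>2)
    \<le> - 2 * C_minus \<alpha> \<gamma> \<delta> \<zeta>1 \<zeta>2 * ((Re z)\<^sup>2 + (Re w)\<^sup>2)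
      + 4 * (\<bar>\<alpha>\<bar> + \<bar>\<delta>\<bar> + \<bar>\<gamma>\<bar>) * (1 + \<bar>\<zeta>1\<bar> + \<bar>\<zeta>2\<bar>) * (W + W\<^sup>2) * ((cmod z)\<^sup>2 + (cmod w)\<^sup>2)"
proof -
  define x y p q where "x = Re z" and "y = Re w" and "p = (cmod z)\<^sup>2" and "q = (cmod w)\<^sup>2"
  define N where "N = \<bar>\<alpha>\<bar> + \<bar>\<delta>\<bar> + \<bar>\<gamma>\<bar>"
  define Z where "Z = \<bar>\<zeta>1\<bar> + \<bar>\<zeta>2\<bar>"
  have pos: "0 \<le> W" "0 \<le> p" "0 \<le> q" "0 \<le> N" "0 \<le> Z"
    using order_trans[OF norm_ge_zero W(1)] by (auto simp: p_def q_def N_def Z_def)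
  have xy: "\<bar>x\<bar> \<le> W" "\<bar>y\<bar> \<le> W"
    using abs_Re_le_cmod[of z] abs_Re_le_cmod[of w] W by (auto simp: x_def y_def)
  have pq: "p \<le> W\<^sup>2" "q \<le> W\<^sup>2" using W by (auto simp: p_def q_def power_mono)
  have split: "coupling_form \<alpha> \<gamma> \<delta> (2 * \<zeta>1 * x + p) (2 * \<zeta>2 * y + q)
      = 4 * coupling_form \<alpha> \<gamma> \<delta> (\<zeta>1 * x) (\<zeta>2 * y)
        + 4 * (\<alpha> * \<zeta>1 * x * p + \<delta> * (\<zeta>1 * x * q + \<zeta>2 * y * p) + \<gamma> * \<zeta>2 * y * q)
        + (\<alpha> * p * p + 2 * \<delta> * p * q + \<gamma> * q * q)"
    by (simp add: coupling_form_def power2_eq_square algebra_simps)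
  have t: "c * e * v * r \<le> \<bar>c\<bar> * (Z * W) * r"
    if "\<bar>e\<bar> \<le> Z" "\<bar>v\<bar> \<le> W" "0 \<le> r" for c e v r :: real
  proof -
    have "c * e * v \<le> \<bar>c\<bar> * (\<bar>e\<bar> * \<bar>v\<bar>)" by (metis abs_ge_self abs_mult mult.assoc)
    also have "\<dots> \<le> \<bar>c\<bar> * (Z * W)" using that pos by (intro mult_left_mono mult_mono) auto
    finally show ?thesis using that by (intro mult_right_mono)
  qed
  have Z: "\<bar>\<zeta>1\<bar> \<le> Z" "\<bar>\<zeta>2\<bar> \<le> Z" by (auto simp: Z_def)
  have "\<alpha> * \<zeta>1 * x * p + \<delta> * (\<zeta>1 * x * q + \<zeta>2 * y * p) + \<gamma> * \<zeta>2 * y * q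
      \<le> \<bar>\<alpha>\<bar> * (Z * W) * p + (\<bar>\<delta>\<bar> * (Z * W) * q + \<bar>\<delta>\<bar> * (Z * W) * p) + \<bar>\<gamma>\<bar> * (Z * W) * q"
    using t[OF Z(1) xy(1) pos(2), of \<alpha>] t[OF Z(1) xy(1) pos(3), of \<delta>] t[OF Z(2) xy(2) pos(2), of \<delta>]
      t[OF Z(2) xy(2) pos(3), of \<gamma>] by (simp add: distrib_left mult.assoc)
  also have "\<dots> \<le> N * (Z * W) * (p + q)"
  proof -
    have "0 \<le> \<bar>\<gamma>\<bar> * (Z * W) * p" "0 \<le> \<bar>\<alpha>\<bar> * (Z * W) * q" using pos by simp_all
    then show ?thesis by (simp add: N_def algebra_simps)
  qed
  finally have cross: "\<alpha> * \<zeta>1 * x * p + \<delta> * (\<zeta>1 * x * q + \<zeta>2 * y * p) + \<gamma> * \<zeta>2 * y * q \<le> N * (Z * W) * (p + q)" .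
  have t2: "c * r * r' \<le> \<bar>c\<bar> * W\<^sup>2 * r'" if "0 \<le> r" "r \<le> W\<^sup>2" "0 \<le> r'" for c r r' :: real
  proof -
    have "c * r \<le> \<bar>c\<bar> * r" using that by (intro mult_right_mono) auto
    also have "\<dots> \<le> \<bar>c\<bar> * W\<^sup>2" using that by (intro mult_left_mono) auto
    finally show ?thesis using that by (intro mult_right_mono)
  qed
  have "\<alpha> * p * p + 2 * \<delta> * p * q + \<gamma> * q * q \<le> \<bar>\<alpha>\<bar> * W\<^sup>2 * p + 2 * (\<bar>\<delta>\<bar> * W\<^sup>2 * q) + \<bar>\<gamma>\<bar> * W\<^sup>2 * q"
    using t2[of p p \<alpha>] t2[of p q \<delta>] t2[of q q \<gamma>] pos pq by (simp add: mult.assoc)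
  also have "\<dots> \<le> 4 * (N * W\<^sup>2 * (p + q))"
  proof -
    have "0 \<le> \<bar>\<alpha>\<bar> * W\<^sup>2 * p" "0 \<le> \<bar>\<alpha>\<bar> * W\<^sup>2 * q" "0 \<le> \<bar>\<delta>\<bar> * W\<^sup>2 * q" "0 \<le> \<bar>\<delta>\<bar> * W\<^sup>2 * p"
      "0 \<le> \<bar>\<gamma>\<bar> * W\<^sup>2 * q" "0 \<le> \<bar>\<gamma>\<bar> * W\<^sup>2 * p" using pos by simp_all
    then show ?thesis by (simp add: N_def algebra_simps)
  qed
  finally have quad: "\<alpha> * p * p + 2 * \<delta> * p * q + \<gamma> * q * q \<le> 4 * (N * W\<^sup>2 * (p + q))" .
  have arith: "4 * a + 4 * b + c \<le> d + t"
    if "4 * a \<le> d" "4 * v + v' \<le> t" "b \<le> v" "c \<le> v'" for a b c d t v v' :: real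
    using that by linarith
  have "4 * coupling_form \<alpha> \<gamma> \<delta> (\<zeta>1 * x) (\<zeta>2 * y) \<le> - 2 * C_minus \<alpha> \<gamma> \<delta> \<zeta>1 \<zeta>2 * (x\<^sup>2 + y\<^sup>2)"
    using coupling_form_le_C_minus[of \<alpha> \<gamma> \<delta> \<zeta>1 x \<zeta>2 y] by simp
  moreover have "4 * (N * (Z * W) * (p + q)) + 4 * (N * W\<^sup>2 * (p + q)) \<le> 4 * N * (1 + Z) * (W + W\<^sup>2) * (p + q)"
  proof -
    have "0 \<le> N * W * (p + q)" "0 \<le> N * Z * W\<^sup>2 * (p + q)" using pos by simp_all
    then show ?thesis by (simp add: algebra_simps)
  qed
  ultimately have "coupling_form \<alpha> \<gamma> \<delta> (2 * \<zeta>1 * x + p) (2 * \<zeta>2 * y + q)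
      \<le> - 2 * C_minus \<alpha> \<gamma> \<delta> \<zeta>1 \<zeta>2 * (x\<^sup>2 + y\<^sup>2) + 4 * N * (1 + Z) * (W + W\<^sup>2) * (p + q)"
    unfolding split using cross quad by (rule arith)
  then show ?thesis by (simp add: x_def y_def p_def q_def N_def Z_def add.assoc)
qed

context torus
begin

lemma kinetic_eq:
  assumes u: "has_wderiv L u g"
  shows "kinetic \<beta> \<kappa> u = \<beta> * ((nrm g)\<^sup>2 + 2 * \<kappa> * Im (ip g u))"
proof -
  have w: "has_wderiv L u (weak_deriv L u)"
    using u by (intro has_wderiv_weak_deriv) (auto simp: H1_iff)
  note L2 = wderiv_L2'[OF w] wderiv_L2'[OF u] L2_cnj[OF wderiv_L2[OF u]]
  have "nrm (weak_deriv L u) = nrm g"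
    using norm2_reverse_triangle[OF L2(1,2)] wderiv_unique[OF w u] by simp
  moreover have "cmod (\<integral>x. (weak_deriv L u x - g x) * cnj (u x) \<partial>M) \<le> 0"
    using Cauchy_Schwarz_L2[OF L2_diff[OF L2(1,2)] L2(3)] wderiv_unique[OF w u] by simp
  then have "ip (weak_deriv L u) u = ip g u"
    by (simp add: left_diff_distrib L2_mult_integrable L2)
  ultimately show ?thesis by (simp add: kinetic_def)
qed

lemma kinetic_phase:
  assumes u: "u \<in> H1 L" and c: "cmod c = 1"
  shows "kinetic \<beta> \<kappa> (\<lambda>x. c * u x) = kinetic \<beta> \<kappa> u"
proof -
  note w = has_wderiv_weak_deriv[OF u]
  have "c * g * cnj (c * z) = g * cnj z" for g z
  proof -
    have "c * cnj c = 1" using c by (simp flip: complex_norm_square)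
    then show ?thesis by (simp add: mult_ac)
  qed
  then show ?thesis
    unfolding kinetic_eq[OF w] kinetic_eq[OF wderiv_cmult[OF w]] by (simp only: norm2_cmult c) simp
qed

lemma integral_wderiv_0:
  assumes u: "has_wderiv L u g"
  shows "(\<integral>x. g x \<partial>M) = 0"
  using integration_by_parts[OF wderiv_const[of 1] u] by simp

abbreviation perturbed :: "real \<Rightarrow> (real \<Rightarrow> complex) \<Rightarrow> real \<Rightarrow> complex" where
  "perturbed \<zeta> w \<equiv> \<lambda>x. of_real \<zeta> + w x"

lemma kinetic_const_add:
  assumes w: "has_wderiv L w h"
  shows "kinetic \<beta> \<kappa> (perturbed \<zeta> w) = \<beta> * ((nrm h)\<^sup>2 + 2 * \<kappa> * Im (ip h w))"
proof -
  have v: "has_wderiv L (perturbed \<zeta> w) h"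
    using wderiv_add[OF wderiv_const[of "of_real \<zeta>"] w] by simp
  have one: "(\<lambda>_. 1) \<in> L2 M" by (intro continuous_L2 continuous_intros)
  have "integrable M h" using L2_mult_integrable[OF wderiv_L2'[OF w] one] by simp
  then have "(\<integral>x. h x * cnj (of_real \<zeta> + w x) \<partial>M) = ip h w"
    by (simp add: distrib_left L2_mult_integrable wderiv_L2'[OF w] L2_cnj wderiv_L2[OF w] integral_wderiv_0[OF w])
  then show ?thesis unfolding kinetic_eq[OF v] by simp
qed

lemma Re_Im_L2: "f \<in> L2 M \<Longrightarrow> (\<lambda>x. of_real (Re (f x))) \<in> L2 M" "f \<in> L2 M \<Longrightarrow> (\<lambda>x. of_real (Im (f x))) \<in> L2 M"
proof -
  have Re: "(\<lambda>x. of_real (Re (f x))) \<in> L2 M" if "f \<in> L2 M" for f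
  proof -
    have "complex_of_real (Re z) = 1 / 2 * (z + cnj z)" for z by (simp add: complex_eq_iff)
    then show ?thesis using that by (simp only: L2_cmult L2_add L2_cnj)
  qed
  show "f \<in> L2 M \<Longrightarrow> (\<lambda>x. of_real (Re (f x))) \<in> L2 M" by (rule Re)
  show "f \<in> L2 M \<Longrightarrow> (\<lambda>x. of_real (Im (f x))) \<in> L2 M" using Re[OF L2_cmult, of f "- \<i>"] by simp
qed

lemma real_mult_integrable:
  assumes "(\<lambda>x. complex_of_real (f x)) \<in> L2 M" "(\<lambda>x. complex_of_real (g x)) \<in> L2 M"
  shows "integrable M (\<lambda>x. f x * g x)"
  using integrable_Re[OF L2_mult_integrable[OF assms]] by simp

lemma nrm_Re_Im:
  assumes "f \<in> L2 M"
  shows "(nrm f)\<^sup>2 = (\<integral>x. (Re (f x))\<^sup>2 \<partial>M) + (\<integral>x. (Im (f x))\<^sup>2 \<partial>M)"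
  using real_mult_integrable[OF Re_Im_L2(1)[OF assms] Re_Im_L2(1)[OF assms]]
    real_mult_integrable[OF Re_Im_L2(2)[OF assms] Re_Im_L2(2)[OF assms]]
  by (simp add: norm2_sq cmod_power2 flip: power2_eq_square)

lemma real_Wirtinger:
  assumes "has_wderiv L (\<lambda>x. of_real (f x)) (\<lambda>x. of_real (g x))"
  shows "(2 * pi / L)\<^sup>2 * ((\<integral>x. (f x)\<^sup>2 \<partial>M) - (\<integral>x. f x \<partial>M)\<^sup>2 / L) \<le> (\<integral>x. (g x)\<^sup>2 \<partial>M)"
proof -
  have "(nrm (\<lambda>x. of_real (f x)))\<^sup>2 = (\<integral>x. (f x)\<^sup>2 \<partial>M)" "(nrm (\<lambda>x. of_real (g x)))\<^sup>2 = (\<integral>x. (g x)\<^sup>2 \<partial>M)"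
    by (simp_all add: norm2_sq)
  then show ?thesis using Wirtinger[OF assms] by (simp add: integral_complex_of_real)
qed

text \<open>
  The first-order term couples the real part of the perturbation with the derivative of its
  imaginary part.  Completing the square costs \<open>4 \<kappa>\<^sup>2\<close> times the squared norm of the real part,
  up to an arbitrarily small loss \<open>\<theta>\<close>, and the Wirtinger inequality pays for it.
\<close>

lemma kinetic_lower_bound:
  assumes w: "has_wderiv L w h" and \<beta>: "0 < \<beta>" and \<theta>: "0 < \<theta>" "\<theta> < 1"
  shows "\<theta> * \<beta> * (nrm h)\<^sup>2
      + ((1 - \<theta>) * \<beta> * (2 * pi / L)\<^sup>2 - 4 * \<beta> * \<kappa>\<^sup>2 / (1 - \<theta>)) * (\<integral>x. (Re (w x))\<^sup>2 \<partial>M)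
      - \<beta> * (2 * pi / L)\<^sup>2 / L * (\<integral>x. Re (w x) \<partial>M)\<^sup>2
    \<le> \<beta> * ((nrm h)\<^sup>2 + 2 * \<kappa> * Im (ip h w))"
proof -
  define A B R I m b where "A = (\<integral>x. (Re (h x))\<^sup>2 \<partial>M)" and "B = (\<integral>x. (Im (h x))\<^sup>2 \<partial>M)"
    and "R = (\<integral>x. (Re (w x))\<^sup>2 \<partial>M)" and "I = (\<integral>x. Re (w x) * Im (h x) \<partial>M)"
    and "m = (\<integral>x. Re (w x) \<partial>M)" and "b = 1 - \<theta>"
  define \<nu> where "\<nu> = (2 * pi / L)\<^sup>2"
  note wL2 = wderiv_L2[OF w] and hL2 = wderiv_L2'[OF w]
  note wR = Re_Im_L2(1)[OF wL2] and wI = Re_Im_L2(2)[OF wL2]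
    and hR = Re_Im_L2(1)[OF hL2] and hI = Re_Im_L2(2)[OF hL2]
  have h: "(nrm h)\<^sup>2 = A + B" unfolding A_def B_def by (rule nrm_Re_Im[OF hL2])
  have "(\<integral>x. of_real (Re (w x)) * complex_of_real (Im (h x)) \<partial>M) = - (\<integral>x. of_real (Re (h x)) * of_real (Im (w x)) \<partial>M)"
    by (rule integration_by_parts[OF wderiv_Re[OF w] wderiv_Im[OF w]])
  then have "complex_of_real I = of_real (- (\<integral>x. Re (h x) * Im (w x) \<partial>M))"
    unfolding I_def of_real_minus by (simp only: of_real_mult[symmetric] integral_complex_of_real)
  then have I': "I = - (\<integral>x. Re (h x) * Im (w x) \<partial>M)" by (simp only: of_real_eq_iff)
  have "Im (ip h w) = (\<integral>x. Im (h x * cnj (w x)) \<partial>M)"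
    by (rule integral_Im[symmetric]) (intro L2_mult_integrable hL2 L2_cnj wL2)
  also have "\<dots> = (\<integral>x. Re (w x) * Im (h x) - Re (h x) * Im (w x) \<partial>M)"
    by (intro Bochner_Integration.integral_cong) (auto simp: algebra_simps)
  also have "\<dots> = 2 * I"
    using real_mult_integrable[OF wR hI] real_mult_integrable[OF hR wI] I' by (simp add: I_def)
  finally have Im: "Im (ip h w) = 2 * I" .
  have b: "0 < b" "b < 1" using \<theta> by (auto simp: b_def)
  \<comment> \<open>The square to be completed, integrated.\<close>
  have "0 \<le> (\<integral>x. (b * Im (h x) + 2 * \<kappa> * Re (w x))\<^sup>2 \<partial>M)" by simp
  also have "\<dots> = (\<integral>x. b\<^sup>2 * (Im (h x) * Im (h x)) + 4 * b * \<kappa> * (Re (w x) * Im (h x))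
      + 4 * \<kappa>\<^sup>2 * (Re (w x) * Re (w x)) \<partial>M)"
    by (intro Bochner_Integration.integral_cong) (auto simp: power2_eq_square algebra_simps)
  also have "\<dots> = b\<^sup>2 * B + 4 * b * \<kappa> * I + 4 * \<kappa>\<^sup>2 * R"
    using real_mult_integrable[OF hI hI] real_mult_integrable[OF wR hI] real_mult_integrable[OF wR wR]
    by (simp add: B_def I_def R_def power2_eq_square)
  finally have "0 \<le> (b\<^sup>2 * B + 4 * b * \<kappa> * I + 4 * \<kappa>\<^sup>2 * R) / b" using b by simp
  also have "\<dots> = b * B + 4 * \<kappa> * I + 4 * \<kappa>\<^sup>2 / b * R"
    using b by (simp add: power2_eq_square field_simps)
  finally have sq: "0 \<le> b * B + 4 * \<kappa> * I + 4 * \<kappa>\<^sup>2 / b * R" .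
  have "\<nu> * (R - m\<^sup>2 / L) \<le> A"
    unfolding \<nu>_def R_def m_def A_def by (rule real_Wirtinger[OF wderiv_Re[OF w]])
  then have "b * (\<nu> * (R - m\<^sup>2 / L)) \<le> b * A" using b by (intro mult_left_mono) auto
  moreover have "b * (\<nu> * (m\<^sup>2 / L)) \<le> 1 * (\<nu> * (m\<^sup>2 / L))"
    using b L_pos by (intro mult_right_mono) (auto simp: \<nu>_def)
  ultimately have "b * \<nu> * R - \<nu> / L * m\<^sup>2 \<le> b * A" by (simp add: algebra_simps)
  with sq have "\<theta> * (A + B) + (b * \<nu> - 4 * \<kappa>\<^sup>2 / b) * R - \<nu> / L * m\<^sup>2 \<le> (A + B) + 4 * \<kappa> * I"
    by (simp add: b_def algebra_simps)
  then have "\<beta> * (\<theta> * (A + B) + (b * \<nu> - 4 * \<kappa>\<^sup>2 / b) * R - \<nu> / L * m\<^sup>2) \<le> \<beta> * ((A + B) + 4 * \<kappa> * I)"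
    using \<beta> by (intro mult_left_mono) auto
  then show ?thesis
    unfolding Im h R_def[symmetric] m_def[symmetric] b_def[symmetric] \<nu>_def[symmetric]
    by (simp add: algebra_simps)
qed

end

context torus
begin

section \<open>The Lyapunov functional\<close>

text \<open>
  Energy plus those multiples of the masses that make the constant state critical, normalized to
  vanish there.  In this form the critical point is visible: the potential part is a quadratic form
  in the deviations of the densities.
\<close>

definition Lyapunov :: "real \<Rightarrow> real \<Rightarrow> real \<Rightarrow> real \<Rightarrow> real \<Rightarrow> real \<Rightarrow> real \<Rightarrow> state \<Rightarrow> real" where
  "Lyapunov \<beta> k \<alpha> \<gamma> \<delta> \<zeta>1 \<zeta>2 v = kinetic \<beta> k (fst v) + kinetic \<beta> (- k) (snd v)
    - (\<integral>x. coupling_form \<alpha> \<gamma> \<delta> ((cmod (fst v x))\<^sup>2 - \<zeta>1\<^sup>2) ((cmod (snd v x))\<^sup>2 - \<zeta>2\<^sup>2) \<partial>M) / 2"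

definition mass_excess :: "real \<Rightarrow> (real \<Rightarrow> complex) \<Rightarrow> real" where
  "mass_excess \<zeta> v = (nrm v)\<^sup>2 - L * \<zeta>\<^sup>2"

lemma Lyapunov_energy:
  assumes v: "v \<in> phase_space L"
  shows "Lyapunov \<beta> k \<alpha> \<gamma> \<delta> \<zeta>1 \<zeta>2 v = energy \<beta> k \<alpha> \<gamma> \<delta> v
    + (\<alpha> * \<zeta>1\<^sup>2 + \<delta> * \<zeta>2\<^sup>2) * (nrm (fst v))\<^sup>2 + (\<delta> * \<zeta>1\<^sup>2 + \<gamma> * \<zeta>2\<^sup>2) * (nrm (snd v))\<^sup>2
    - L * coupling_form \<alpha> \<gamma> \<delta> (\<zeta>1\<^sup>2) (\<zeta>2\<^sup>2) / 2"
proof -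
  have v1: "continuous_on UNIV (fst v)" and v2: "continuous_on UNIV (snd v)"
    using v by (auto simp: phase_space_def H1_def)
  have i: "integrable M (\<lambda>x. quartic \<alpha> \<gamma> \<delta> (fst v x) (snd v x))"
    "integrable M (\<lambda>x. (cmod (fst v x))\<^sup>2)" "integrable M (\<lambda>x. (cmod (snd v x))\<^sup>2)"
    unfolding quartic_def by (intro continuous_integrable continuous_intros v1 v2)+
  have "(\<integral>x. coupling_form \<alpha> \<gamma> \<delta> ((cmod (fst v x))\<^sup>2 - \<zeta>1\<^sup>2) ((cmod (snd v x))\<^sup>2 - \<zeta>2\<^sup>2) \<partial>M)
      = (\<integral>x. quartic \<alpha> \<gamma> \<delta> (fst v x) (snd v x)
        - 2 * (\<alpha> * \<zeta>1\<^sup>2 + \<delta> * \<zeta>2\<^sup>2) * (cmod (fst v x))\<^sup>2 - 2 * (\<delta> * \<zeta>1\<^sup>2 + \<gamma> * \<zeta>2\<^sup>2) * (cmod (snd v x))\<^sup>2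
        + coupling_form \<alpha> \<gamma> \<delta> (\<zeta>1\<^sup>2) (\<zeta>2\<^sup>2) \<partial>M)"
    by (intro Bochner_Integration.integral_cong)
      (auto simp: coupling_form_def quartic_def power4_eq_xxxx power2_eq_square algebra_simps)
  also have "\<dots> = (\<integral>x. quartic \<alpha> \<gamma> \<delta> (fst v x) (snd v x) \<partial>M)
        - 2 * (\<alpha> * \<zeta>1\<^sup>2 + \<delta> * \<zeta>2\<^sup>2) * (nrm (fst v))\<^sup>2 - 2 * (\<delta> * \<zeta>1\<^sup>2 + \<gamma> * \<zeta>2\<^sup>2) * (nrm (snd v))\<^sup>2
        + L * coupling_form \<alpha> \<gamma> \<delta> (\<zeta>1\<^sup>2) (\<zeta>2\<^sup>2)"
    using i by (simp add: norm2_sq)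
  finally show ?thesis by (simp add: Lyapunov_def energy_def field_simps)
qed

lemma phase_H1: "u \<in> H1 L \<Longrightarrow> (\<lambda>x. c * u x) \<in> H1 L"
  by (auto simp: H1_iff dest: wderiv_cmult)

lemma Lyapunov_phase:
  assumes "v \<in> phase_space L" "cmod c = 1" "cmod d = 1"
  shows "Lyapunov \<beta> k \<alpha> \<gamma> \<delta> \<zeta>1 \<zeta>2 (\<lambda>x. c * fst v x, \<lambda>x. d * snd v x) = Lyapunov \<beta> k \<alpha> \<gamma> \<delta> \<zeta>1 \<zeta>2 v"
  using assms by (auto simp: Lyapunov_def kinetic_phase norm_mult phase_space_def)

lemma cmod_const_add_sq: "(cmod (of_real \<zeta> + z))\<^sup>2 - \<zeta>\<^sup>2 = 2 * \<zeta> * Re z + (cmod z)\<^sup>2"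
  by (simp add: cmod_power2) (simp add: power2_eq_square algebra_simps)

lemma Lyapunov_const_add:
  assumes "has_wderiv L w1 g1" "has_wderiv L w2 g2"
  shows "Lyapunov \<beta> k \<alpha> \<gamma> \<delta> \<zeta>1 \<zeta>2 (perturbed \<zeta>1 w1, perturbed \<zeta>2 w2) =
    \<beta> * ((nrm g1)\<^sup>2 + 2 * k * Im (ip g1 w1))
    + \<beta> * ((nrm g2)\<^sup>2 + 2 * (- k) * Im (ip g2 w2))
    - (\<integral>x. coupling_form \<alpha> \<gamma> \<delta> (2 * \<zeta>1 * Re (w1 x) + (cmod (w1 x))\<^sup>2) (2 * \<zeta>2 * Re (w2 x) + (cmod (w2 x))\<^sup>2) \<partial>M) / 2"
  unfolding Lyapunov_def fst_conv snd_conv kinetic_const_add[OF assms(1)] kinetic_const_add[OF assms(2)]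
    cmod_const_add_sq by simp

lemma mass_excess_const_add:
  assumes w: "has_wderiv L w h"
  shows "mass_excess \<zeta> (perturbed \<zeta> w) = 2 * \<zeta> * (\<integral>x. Re (w x) \<partial>M) + (nrm w)\<^sup>2"
proof -
  have c: "(\<lambda>_. of_real \<zeta>) \<in> L2 M" by (intro continuous_L2 continuous_intros)
  have i: "integrable M (\<lambda>x. cnj (w x))" "integrable M w"
    by (intro continuous_integrable continuous_intros wderiv_continuous[OF w])+
  have "Re (\<integral>x. of_real \<zeta> * cnj (w x) \<partial>M) = \<zeta> * (\<integral>x. Re (w x) \<partial>M)"
    using i by (simp add: integral_Re)
  then show ?thesis
    using norm2_add_sq[OF c wderiv_L2[OF w]] L_pos
    by (simp add: mass_excess_def norm2_const power_mult_distrib)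
qed

text \<open>
  The mass constraint makes the mean of the real part of second order, so that it does not spoil
  coercivity.
\<close>

lemma mean_Re_bound:
  assumes w: "has_wderiv L w h" and \<zeta>: "\<zeta> \<noteq> 0"
  shows "(\<integral>x. Re (w x) \<partial>M)\<^sup>2 \<le> ((mass_excess \<zeta> (perturbed \<zeta> w))\<^sup>2 + (nrm w)^4) / (2 * \<zeta>\<^sup>2)"
proof -
  define m D y where "m = (\<integral>x. Re (w x) \<partial>M)" and "D = mass_excess \<zeta> (perturbed \<zeta> w)"
    and "y = (nrm w)\<^sup>2"
  have "2 * \<zeta> * m = D - y"
    unfolding m_def D_def y_def mass_excess_const_add[OF w] by simp
  then have "4 * \<zeta>\<^sup>2 * m\<^sup>2 = (D - y)\<^sup>2"
    by (metis (no_types, opaque_lifting) four_x_squared mult.assoc power_mult_distrib)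
  also have "\<dots> \<le> 2 * (D\<^sup>2 + y\<^sup>2)"
    using sum_squares_ge_zero[of "D + y" 0] by (simp add: power2_eq_square algebra_simps)
  finally have "m\<^sup>2 * (2 * \<zeta>\<^sup>2) \<le> D\<^sup>2 + y\<^sup>2" by (simp add: mult_ac)
  then have "m\<^sup>2 \<le> (D\<^sup>2 + y\<^sup>2) / (2 * \<zeta>\<^sup>2)"
    using \<zeta> by (subst pos_le_divide_eq) auto
  then show ?thesis by (simp add: m_def D_def y_def)
qed

definition perturbation_size :: "(real \<Rightarrow> complex) \<Rightarrow> (real \<Rightarrow> complex) \<Rightarrow> real" where
  "perturbation_size w1 w2 = sqrt ((h1 L w1)\<^sup>2 + (h1 L w2)\<^sup>2)"

lemma h1_sq_eq: "has_wderiv L w h \<Longrightarrow> (h1 L w)\<^sup>2 = (nrm w)\<^sup>2 + (nrm h)\<^sup>2"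
  by (simp add: h1_eq)

lemma perturbation_size_sq: "(perturbation_size w1 w2)\<^sup>2 = (h1 L w1)\<^sup>2 + (h1 L w2)\<^sup>2"
  by (simp add: perturbation_size_def)

lemma perturbation_sup:
  assumes "w1 \<in> H1 L" "w2 \<in> H1 L"
  shows "cmod (w1 x) \<le> Sob * perturbation_size w1 w2" "cmod (w2 x) \<le> Sob * perturbation_size w1 w2"
proof -
  have "h1 L w1 \<le> perturbation_size w1 w2" "h1 L w2 \<le> perturbation_size w1 w2"
    unfolding perturbation_size_def by (auto intro!: real_le_rsqrt)
  then show "cmod (w1 x) \<le> Sob * perturbation_size w1 w2" "cmod (w2 x) \<le> Sob * perturbation_size w1 w2"
    using Sobolev[OF assms(1), of x] Sobolev[OF assms(2), of x] Sob_pos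
    by (meson mult_left_mono order_trans less_imp_le)+
qed

text \<open>
  The kinetic part bounds the potential part because the stability condition is a strict inequality
  and therefore leaves a share \<open>\<theta>\<close> of the kinetic energy over.  This controls the full \<open>H\<^sup>1\<close> norm: the
  imaginary parts have mean zero and are governed by their derivatives.  The means of the real parts
  enter through the mass excess, and the terms of third and fourth order are absorbed when the
  perturbation is small.
\<close>

theorem Lyapunov_coercive:
  assumes \<beta>: "0 < \<beta>" and \<zeta>: "\<zeta>1 \<noteq> 0" "\<zeta>2 \<noteq> 0"
    and stable: "\<beta> * (2 * pi / L)\<^sup>2 + C_minus \<alpha> \<gamma> \<delta> \<zeta>1 \<zeta>2 > 4 * \<beta> * k\<^sup>2"
  obtains c K z0 where "0 < c" "0 \<le> K" "0 < z0"
    "\<And>w1 w2. w1 \<in> H1 L \<Longrightarrow> w2 \<in> H1 L \<Longrightarrow> (\<integral>x. Im (w1 x) \<partial>M) = 0 \<Longrightarrow> (\<integral>x. Im (w2 x) \<partial>M) = 0 \<Longrightarrow>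
      perturbation_size w1 w2 \<le> z0 \<Longrightarrow>
      c * (perturbation_size w1 w2)\<^sup>2 \<le>
        Lyapunov \<beta> k \<alpha> \<gamma> \<delta> \<zeta>1 \<zeta>2 (perturbed \<zeta>1 w1, perturbed \<zeta>2 w2)
        + K * ((mass_excess \<zeta>1 (perturbed \<zeta>1 w1))\<^sup>2 + (mass_excess \<zeta>2 (perturbed \<zeta>2 w2))\<^sup>2)"
proof -
  define C where "C = C_minus \<alpha> \<gamma> \<delta> \<zeta>1 \<zeta>2"
  define \<nu> where "\<nu> = (2 * pi / L)\<^sup>2"
  have \<nu>: "0 < \<nu>" using L_pos by (simp add: \<nu>_def)
  \<comment> \<open>At \<open>\<theta> = 0\<close> the coefficient of the squared real part is positive by the stability condition.\<close>
  have "((\<lambda>\<theta>. (1 - \<theta>) * \<beta> * \<nu> - 4 * \<beta> * k\<^sup>2 / (1 - \<theta>) + C) \<longlongrightarrow>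
      (1 - 0) * \<beta> * \<nu> - 4 * \<beta> * k\<^sup>2 / (1 - 0) + C) (at_right 0)"
    by (intro tendsto_intros) auto
  then have "\<forall>\<^sub>F \<theta> in at_right 0. 0 < (1 - \<theta>) * \<beta> * \<nu> - 4 * \<beta> * k\<^sup>2 / (1 - \<theta>) + C"
    using stable by (intro order_tendstoD(1)) (auto simp: C_def \<nu>_def)
  then have "\<forall>\<^sub>F \<theta> in at_right 0. 0 < (1 - \<theta>) * \<beta> * \<nu> - 4 * \<beta> * k\<^sup>2 / (1 - \<theta>) + C \<and> \<theta> \<in> {0<..<1}"
    using eventually_at_right_real[of 0 1] by (simp add: eventually_conj_iff)
  then obtain \<theta> where \<theta>: "0 < \<theta>" "\<theta> < 1" and \<tau>0: "0 < (1 - \<theta>) * \<beta> * \<nu> - 4 * \<beta> * k\<^sup>2 / (1 - \<theta>) + C"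
    using eventually_happens[of _ "at_right (0::real)"] by (auto simp: trivial_limit_at_right_real)
  define \<sigma> where "\<sigma> = (1 - \<theta>) * \<beta> * \<nu> - 4 * \<beta> * k\<^sup>2 / (1 - \<theta>)"
  define \<tau> where "\<tau> = \<sigma> + C"
  have \<tau>: "0 < \<tau>" using \<tau>0 by (simp add: \<tau>_def \<sigma>_def)
  define c where "c = min (min (\<theta> * \<beta> / 2) (\<theta> * \<beta> * \<nu> / 2)) \<tau>"
  have c: "0 < c" "c \<le> \<theta> * \<beta> / 2" "c \<le> \<theta> * \<beta> * \<nu> / 2" "c \<le> \<tau>"
    using \<theta> \<beta> \<nu> \<tau> by (auto simp: c_def)
  define K where "K = \<beta> * \<nu> / L * (1 / (2 * \<zeta>1\<^sup>2) + 1 / (2 * \<zeta>2\<^sup>2))"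
  have K: "0 \<le> K" using \<beta> \<nu> L_pos by (simp add: K_def)
  define N where "N = 2 * (\<bar>\<alpha>\<bar> + \<bar>\<delta>\<bar> + \<bar>\<gamma>\<bar>) * (1 + \<bar>\<zeta>1\<bar> + \<bar>\<zeta>2\<bar>) * (Sob + Sob\<^sup>2)"
  have N: "0 \<le> N" using Sob_pos by (simp add: N_def)
  \<comment> \<open>Below \<open>z0\<close> all terms of order higher than two cost at most half of the quadratic lower bound.\<close>
  define z0 where "z0 = min 1 (c / (2 * (2 * K + N + 1)))"
  have KN: "0 < 2 * K + N + 1" using K N by linarith
  have z0: "0 < z0" "z0 \<le> 1" unfolding z0_def using c KN by (auto intro!: divide_pos_pos mult_pos_pos)
  have z0': "(2 * K + N) * z0 \<le> c / 2"
  proof -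
    define X where "X = 2 * K + N + 1"
    have X: "0 < X" using KN by (simp add: X_def)
    have "(2 * K + N) * z0 \<le> X * (c / (2 * X))"
      using K N z0 by (intro mult_mono) (auto simp: z0_def X_def)
    then show ?thesis using X by simp
  qed
  show ?thesis
  proof (rule that[of "c / 2" K z0])
    fix w1 w2
    assume w: "w1 \<in> H1 L" "w2 \<in> H1 L" and mean: "(\<integral>x. Im (w1 x) \<partial>M) = 0" "(\<integral>x. Im (w2 x) \<partial>M) = 0"
      and small: "perturbation_size w1 w2 \<le> z0"
    obtain g1 g2 where g: "has_wderiv L w1 g1" "has_wderiv L w2 g2" using w by (auto simp: H1_iff)
    define z where "z = perturbation_size w1 w2"
    have "0 \<le> z" by (simp add: z_def perturbation_size_def)
    then have z: "0 \<le> z" "z \<le> z0" "z \<le> 1" using small z0 unfolding z_def[symmetric] by linarith+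
    have z_sq: "z\<^sup>2 = (nrm w1)\<^sup>2 + (nrm g1)\<^sup>2 + ((nrm w2)\<^sup>2 + (nrm g2)\<^sup>2)"
      unfolding z_def perturbation_size_sq h1_sq_eq[OF g(1)] h1_sq_eq[OF g(2)] by simp
    define R1 R2 where "R1 = (\<integral>x. (Re (w1 x))\<^sup>2 \<partial>M)" and "R2 = (\<integral>x. (Re (w2 x))\<^sup>2 \<partial>M)"
    define D1 D2 where "D1 = mass_excess \<zeta>1 (perturbed \<zeta>1 w1)"
      and "D2 = mass_excess \<zeta>2 (perturbed \<zeta>2 w2)"
    have comp: "c * ((nrm w)\<^sup>2 + (nrm g)\<^sup>2) - \<beta> * \<nu> / L * (1 / (2 * \<zeta>\<^sup>2)) * (D\<^sup>2 + z\<^sup>2 * z\<^sup>2)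
        \<le> \<beta> * ((nrm g)\<^sup>2 + 2 * \<kappa> * Im (ip g w)) + C * (\<integral>x. (Re (w x))\<^sup>2 \<partial>M)"
      if w: "has_wderiv L w g" and mean: "(\<integral>x. Im (w x) \<partial>M) = 0" and \<kappa>: "\<kappa>\<^sup>2 = k\<^sup>2" and \<zeta>: "\<zeta> \<noteq> 0"
        and D: "D = mass_excess \<zeta> (perturbed \<zeta> w)" and wz: "(nrm w)\<^sup>2 \<le> z\<^sup>2" for w g \<kappa> \<zeta> D
    proof -
      define R S A B m where "R = (\<integral>x. (Re (w x))\<^sup>2 \<partial>M)" and "S = (\<integral>x. (Im (w x))\<^sup>2 \<partial>M)"
        and "A = (\<integral>x. (Re (g x))\<^sup>2 \<partial>M)" and "B = (\<integral>x. (Im (g x))\<^sup>2 \<partial>M)" and "m = (\<integral>x. Re (w x) \<partial>M)"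
      have nn: "0 \<le> R" "0 \<le> S" "0 \<le> A" "0 \<le> B" by (auto simp: R_def S_def A_def B_def)
      have eqs: "(nrm w)\<^sup>2 = R + S" "(nrm g)\<^sup>2 = A + B"
        unfolding R_def S_def A_def B_def by (rule nrm_Re_Im[OF wderiv_L2[OF w]], rule nrm_Re_Im[OF wderiv_L2'[OF w]])
      have SB: "\<nu> * S \<le> B"
        using real_Wirtinger[OF wderiv_Im[OF w]] mean by (simp add: \<nu>_def S_def B_def)
      have low: "\<theta> * \<beta> * (A + B) + \<sigma> * R - \<beta> * \<nu> / L * m\<^sup>2
          \<le> \<beta> * ((nrm g)\<^sup>2 + 2 * \<kappa> * Im (ip g w))"
        using kinetic_lower_bound[OF w \<beta> \<theta>, of \<kappa>]
        unfolding \<kappa> \<sigma>_def \<nu>_def[symmetric] R_def[symmetric] m_def[symmetric] eqs(2) .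
      have "c * (R + S + (A + B)) \<le> \<theta> * \<beta> * (A + B) + \<tau> * R"
      proof -
        define p where "p = \<theta> * \<beta> / 2"
        have p: "0 \<le> p" "c \<le> p" "c \<le> p * \<nu>" using \<theta> \<beta> c by (simp_all add: p_def)
        have "c * R \<le> \<tau> * R" "c * A \<le> p * A" "c * B \<le> p * B"
          by (intro mult_right_mono c p nn)+
        moreover have "0 \<le> p * A" using p nn by simp
        moreover have "c * S \<le> p * B"
        proof -
          have "c * S \<le> p * \<nu> * S" by (intro mult_right_mono p nn)
          also have "\<dots> = p * (\<nu> * S)" by (rule mult.assoc)
          also have "\<dots> \<le> p * B" by (intro mult_left_mono SB p)
          finally show ?thesis .
        qed
        moreover have "\<theta> * \<beta> * (A + B) = 2 * (p * A) + 2 * (p * B)" by (simp add: p_def distrib_left)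
        moreover have "c * (R + S + (A + B)) = c * R + c * S + (c * A + c * B)" by (simp only: distrib_left)
        ultimately show ?thesis by linarith
      qed
      moreover have "\<beta> * \<nu> / L * m\<^sup>2 \<le> \<beta> * \<nu> / L * (1 / (2 * \<zeta>\<^sup>2)) * (D\<^sup>2 + z\<^sup>2 * z\<^sup>2)"
      proof -
        have "(nrm w)^4 = (nrm w)\<^sup>2 * (nrm w)\<^sup>2" by (simp add: power4_eq_xxxx power2_eq_square)
        also have "\<dots> \<le> z\<^sup>2 * z\<^sup>2" using wz by (intro mult_mono) auto
        finally have "m\<^sup>2 \<le> (D\<^sup>2 + z\<^sup>2 * z\<^sup>2) / (2 * \<zeta>\<^sup>2)"
          using mean_Re_bound[OF w \<zeta>] unfolding m_def[symmetric] D[symmetric]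
          by (smt (verit) divide_right_mono zero_le_power2)
        then have "\<beta> * \<nu> / L * m\<^sup>2 \<le> \<beta> * \<nu> / L * ((D\<^sup>2 + z\<^sup>2 * z\<^sup>2) / (2 * \<zeta>\<^sup>2))"
          using \<beta> \<nu> L_pos by (intro mult_left_mono) auto
        then show ?thesis by simp
      qed
      moreover have "\<tau> * R = \<sigma> * R + C * R" by (simp add: \<tau>_def distrib_right)
      ultimately show ?thesis using low unfolding eqs(1) R_def[symmetric] eqs(2) by linarith
    qed
    have c1: "c * ((nrm w1)\<^sup>2 + (nrm g1)\<^sup>2) - \<beta> * \<nu> / L * (1 / (2 * \<zeta>1\<^sup>2)) * (D1\<^sup>2 + z\<^sup>2 * z\<^sup>2)
        \<le> \<beta> * ((nrm g1)\<^sup>2 + 2 * k * Im (ip g1 w1)) + C * R1"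
      unfolding R1_def by (rule comp[OF g(1) mean(1) refl \<zeta>(1) D1_def]) (simp add: z_sq)
    have c2: "c * ((nrm w2)\<^sup>2 + (nrm g2)\<^sup>2) - \<beta> * \<nu> / L * (1 / (2 * \<zeta>2\<^sup>2)) * (D2\<^sup>2 + z\<^sup>2 * z\<^sup>2)
        \<le> \<beta> * ((nrm g2)\<^sup>2 + 2 * (- k) * Im (ip g2 w2)) + C * R2"
      unfolding R2_def by (rule comp[OF g(2) mean(2) _ \<zeta>(2) D2_def]) (simp_all add: z_sq)
    have nonlin: "(\<integral>x. coupling_form \<alpha> \<gamma> \<delta> (2 * \<zeta>1 * Re (w1 x) + (cmod (w1 x))\<^sup>2)
        (2 * \<zeta>2 * Re (w2 x) + (cmod (w2 x))\<^sup>2) \<partial>M) / 2 \<le> - C * (R1 + R2) + N * z * z\<^sup>2"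
    proof -
      define N' where "N' = 4 * (\<bar>\<alpha>\<bar> + \<bar>\<delta>\<bar> + \<bar>\<gamma>\<bar>) * (1 + \<bar>\<zeta>1\<bar> + \<bar>\<zeta>2\<bar>)"
      have N': "0 \<le> N'" by (simp add: N'_def)
      note cont = wderiv_continuous[OF g(1)] wderiv_continuous[OF g(2)]
      have "(\<integral>x. coupling_form \<alpha> \<gamma> \<delta> (2 * \<zeta>1 * Re (w1 x) + (cmod (w1 x))\<^sup>2)
          (2 * \<zeta>2 * Re (w2 x) + (cmod (w2 x))\<^sup>2) \<partial>M)
        \<le> (\<integral>x. - 2 * C * ((Re (w1 x))\<^sup>2 + (Re (w2 x))\<^sup>2)
          + N' * (Sob * z + (Sob * z)\<^sup>2) * ((cmod (w1 x))\<^sup>2 + (cmod (w2 x))\<^sup>2) \<partial>M)"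
      proof (rule integral_mono)
        show "integrable M (\<lambda>x. coupling_form \<alpha> \<gamma> \<delta> (2 * \<zeta>1 * Re (w1 x) + (cmod (w1 x))\<^sup>2)
          (2 * \<zeta>2 * Re (w2 x) + (cmod (w2 x))\<^sup>2))"
          unfolding coupling_form_def by (intro continuous_integrable continuous_intros cont)
        show "integrable M (\<lambda>x. - 2 * C * ((Re (w1 x))\<^sup>2 + (Re (w2 x))\<^sup>2)
          + N' * (Sob * z + (Sob * z)\<^sup>2) * ((cmod (w1 x))\<^sup>2 + (cmod (w2 x))\<^sup>2))"
          by (intro continuous_integrable continuous_intros cont)
        show "coupling_form \<alpha> \<gamma> \<delta> (2 * \<zeta>1 * Re (w1 x) + (cmod (w1 x))\<^sup>2)
          (2 * \<zeta>2 * Re (w2 x) + (cmod (w2 x))\<^sup>2) \<le> - 2 * C * ((Re (w1 x))\<^sup>2 + (Re (w2 x))\<^sup>2)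
          + N' * (Sob * z + (Sob * z)\<^sup>2) * ((cmod (w1 x))\<^sup>2 + (cmod (w2 x))\<^sup>2)" for x
          unfolding C_def N'_def z_def by (rule coupling_form_density_upper[OF perturbation_sup[OF w]])
      qed
      also have "\<dots> = - 2 * C * (R1 + R2) + N' * (Sob * z + (Sob * z)\<^sup>2) * ((nrm w1)\<^sup>2 + (nrm w2)\<^sup>2)"
      proof -
        have "integrable M (\<lambda>x. (Re (w1 x))\<^sup>2)" "integrable M (\<lambda>x. (Re (w2 x))\<^sup>2)"
          "integrable M (\<lambda>x. (cmod (w1 x))\<^sup>2)" "integrable M (\<lambda>x. (cmod (w2 x))\<^sup>2)"
          by (intro continuous_integrable continuous_intros cont)+
        then show ?thesis by (simp add: R1_def R2_def norm2_sq)
      qed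
      also have "N' * (Sob * z + (Sob * z)\<^sup>2) * ((nrm w1)\<^sup>2 + (nrm w2)\<^sup>2) \<le> N' * ((Sob + Sob\<^sup>2) * z) * z\<^sup>2"
      proof -
        have "z\<^sup>2 \<le> z" using z by (simp add: power2_eq_square mult_left_le)
        then have "Sob * z + (Sob * z)\<^sup>2 \<le> (Sob + Sob\<^sup>2) * z"
          by (simp add: power_mult_distrib distrib_right mult_left_mono)
        then show ?thesis
          using N' z Sob_pos by (intro mult_mono mult_left_mono) (auto simp: z_sq)
      qed
      finally have "(\<integral>x. coupling_form \<alpha> \<gamma> \<delta> (2 * \<zeta>1 * Re (w1 x) + (cmod (w1 x))\<^sup>2)
          (2 * \<zeta>2 * Re (w2 x) + (cmod (w2 x))\<^sup>2) \<partial>M)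
        \<le> - 2 * C * (R1 + R2) + N' * ((Sob + Sob\<^sup>2) * z) * z\<^sup>2" by simp
      moreover have "N' * ((Sob + Sob\<^sup>2) * z) * z\<^sup>2 = 2 * (N * z * z\<^sup>2)"
        by (simp add: N_def N'_def)
      ultimately show ?thesis by linarith
    qed
    have "2 * K * (z\<^sup>2 * z\<^sup>2) + N * z * z\<^sup>2 \<le> c / 2 * z\<^sup>2"
    proof -
      have "z * z \<le> z" using z by (simp add: mult_left_le)
      then have "2 * K * (z * z) + N * z \<le> 2 * K * z + N * z"
        using K by (intro add_mono mult_left_mono order_refl) auto
      also have "\<dots> = (2 * K + N) * z" by (simp add: distrib_right)
      also have "\<dots> \<le> (2 * K + N) * z0" using z K N by (intro mult_left_mono) auto
      also note z0'
      finally have "(2 * K * (z * z) + N * z) * z\<^sup>2 \<le> c / 2 * z\<^sup>2" by (intro mult_right_mono) auto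
      then show ?thesis by (simp add: power2_eq_square algebra_simps)
    qed
    moreover have "\<beta> * \<nu> / L * (1 / (2 * \<zeta>1\<^sup>2)) * (D1\<^sup>2 + z\<^sup>2 * z\<^sup>2)
        + \<beta> * \<nu> / L * (1 / (2 * \<zeta>2\<^sup>2)) * (D2\<^sup>2 + z\<^sup>2 * z\<^sup>2) \<le> K * (D1\<^sup>2 + D2\<^sup>2) + K * (z\<^sup>2 * z\<^sup>2)"
    proof -
      define a b where "a = \<beta> * \<nu> / L * (1 / (2 * \<zeta>1\<^sup>2))" and "b = \<beta> * \<nu> / L * (1 / (2 * \<zeta>2\<^sup>2))"
      have "0 \<le> a" "0 \<le> b" using \<beta> \<nu> L_pos by (auto simp: a_def b_def)
      then have "0 \<le> a * D2\<^sup>2" "0 \<le> b * D1\<^sup>2" by simp_all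
      moreover have "K = a + b" unfolding K_def a_def b_def by (rule distrib_left)
      ultimately show ?thesis unfolding a_def[symmetric] b_def[symmetric] by (simp add: algebra_simps)
    qed
    moreover have "0 \<le> K * (z\<^sup>2 * z\<^sup>2)" using K by simp
    moreover have "c * z\<^sup>2 = c * ((nrm w1)\<^sup>2 + (nrm g1)\<^sup>2) + c * ((nrm w2)\<^sup>2 + (nrm g2)\<^sup>2)"
      by (simp add: z_sq distrib_left)
    moreover have "- C * (R1 + R2) = - (C * R1) - C * R2" by (simp add: algebra_simps)
    ultimately show "c / 2 * (perturbation_size w1 w2)\<^sup>2 \<le>
        Lyapunov \<beta> k \<alpha> \<gamma> \<delta> \<zeta>1 \<zeta>2 (perturbed \<zeta>1 w1, perturbed \<zeta>2 w2)
        + K * ((mass_excess \<zeta>1 (perturbed \<zeta>1 w1))\<^sup>2 + (mass_excess \<zeta>2 (perturbed \<zeta>2 w2))\<^sup>2)"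
      unfolding Lyapunov_const_add[OF g] z_def[symmetric] D1_def[symmetric] D2_def[symmetric]
      using c1 c2 nonlin by linarith
  qed (use c K z0 in auto)
qed

lemma integral_le_nrm:
  assumes f: "f \<in> L2 M"
  shows "cmod (\<integral>x. f x \<partial>M) \<le> sqrt L * nrm f"
proof -
  have one: "(\<lambda>_. 1) \<in> L2 M" by (intro continuous_L2 continuous_intros)
  show ?thesis using Cauchy_Schwarz_L2[OF f one] by (simp add: norm2_const mult.commute)
qed

text \<open>
  The functional has no terms of first order because the constant state is critical, and the mass
  excess has no term of order zero.  This makes the conserved quantities small at the initial time.
\<close>

lemma Lyapunov_upper_bound:
  assumes \<beta>: "0 < \<beta>"
  obtains K where "0 \<le> K"
    "\<And>w1 w2. w1 \<in> H1 L \<Longrightarrow> w2 \<in> H1 L \<Longrightarrow> perturbation_size w1 w2 \<le> 1 \<Longrightarrow>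
      Lyapunov \<beta> k \<alpha> \<gamma> \<delta> \<zeta>1 \<zeta>2 (perturbed \<zeta>1 w1, perturbed \<zeta>2 w2) \<le> K * (perturbation_size w1 w2)\<^sup>2
      \<and> (mass_excess \<zeta>1 (perturbed \<zeta>1 w1))\<^sup>2 \<le> K * (perturbation_size w1 w2)\<^sup>2
      \<and> (mass_excess \<zeta>2 (perturbed \<zeta>2 w2))\<^sup>2 \<le> K * (perturbation_size w1 w2)\<^sup>2"
proof -
  define Z where "Z = \<bar>\<zeta>1\<bar> + \<bar>\<zeta>2\<bar>"
  define G where "G = 2 * Z * Sob + Sob\<^sup>2"
  define N where "N = \<bar>\<alpha>\<bar> + 2 * \<bar>\<delta>\<bar> + \<bar>\<gamma>\<bar>"
  define K1 where "K1 = 2 * (\<beta> * (1 + 2 * \<bar>k\<bar>)) + L * (N * G\<^sup>2)"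
  define K2 where "K2 = (2 * Z * sqrt L + 1)\<^sup>2"
  have Z: "0 \<le> Z" "\<bar>\<zeta>1\<bar> \<le> Z" "\<bar>\<zeta>2\<bar> \<le> Z" by (auto simp: Z_def)
  have N: "0 \<le> N" by (simp add: N_def)
  have K12: "0 \<le> K1" "0 \<le> K2" using \<beta> L_pos N by (auto simp: K1_def K2_def)
  show ?thesis
  proof (rule that[of "K1 + K2"])
    fix w1 w2 assume w: "w1 \<in> H1 L" "w2 \<in> H1 L" and small: "perturbation_size w1 w2 \<le> 1"
    obtain g1 g2 where g: "has_wderiv L w1 g1" "has_wderiv L w2 g2" using w by (auto simp: H1_iff)
    define z where "z = perturbation_size w1 w2"
    have z: "0 \<le> z" by (simp add: z_def perturbation_size_def)
    have z1: "z \<le> 1" using small by (simp add: z_def)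
    note z = z z1
    have z_sq: "z\<^sup>2 = (nrm w1)\<^sup>2 + (nrm g1)\<^sup>2 + ((nrm w2)\<^sup>2 + (nrm g2)\<^sup>2)"
      unfolding z_def perturbation_size_sq h1_sq_eq[OF g(1)] h1_sq_eq[OF g(2)] by simp
    have nz: "nrm w1 \<le> z" "nrm g1 \<le> z" "nrm w2 \<le> z" "nrm g2 \<le> z"
      by (rule power2_le_imp_le[OF _ z(1)], simp add: z_sq)+
    have kin: "\<beta> * ((nrm g)\<^sup>2 + 2 * \<kappa> * Im (ip g w)) \<le> \<beta> * (1 + 2 * \<bar>k\<bar>) * z\<^sup>2"
      if g: "has_wderiv L w g" and \<kappa>: "\<bar>\<kappa>\<bar> = \<bar>k\<bar>" and le: "nrm w \<le> z" "nrm g \<le> z" for w g \<kappa>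
    proof -
      have "\<bar>Im (ip g w)\<bar> \<le> nrm g * nrm w"
        using order_trans[OF abs_Im_le_cmod Cauchy_Schwarz_L2[OF wderiv_L2'[OF g] L2_cnj[OF wderiv_L2[OF g]]]] by simp
      also have "\<dots> \<le> z * z" using le z by (intro mult_mono) auto
      finally have "\<bar>\<kappa>\<bar> * \<bar>Im (ip g w)\<bar> \<le> \<bar>k\<bar> * z\<^sup>2"
        unfolding \<kappa> by (intro mult_left_mono) (auto simp: power2_eq_square)
      then have "\<kappa> * Im (ip g w) \<le> \<bar>k\<bar> * z\<^sup>2"
        unfolding abs_mult[symmetric] by linarith
      moreover have "(nrm g)\<^sup>2 \<le> z\<^sup>2" using le by (intro power_mono) auto
      ultimately have "(nrm g)\<^sup>2 + 2 * \<kappa> * Im (ip g w) \<le> (1 + 2 * \<bar>k\<bar>) * z\<^sup>2"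
        by (simp add: distrib_right)
      then show ?thesis using \<beta> by simp
    qed
    have nonlin: "- (\<integral>x. coupling_form \<alpha> \<gamma> \<delta> (2 * \<zeta>1 * Re (w1 x) + (cmod (w1 x))\<^sup>2)
        (2 * \<zeta>2 * Re (w2 x) + (cmod (w2 x))\<^sup>2) \<partial>M) \<le> L * (N * G\<^sup>2) * z\<^sup>2"
    proof -
      let ?f = "\<lambda>x. coupling_form \<alpha> \<gamma> \<delta> (2 * \<zeta>1 * Re (w1 x) + (cmod (w1 x))\<^sup>2)
        (2 * \<zeta>2 * Re (w2 x) + (cmod (w2 x))\<^sup>2)"
      have \<rho>: "\<bar>2 * \<zeta> * Re v + (cmod v)\<^sup>2\<bar> \<le> G * z" if \<zeta>: "\<bar>\<zeta>\<bar> \<le> Z" and v: "cmod v \<le> Sob * z" for \<zeta> v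
      proof -
        have "\<bar>\<zeta> * Re v\<bar> \<le> Z * (Sob * z)"
          unfolding abs_mult using \<zeta> Z v order_trans[OF abs_Re_le_cmod v] by (intro mult_mono) auto
        moreover have "(cmod v)\<^sup>2 \<le> (Sob * z)\<^sup>2" using v by (intro power_mono) auto
        moreover have "(Sob * z)\<^sup>2 \<le> Sob\<^sup>2 * z"
          using z by (simp add: power_mult_distrib power2_eq_square[of z] mult_left_mono mult_left_le)
        moreover have "\<bar>2 * \<zeta> * Re v + (cmod v)\<^sup>2\<bar> \<le> 2 * \<bar>\<zeta> * Re v\<bar> + (cmod v)\<^sup>2"
          using abs_triangle_ineq[of "2 * (\<zeta> * Re v)" "(cmod v)\<^sup>2"] by (simp add: abs_mult mult.assoc)
        moreover have "G * z = 2 * (Z * (Sob * z)) + Sob\<^sup>2 * z" by (simp add: G_def algebra_simps)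
        ultimately show ?thesis by linarith
      qed
      have "\<bar>?f x\<bar> \<le> N * (G * z)\<^sup>2" for x
        unfolding N_def
        by (intro coupling_form_bound \<rho> Z perturbation_sup[OF w, folded z_def])
      moreover have "integrable M ?f"
        unfolding coupling_form_def
        by (intro continuous_integrable continuous_intros wderiv_continuous[OF g(1)] wderiv_continuous[OF g(2)])
      ultimately have "(\<integral>x. - ?f x \<partial>M) \<le> (\<integral>x. N * (G * z)\<^sup>2 \<partial>M)"
        by (intro integral_mono) (auto simp: abs_le_iff)
      then show ?thesis by (simp add: power_mult_distrib mult_ac)
    qed
    have mass: "(mass_excess \<zeta> (perturbed \<zeta> w))\<^sup>2 \<le> K2 * z\<^sup>2"
      if g: "has_wderiv L w g" and \<zeta>: "\<bar>\<zeta>\<bar> \<le> Z" and le: "nrm w \<le> z" for \<zeta> w g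
    proof -
      have i: "integrable M w" by (intro continuous_integrable wderiv_continuous[OF g])
      have "\<bar>\<integral>x. Re (w x) \<partial>M\<bar> \<le> sqrt L * nrm w"
        using order_trans[OF abs_Re_le_cmod integral_le_nrm[OF wderiv_L2[OF g]]] i by simp
      also have "\<dots> \<le> sqrt L * z" using le L_pos by (intro mult_left_mono) auto
      finally have "\<bar>\<zeta> * (\<integral>x. Re (w x) \<partial>M)\<bar> \<le> Z * (sqrt L * z)"
        unfolding abs_mult using \<zeta> Z by (intro mult_mono) auto
      moreover have "(nrm w)\<^sup>2 \<le> 1 * z"
        unfolding power2_eq_square using le z by (intro mult_mono) auto
      ultimately have "\<bar>mass_excess \<zeta> (perturbed \<zeta> w)\<bar> \<le> (2 * Z * sqrt L + 1) * z"
      proof -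
        assume a: "\<bar>\<zeta> * (\<integral>x. Re (w x) \<partial>M)\<bar> \<le> Z * (sqrt L * z)" "(nrm w)\<^sup>2 \<le> 1 * z"
        have "\<bar>2 * \<zeta> * (\<integral>x. Re (w x) \<partial>M) + (nrm w)\<^sup>2\<bar> \<le> 2 * \<bar>\<zeta> * (\<integral>x. Re (w x) \<partial>M)\<bar> + (nrm w)\<^sup>2"
          using abs_triangle_ineq[of "2 * (\<zeta> * (\<integral>x. Re (w x) \<partial>M))" "(nrm w)\<^sup>2"] by (simp add: abs_mult mult.assoc)
        moreover have "(2 * Z * sqrt L + 1) * z = 2 * (Z * (sqrt L * z)) + z" by (simp add: algebra_simps)
        ultimately show ?thesis unfolding mass_excess_const_add[OF g] using a by linarith
      qed
      then show ?thesis unfolding K2_def power_mult_distrib[symmetric] by (rule abs_le_square_iff[THEN iffD1, OF order_trans[OF _ abs_ge_self]])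
    qed
    have "Lyapunov \<beta> k \<alpha> \<gamma> \<delta> \<zeta>1 \<zeta>2 (perturbed \<zeta>1 w1, perturbed \<zeta>2 w2) \<le> K1 * z\<^sup>2"
    proof -
      have "0 \<le> L * (N * G\<^sup>2) * z\<^sup>2" using L_pos N by simp
      then show ?thesis
        unfolding Lyapunov_const_add[OF g] K1_def
        using kin[OF g(1) refl nz(1,2)] kin[OF g(2) _ nz(3,4), of "- k"] nonlin by (simp add: distrib_right)
    qed
    then show "Lyapunov \<beta> k \<alpha> \<gamma> \<delta> \<zeta>1 \<zeta>2 (perturbed \<zeta>1 w1, perturbed \<zeta>2 w2) \<le> (K1 + K2) * (perturbation_size w1 w2)\<^sup>2
      \<and> (mass_excess \<zeta>1 (perturbed \<zeta>1 w1))\<^sup>2 \<le> (K1 + K2) * (perturbation_size w1 w2)\<^sup>2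
      \<and> (mass_excess \<zeta>2 (perturbed \<zeta>2 w2))\<^sup>2 \<le> (K1 + K2) * (perturbation_size w1 w2)\<^sup>2"
      using mass[OF g(1) Z(2) nz(1)] mass[OF g(2) Z(3) nz(3)] mult_nonneg_nonneg[OF K12(1) zero_le_power2[of z]]
        mult_nonneg_nonneg[OF K12(2) zero_le_power2[of z]]
      unfolding z_def[symmetric] by (simp add: distrib_right)
  qed (use K12 in simp)
qed

section \<open>Distance to the orbit\<close>

text \<open>
  The squared \<open>H\<^sup>1\<close> distance of one component to the circle of constants of modulus \<open>\<bar>\<zeta>\<bar>\<close>.  The
  formula contains no phase, so that along a solution it is visibly continuous in time.
\<close>

definition orbit_gap :: "real \<Rightarrow> (real \<Rightarrow> complex) \<Rightarrow> real" where
  "orbit_gap \<zeta> v = (h1 L v)\<^sup>2 - 2 * \<bar>\<zeta>\<bar> * cmod (\<integral>x. v x \<partial>M) + L * \<zeta>\<^sup>2"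

lemma h1_phase_sub_const_sq:
  assumes v: "v \<in> H1 L" and c: "cmod c = 1"
  shows "(h1 L (\<lambda>x. c * v x - of_real \<zeta>))\<^sup>2 = (h1 L v)\<^sup>2 - 2 * \<zeta> * Re (c * (\<integral>x. v x \<partial>M)) + L * \<zeta>\<^sup>2"
proof -
  obtain g where g: "has_wderiv L v g" using v by (auto simp: H1_iff)
  have w: "has_wderiv L (\<lambda>x. c * v x - of_real \<zeta>) (\<lambda>x. c * g x)"
    using wderiv_diff[OF wderiv_cmult[OF g] wderiv_const] by simp
  have k: "(\<lambda>_. - complex_of_real \<zeta>) \<in> L2 M" by (intro continuous_L2 continuous_intros)
  have "(nrm (\<lambda>x. c * v x - of_real \<zeta>))\<^sup>2 = (nrm v)\<^sup>2 - 2 * \<zeta> * Re (c * (\<integral>x. v x \<partial>M)) + L * \<zeta>\<^sup>2"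
    using norm2_add_sq[OF L2_cmult[OF wderiv_L2[OF g]] k, of c] c L_pos
    by (simp add: norm2_cmult norm2_const power_mult_distrib)
  then show ?thesis
    unfolding h1_sq_eq[OF w] h1_sq_eq[OF g] norm2_cmult c by simp
qed

text \<open>
  Rotating \<open>v\<close> so that its mean gets the sign of \<open>\<zeta>\<close> gives the nearest point of the orbit, and
  removes the mean of the imaginary part of the perturbation.
\<close>

lemma optimal_phase:
  assumes v: "v \<in> H1 L" and \<zeta>: "\<zeta> \<noteq> 0"
  obtains c where "cmod c = 1" "(\<integral>x. Im (c * v x - of_real \<zeta>) \<partial>M) = 0"
    "(h1 L (\<lambda>x. c * v x - of_real \<zeta>))\<^sup>2 = orbit_gap \<zeta> v"
proof -
  define I where "I = (\<integral>x. v x \<partial>M)"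
  define c where "c = (if I = 0 then 1 else of_real (sgn \<zeta>) * cnj (sgn I))"
  have c1: "cmod c = 1" using \<zeta> by (simp add: c_def norm_mult norm_sgn)
  have cI: "c * I = of_real (sgn \<zeta> * cmod I)"
  proof (cases "I = 0")
    case False
    have "cnj (sgn I) * I = of_real (cmod I)"
      using False by (simp add: sgn_eq mult.commute complex_norm_square[symmetric] power2_eq_square)
    then show ?thesis using False by (simp add: c_def mult.assoc)
  qed simp
  obtain g where g: "has_wderiv L v g" using v by (auto simp: H1_iff)
  have i: "integrable M (\<lambda>x. c * v x - of_real \<zeta>)" "integrable M v"
    by (intro continuous_integrable continuous_intros wderiv_continuous[OF g])+
  have "(\<integral>x. Im (c * v x - of_real \<zeta>) \<partial>M) = Im (\<integral>x. c * v x - of_real \<zeta> \<partial>M)"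
    by (rule integral_Im[OF i(1)])
  also have "\<dots> = Im (c * I - of_real (L * \<zeta>))"
    using i(2) by (simp add: I_def scaleR_conv_of_real)
  finally have "(\<integral>x. Im (c * v x - of_real \<zeta>) \<partial>M) = 0" by (simp add: cI)
  moreover have "\<zeta> * Re (c * I) = \<bar>\<zeta>\<bar> * cmod I"
    unfolding cI by (simp add: abs_sgn mult.assoc)
  then have "(h1 L (\<lambda>x. c * v x - of_real \<zeta>))\<^sup>2 = orbit_gap \<zeta> v"
    unfolding h1_phase_sub_const_sq[OF v c1] orbit_gap_def I_def[symmetric] by (simp add: mult.assoc)
  ultimately show ?thesis using that c1 by blast
qed

lemma orbit_gap_le:
  assumes v: "v \<in> H1 L"
  shows "orbit_gap \<zeta> v \<le> (h1 L (\<lambda>x. v x - of_real \<zeta>))\<^sup>2"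
proof -
  have "\<zeta> * Re (\<integral>x. v x \<partial>M) \<le> \<bar>\<zeta>\<bar> * cmod (\<integral>x. v x \<partial>M)"
  proof -
    have "\<zeta> * Re (\<integral>x. v x \<partial>M) \<le> \<bar>\<zeta>\<bar> * \<bar>Re (\<integral>x. v x \<partial>M)\<bar>" by (simp flip: abs_mult)
    also have "\<dots> \<le> \<bar>\<zeta>\<bar> * cmod (\<integral>x. v x \<partial>M)" by (intro mult_left_mono abs_Re_le_cmod) simp
    finally show ?thesis .
  qed
  then show ?thesis using h1_phase_sub_const_sq[OF v, of 1 \<zeta>] by (simp add: orbit_gap_def mult.assoc)
qed

lemma const_H1: "(\<lambda>_. c) \<in> H1 L"
  using wderiv_const by (auto simp: H1_iff)

lemma nearest_orbit_point:
  assumes v: "v \<in> phase_space L" and \<zeta>: "\<zeta>1 \<noteq> 0" "\<zeta>2 \<noteq> 0"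
  obtains w1 w2 g where "w1 \<in> H1 L" "w2 \<in> H1 L" "(\<integral>x. Im (w1 x) \<partial>M) = 0" "(\<integral>x. Im (w2 x) \<partial>M) = 0"
    "(perturbation_size w1 w2)\<^sup>2 = orbit_gap \<zeta>1 (fst v) + orbit_gap \<zeta>2 (snd v)"
    "distE L v (act g (const_state \<zeta>1 \<zeta>2)) = perturbation_size w1 w2"
    "Lyapunov \<beta> k \<alpha> \<gamma> \<delta> \<zeta>1 \<zeta>2 (perturbed \<zeta>1 w1, perturbed \<zeta>2 w2)
      = Lyapunov \<beta> k \<alpha> \<gamma> \<delta> \<zeta>1 \<zeta>2 v"
    "mass_excess \<zeta>1 (perturbed \<zeta>1 w1) = mass_excess \<zeta>1 (fst v)"
    "mass_excess \<zeta>2 (perturbed \<zeta>2 w2) = mass_excess \<zeta>2 (snd v)"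
proof -
  have v12: "fst v \<in> H1 L" "snd v \<in> H1 L" using v by (auto simp: phase_space_def)
  obtain c where c: "cmod c = 1" "(\<integral>x. Im (c * fst v x - of_real \<zeta>1) \<partial>M) = 0"
    "(h1 L (\<lambda>x. c * fst v x - of_real \<zeta>1))\<^sup>2 = orbit_gap \<zeta>1 (fst v)"
    using optimal_phase[OF v12(1) \<zeta>(1)] by blast
  obtain d where d: "cmod d = 1" "(\<integral>x. Im (d * snd v x - of_real \<zeta>2) \<partial>M) = 0"
    "(h1 L (\<lambda>x. d * snd v x - of_real \<zeta>2))\<^sup>2 = orbit_gap \<zeta>2 (snd v)"
    using optimal_phase[OF v12(2) \<zeta>(2)] by blast
  define w1 w2 where "w1 = (\<lambda>x. c * fst v x - of_real \<zeta>1)" and "w2 = (\<lambda>x. d * snd v x - of_real \<zeta>2)"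
  have w: "w1 \<in> H1 L" "w2 \<in> H1 L"
    unfolding w1_def w2_def by (intro H1_diff phase_H1 v12 const_H1)+
  have unit: "exp (- \<i> * of_real (Arg e)) = cnj e" "cnj e * e = 1" if "cmod e = 1" for e
  proof -
    have "e = exp (\<i> * of_real (Arg e))" using Arg_eq[of e] that by force
    then have "cnj e = cnj (exp (\<i> * of_real (Arg e)))" by simp
    then show "exp (- \<i> * of_real (Arg e)) = cnj e" by (simp add: exp_cnj)
    show "cnj e * e = 1" using that by (simp add: mult.commute complex_norm_square[symmetric])
  qed
  have dist: "h1 L (\<lambda>x. f x - cnj e * z) = h1 L (\<lambda>x. e * f x - z)"
    if f: "f \<in> H1 L" and e: "cmod e = 1" for f e z
  proof -
    have "cnj e * (e * y) = y" for y by (simp only: mult.assoc[symmetric] unit(2)[OF e] mult_1_left)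
    then have eq: "(\<lambda>x. f x - cnj e * z) = (\<lambda>x. cnj e * (e * f x - z))" by (simp only: right_diff_distrib)
    have "(\<lambda>x. e * f x - z) \<in> H1 L" by (intro H1_diff phase_H1 f const_H1)
    then show ?thesis unfolding eq using h1_cmult[of "\<lambda>x. e * f x - z" _ "cnj e"] e by (auto simp: H1_iff)
  qed
  have eqs: "(perturbed \<zeta>1 w1) = (\<lambda>x. c * fst v x)" "(perturbed \<zeta>2 w2) = (\<lambda>x. d * snd v x)"
    by (auto simp: w1_def w2_def)
  show ?thesis
  proof (rule that[of w1 w2 "(Arg c, Arg d)"])
    show "(perturbation_size w1 w2)\<^sup>2 = orbit_gap \<zeta>1 (fst v) + orbit_gap \<zeta>2 (snd v)"
      unfolding perturbation_size_sq w1_def w2_def c(3) d(3) ..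
    show "distE L v (act (Arg c, Arg d) (const_state \<zeta>1 \<zeta>2)) = perturbation_size w1 w2"
      using dist[OF v12(1) c(1)] dist[OF v12(2) d(1)] unit(1)[OF c(1)] unit(1)[OF d(1)]
      by (simp add: distE_eq act_def const_state_def perturbation_size_def w1_def w2_def)
    show "Lyapunov \<beta> k \<alpha> \<gamma> \<delta> \<zeta>1 \<zeta>2 (perturbed \<zeta>1 w1, perturbed \<zeta>2 w2)
      = Lyapunov \<beta> k \<alpha> \<gamma> \<delta> \<zeta>1 \<zeta>2 v"
      unfolding eqs by (rule Lyapunov_phase[OF v c(1) d(1)])
    show "mass_excess \<zeta>1 (perturbed \<zeta>1 w1) = mass_excess \<zeta>1 (fst v)"
      "mass_excess \<zeta>2 (perturbed \<zeta>2 w2) = mass_excess \<zeta>2 (snd v)"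
      unfolding eqs mass_excess_def norm2_cmult c(1) d(1) by simp_all
  qed (use w c(2) d(2) in \<open>auto simp: w1_def w2_def\<close>)
qed

section \<open>Stability\<close>

lemma tendsto_of_increment_bound:
  fixes f :: "'a \<Rightarrow> 'b::real_normed_vector"
  assumes bound: "\<And>s. norm (f s - l) \<le> C * E s" and E: "(E \<longlongrightarrow> 0) F"
  shows "(f \<longlongrightarrow> l) F"
proof -
  have "((\<lambda>s. C * E s) \<longlongrightarrow> 0) F" using tendsto_mult_left[OF E, of C] by simp
  then have "((\<lambda>s. f s - l) \<longlongrightarrow> 0) F"
    by (rule Lim_null_comparison[rotated]) (use bound in simp)
  then show ?thesis by (simp only: Lim_null[of _ l])
qed

lemma orbit_gap_continuous:
  fixes a :: "real \<Rightarrow> real \<Rightarrow> complex" and E :: "real \<Rightarrow> real \<Rightarrow> real"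
  assumes H: "\<And>t. a t \<in> H1 L" and E: "\<And>t. ((\<lambda>s. E s t) \<longlongrightarrow> 0) (at t)"
    and le: "\<And>s t. h1 L (\<lambda>x. a s x - a t x) \<le> E s t"
  shows "continuous_on UNIV (\<lambda>t. orbit_gap \<zeta> (a t))"
proof -
  have h: "((\<lambda>s. h1 L (a s)) \<longlongrightarrow> h1 L (a t)) (at t)" for t
  proof (rule tendsto_of_increment_bound[OF _ E, where C = 1])
    fix s
    show "norm (h1 L (a s) - h1 L (a t)) \<le> 1 * E s t"
      using h1_triangle[OF H1_diff[OF H H] H, of s t t] h1_triangle[OF H1_diff[OF H H] H, of t s s]
        h1_minus_commute[OF H H, of s t] le[of s t] by simp
  qed
  have i: "((\<lambda>s. \<integral>x. a s x \<partial>M) \<longlongrightarrow> (\<integral>x. a t x \<partial>M)) (at t)" for t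
  proof (rule tendsto_of_increment_bound[OF _ E, where C = "sqrt L"])
    fix s
    obtain g where g: "has_wderiv L (\<lambda>x. a s x - a t x) g" using H1_diff[OF H H] by (auto simp: H1_iff)
    have "integrable M (a r)" for r
      using H[of r] by (auto simp: H1_def intro: continuous_integrable)
    then have "norm ((\<integral>x. a s x \<partial>M) - (\<integral>x. a t x \<partial>M)) = cmod (\<integral>x. a s x - a t x \<partial>M)" by simp
    also have "\<dots> \<le> sqrt L * nrm (\<lambda>x. a s x - a t x)" by (rule integral_le_nrm[OF wderiv_L2[OF g]])
    also have "\<dots> \<le> sqrt L * E s t"
      using nrm_le_h1[OF g] le[of s t] L_pos by (intro mult_left_mono) auto
    finally show "norm ((\<integral>x. a s x \<partial>M) - (\<integral>x. a t x \<partial>M)) \<le> sqrt L * E s t" .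
  qed
  have "((\<lambda>s. orbit_gap \<zeta> (a s)) \<longlongrightarrow> orbit_gap \<zeta> (a t)) (at t)" for t
    unfolding orbit_gap_def by (intro tendsto_intros h i)
  then show ?thesis by (simp add: continuous_on_eq_continuous_at isCont_def)
qed

text \<open>
  A continuity argument.  While the squared distance to the orbit is below the threshold of coercivity
  it is bounded by conserved quantities, which are small initially; hence it never attains the
  value \<open>e\<^sup>2\<close>, and by the intermediate value theorem it stays below.
\<close>

theorem solutions_stay_near_orbit:
  assumes \<beta>: "0 < \<beta>" and \<zeta>: "\<zeta>1 \<noteq> 0" "\<zeta>2 \<noteq> 0"
    and stable: "\<beta> * (2 * pi / L)\<^sup>2 + C_minus \<alpha> \<gamma> \<delta> \<zeta>1 \<zeta>2 > 4 * \<beta> * k\<^sup>2"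
    and \<epsilon>: "0 < \<epsilon>"
  obtains \<eta> where "0 < \<eta>"
    "\<And>u t. nls_solution L \<beta> k \<alpha> \<gamma> \<delta> u \<Longrightarrow> distE L (u 0) (const_state \<zeta>1 \<zeta>2) \<le> \<eta> \<Longrightarrow>
      orbit_gap \<zeta>1 (fst (u t)) + orbit_gap \<zeta>2 (snd (u t)) < \<epsilon>\<^sup>2"
proof -
  let ?\<Lambda> = "Lyapunov \<beta> k \<alpha> \<gamma> \<delta> \<zeta>1 \<zeta>2"
  obtain c K z0 where c: "0 < c" and K: "0 \<le> K" and z0: "0 < z0" and coercive:
    "\<And>w1 w2. w1 \<in> H1 L \<Longrightarrow> w2 \<in> H1 L \<Longrightarrow> (\<integral>x. Im (w1 x) \<partial>M) = 0 \<Longrightarrow> (\<integral>x. Im (w2 x) \<partial>M) = 0 \<Longrightarrow>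
      perturbation_size w1 w2 \<le> z0 \<Longrightarrow>
      c * (perturbation_size w1 w2)\<^sup>2 \<le> ?\<Lambda> (perturbed \<zeta>1 w1, perturbed \<zeta>2 w2)
        + K * ((mass_excess \<zeta>1 (perturbed \<zeta>1 w1))\<^sup>2 + (mass_excess \<zeta>2 (perturbed \<zeta>2 w2))\<^sup>2)"
    using Lyapunov_coercive[OF \<beta> \<zeta> stable] by metis
  obtain K' where K': "0 \<le> K'" and upper:
    "\<And>w1 w2. w1 \<in> H1 L \<Longrightarrow> w2 \<in> H1 L \<Longrightarrow> perturbation_size w1 w2 \<le> 1 \<Longrightarrow>
      ?\<Lambda> (perturbed \<zeta>1 w1, perturbed \<zeta>2 w2) \<le> K' * (perturbation_size w1 w2)\<^sup>2
      \<and> (mass_excess \<zeta>1 (perturbed \<zeta>1 w1))\<^sup>2 \<le> K' * (perturbation_size w1 w2)\<^sup>2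
      \<and> (mass_excess \<zeta>2 (perturbed \<zeta>2 w2))\<^sup>2 \<le> K' * (perturbation_size w1 w2)\<^sup>2"
    using Lyapunov_upper_bound[OF \<beta>] by metis
  define K2 where "K2 = K' + K * (2 * K')"
  have K2: "0 \<le> K2" using K K' by (simp add: K2_def)
  define e where "e = min \<epsilon> z0"
  have e: "0 < e" "e \<le> \<epsilon>" "e \<le> z0" using \<epsilon> z0 by (auto simp: e_def)
  \<comment> \<open>The second bound makes the conserved quantities smaller than what distance \<open>e\<close> would require.\<close>
  define \<eta> where "\<eta> = min (min 1 (e / 2)) (sqrt (c * e\<^sup>2 / (2 * (K2 + 1))))"
  have \<eta>: "0 < \<eta>" "\<eta> \<le> 1" "\<eta> < e" using e c K2 by (auto simp: \<eta>_def min_less_iff_disj)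
  have \<eta>_sq: "K2 * \<eta>\<^sup>2 < c * e\<^sup>2"
  proof -
    have "\<eta>\<^sup>2 \<le> (sqrt (c * e\<^sup>2 / (2 * (K2 + 1))))\<^sup>2" using \<eta>(1) by (intro power_mono) (auto simp: \<eta>_def)
    then have "\<eta>\<^sup>2 \<le> c * e\<^sup>2 / (2 * (K2 + 1))" using c K2 by simp
    then have "\<eta>\<^sup>2 * (2 * (K2 + 1)) \<le> c * e\<^sup>2" using K2 by (simp add: pos_le_divide_eq)
    moreover have "0 \<le> K2 * \<eta>\<^sup>2" "0 < \<eta>\<^sup>2" using K2 \<eta> by simp_all
    moreover have "\<eta>\<^sup>2 * (2 * (K2 + 1)) = 2 * (K2 * \<eta>\<^sup>2) + 2 * \<eta>\<^sup>2" by (simp add: algebra_simps)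
    ultimately show ?thesis by linarith
  qed
  show ?thesis
  proof (rule that[OF \<eta>(1)])
    fix u t assume sol: "nls_solution L \<beta> k \<alpha> \<gamma> \<delta> u" and init: "distE L (u 0) (const_state \<zeta>1 \<zeta>2) \<le> \<eta>"
    have ps: "u t \<in> phase_space L" for t using sol by (simp add: nls_solution_def)
    have H: "fst (u t) \<in> H1 L" "snd (u t) \<in> H1 L" for t using ps[of t] by (auto simp: phase_space_def)
    define y where "y t = orbit_gap \<zeta>1 (fst (u t)) + orbit_gap \<zeta>2 (snd (u t))" for t
    define V where "V t = ?\<Lambda> (u t) + K * ((mass_excess \<zeta>1 (fst (u t)))\<^sup>2 + (mass_excess \<zeta>2 (snd (u t)))\<^sup>2)" for t
    have V: "V t = V 0" for t
      unfolding V_def Lyapunov_energy[OF ps] mass_excess_def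
      using energy_conservation[OF sol, of t] sol_mass[OF sol, of t] by simp
    define w1 w2 where "w1 = (\<lambda>x. fst (u 0) x - of_real \<zeta>1)" and "w2 = (\<lambda>x. snd (u 0) x - of_real \<zeta>2)"
    have w: "w1 \<in> H1 L" "w2 \<in> H1 L" unfolding w1_def w2_def by (intro H1_diff H const_H1)+
    have size: "perturbation_size w1 w2 = distE L (u 0) (const_state \<zeta>1 \<zeta>2)"
      by (simp add: perturbation_size_def distE_eq const_state_def w1_def w2_def)
    define z where "z = perturbation_size w1 w2"
    have "0 \<le> z" by (simp add: z_def perturbation_size_def)
    moreover have "z \<le> \<eta>" using init by (simp add: z_def size)
    ultimately have z: "0 \<le> z" "z \<le> \<eta>" "z \<le> 1" using \<eta> by simp_all
    have z_sq: "z\<^sup>2 \<le> \<eta>\<^sup>2" using z by (intro power_mono) auto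
    have "y 0 \<le> z\<^sup>2"
      using orbit_gap_le[OF H(1), of \<zeta>1 0] orbit_gap_le[OF H(2), of \<zeta>2 0]
      by (simp add: y_def z_def perturbation_size_sq w1_def w2_def)
    moreover have "\<eta>\<^sup>2 < e\<^sup>2" using \<eta> by (intro power_strict_mono) auto
    ultimately have y0: "y 0 < e\<^sup>2" using z_sq by linarith
    have "V 0 \<le> K2 * z\<^sup>2"
    proof -
      have "(perturbed \<zeta>1 w1, perturbed \<zeta>2 w2) = u 0" "(perturbed \<zeta>1 w1) = fst (u 0)"
        "(perturbed \<zeta>2 w2) = snd (u 0)" by (auto simp: w1_def w2_def)
      then have "?\<Lambda> (u 0) \<le> K' * z\<^sup>2" "(mass_excess \<zeta>1 (fst (u 0)))\<^sup>2 \<le> K' * z\<^sup>2"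
        "(mass_excess \<zeta>2 (snd (u 0)))\<^sup>2 \<le> K' * z\<^sup>2"
        using upper[OF w] z(3) unfolding z_def[symmetric] by simp_all
      then have "V 0 \<le> K' * z\<^sup>2 + K * (K' * z\<^sup>2 + K' * z\<^sup>2)"
        unfolding V_def using K by (intro add_mono mult_left_mono) auto
      then show ?thesis by (simp add: K2_def algebra_simps)
    qed
    also have "\<dots> \<le> K2 * \<eta>\<^sup>2" using z_sq K2 by (rule mult_left_mono)
    finally have V0: "V 0 < c * e\<^sup>2" using \<eta>_sq by linarith
    have never: "y s \<noteq> e\<^sup>2" for s
    proof
      assume ys: "y s = e\<^sup>2"
      obtain v1 v2 g where v: "v1 \<in> H1 L" "v2 \<in> H1 L" "(\<integral>x. Im (v1 x) \<partial>M) = 0" "(\<integral>x. Im (v2 x) \<partial>M) = 0"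
        "(perturbation_size v1 v2)\<^sup>2 = y s"
        "distE L (u s) (act g (const_state \<zeta>1 \<zeta>2)) = perturbation_size v1 v2"
        "?\<Lambda> (perturbed \<zeta>1 v1, perturbed \<zeta>2 v2) = ?\<Lambda> (u s)"
        "mass_excess \<zeta>1 (perturbed \<zeta>1 v1) = mass_excess \<zeta>1 (fst (u s))"
        "mass_excess \<zeta>2 (perturbed \<zeta>2 v2) = mass_excess \<zeta>2 (snd (u s))"
        unfolding y_def by (rule nearest_orbit_point[OF ps[of s] \<zeta>])
      have "perturbation_size v1 v2 = e"
        by (rule power2_eq_imp_eq) (use v(5) ys e(1) in \<open>simp_all add: perturbation_size_def\<close>)
      then have "c * e\<^sup>2 \<le> V s"
        using coercive[OF v(1-4)] e(3) unfolding v(7-9) V_def by simp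
      then show False using V[of s] V0 by linarith
    qed
    have "continuous_on UNIV y"
      unfolding y_def
      using path_dist_bounds(1,2)[OF sol] by (intro continuous_on_add orbit_gap_continuous[OF _ path_dist_tendsto[OF sol]] H)
    then have "connected (range y)" by (rule connected_continuous_image) simp
    then have "{y 0..y t} \<subseteq> range y" by (rule connected_contains_Icc) auto
    moreover have "e\<^sup>2 \<notin> range y" using never by (metis rangeE)
    ultimately have "e\<^sup>2 \<notin> {y 0..y t}" by blast
    then have "y t < e\<^sup>2" using y0 by simp
    also have "\<dots> \<le> \<epsilon>\<^sup>2" using e by (intro power_mono) auto
    finally show "orbit_gap \<zeta>1 (fst (u t)) + orbit_gap \<zeta>2 (snd (u t)) < \<epsilon>\<^sup>2" by (simp add: y_def)
  qed
qed

lemma h1_const: "h1 L (\<lambda>_. c) = sqrt L * cmod c"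
  using L_pos by (simp add: h1_eq[OF wderiv_const] norm2_const norm2_def[of _ "\<lambda>_. 0"])

text \<open>
  The angular velocities are the components of \<open>\<xi>\<close>: on constants the equations reduce to
  multiplication by \<open>\<xi>\<close>.
\<close>

lemma rotating_constant_solution:
  "nls_solution L \<beta> k \<alpha> \<gamma> \<delta> (\<lambda>t. act
    ((\<beta> * k\<^sup>2 - (\<alpha> * \<zeta>1\<^sup>2 + \<delta> * \<zeta>2\<^sup>2)) * t, (\<beta> * k\<^sup>2 - (\<delta> * \<zeta>1\<^sup>2 + \<gamma> * \<zeta>2\<^sup>2)) * t) (const_state \<zeta>1 \<zeta>2))"
proof -
  define \<xi>1 \<xi>2 where "\<xi>1 = \<beta> * k\<^sup>2 - (\<alpha> * \<zeta>1\<^sup>2 + \<delta> * \<zeta>2\<^sup>2)" and "\<xi>2 = \<beta> * k\<^sup>2 - (\<delta> * \<zeta>1\<^sup>2 + \<gamma> * \<zeta>2\<^sup>2)"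
  define p where "p \<xi> \<zeta> t = exp (- \<i> * of_real (\<xi> * t)) * complex_of_real \<zeta>" for \<xi> \<zeta> t
  have p_norm: "cmod (p \<xi> \<zeta> t) = \<bar>\<zeta>\<bar>" for \<xi> \<zeta> t
    by (simp add: p_def norm_mult)
  have p_deriv: "(p \<xi> \<zeta> has_vector_derivative - \<i> * of_real \<xi> * p \<xi> \<zeta> t) (at t)" for \<xi> \<zeta> t
  proof -
    have "((\<lambda>t. exp (- \<i> * of_real \<xi> * of_real t) * complex_of_real \<zeta>) has_vector_derivative
        - \<i> * of_real \<xi> * (exp (- \<i> * of_real \<xi> * of_real t) * complex_of_real \<zeta>)) (at t)"
      by (rule has_vector_derivative_real_field) (auto intro!: derivative_eq_intros)
    then show ?thesis by (simp add: p_def[abs_def] mult.assoc)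
  qed
  have act: "act (\<xi>1 * t, \<xi>2 * t) (const_state \<zeta>1 \<zeta>2) = (\<lambda>_. p \<xi>1 \<zeta>1 t, \<lambda>_. p \<xi>2 \<zeta>2 t)" for t
    by (simp add: act_def const_state_def p_def)
  have "nls_solution L \<beta> k \<alpha> \<gamma> \<delta> (\<lambda>t. (\<lambda>_. p \<xi>1 \<zeta>1 t, \<lambda>_. p \<xi>2 \<zeta>2 t))"
    unfolding nls_solution_def
  proof (intro conjI allI impI)
    show "(\<lambda>_. p \<xi>1 \<zeta>1 t, \<lambda>_. p \<xi>2 \<zeta>2 t) \<in> phase_space L" for t
      by (simp add: phase_space_def const_H1)
    show "((\<lambda>s. distE L (\<lambda>_. p \<xi>1 \<zeta>1 s, \<lambda>_. p \<xi>2 \<zeta>2 s) (\<lambda>_. p \<xi>1 \<zeta>1 t, \<lambda>_. p \<xi>2 \<zeta>2 t)) \<longlongrightarrow> 0) (at t)" for t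
    proof -
      have lim: "(p \<xi> \<zeta> \<longlongrightarrow> p \<xi> \<zeta> t) (at t)" for \<xi> \<zeta>
        using has_vector_derivative_continuous[OF p_deriv[of \<xi> \<zeta> t]] by (simp add: isCont_def)
      have "((\<lambda>s. sqrt ((sqrt L * cmod (p \<xi>1 \<zeta>1 s - p \<xi>1 \<zeta>1 t))\<^sup>2 + (sqrt L * cmod (p \<xi>2 \<zeta>2 s - p \<xi>2 \<zeta>2 t))\<^sup>2)) \<longlongrightarrow>
          sqrt ((sqrt L * cmod (p \<xi>1 \<zeta>1 t - p \<xi>1 \<zeta>1 t))\<^sup>2 + (sqrt L * cmod (p \<xi>2 \<zeta>2 t - p \<xi>2 \<zeta>2 t))\<^sup>2)) (at t)"
        by (intro tendsto_intros lim)
      then show ?thesis by (simp add: distE_eq h1_const)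
    qed
    fix \<phi> t assume \<phi>: "torus_test L \<phi>"
    have z: "(\<integral>x. \<phi> 1 x \<partial>M) = 0" "(\<integral>x. \<phi> 2 x \<partial>M) = 0"
      using integral_test_deriv[OF \<phi>, of 0] integral_test_deriv[OF \<phi>, of 1] by (simp_all add: numeral_2_eq_2)
    define J where "J = (\<integral>x. \<phi> 0 x \<partial>M)"
    have d: "((\<lambda>s. p \<xi> \<zeta> s * J) has_vector_derivative - \<i> * of_real \<xi> * p \<xi> \<zeta> t * J) (at t)" for \<xi> \<zeta>
      by (rule has_vector_derivative_mult_left[OF p_deriv])
    show "let u1 = fst (\<lambda>_. p \<xi>1 \<zeta>1 t, \<lambda>_. p \<xi>2 \<zeta>2 t); u2 = snd (\<lambda>_. p \<xi>1 \<zeta>1 t, \<lambda>_. p \<xi>2 \<zeta>2 t)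
      in \<exists>d1 d2.
         ((\<lambda>s. pairing L (fst (\<lambda>_. p \<xi>1 \<zeta>1 s, \<lambda>_. p \<xi>2 \<zeta>2 s)) (\<phi> 0)) has_vector_derivative d1) (at t) \<and>
         ((\<lambda>s. pairing L (snd (\<lambda>_. p \<xi>1 \<zeta>1 s, \<lambda>_. p \<xi>2 \<zeta>2 s)) (\<phi> 0)) has_vector_derivative d2) (at t) \<and>
          \<i> * d1 + of_real \<beta> * pairing L u1 (\<phi> 2)
            - 2 * of_real \<beta> * \<i> * of_real k * pairing L u1 (\<phi> 1)
            + pairing L (\<lambda>x. of_real (\<alpha> * (cmod (u1 x))\<^sup>2 + \<delta> * (cmod (u2 x))\<^sup>2) * u1 x) (\<phi> 0)
            - of_real (\<beta> * k\<^sup>2) * pairing L u1 (\<phi> 0) = 0 \<and>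
          \<i> * d2 + of_real \<beta> * pairing L u2 (\<phi> 2)
            + 2 * of_real \<beta> * \<i> * of_real k * pairing L u2 (\<phi> 1)
            + pairing L (\<lambda>x. of_real (\<delta> * (cmod (u1 x))\<^sup>2 + \<gamma> * (cmod (u2 x))\<^sup>2) * u2 x) (\<phi> 0)
            - of_real (\<beta> * k\<^sup>2) * pairing L u2 (\<phi> 0) = 0"
      unfolding Let_def fst_conv snd_conv pairing_eq integral_mult_right_zero z J_def[symmetric] p_norm power2_abs
      by (intro exI[of _ "- \<i> * of_real \<xi>1 * p \<xi>1 \<zeta>1 t * J"] exI[of _ "- \<i> * of_real \<xi>2 * p \<xi>2 \<zeta>2 t * J"] conjI d)
        (simp_all add: \<xi>1_def \<xi>2_def algebra_simps)
  qed
  then show ?thesis unfolding act[symmetric] by (simp add: \<xi>1_def \<xi>2_def)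
qed

end

theorem proposition8p5:
  fixes L \<beta> k \<zeta>1 \<zeta>2 \<alpha> \<gamma> \<delta> :: real
  assumes "L > 0" and "\<beta> > 0"
    and "\<exists>m::int. k = 2 * pi / L * of_int m"
    and "\<zeta>1 \<noteq> 0" and "\<zeta>2 \<noteq> 0" and "\<delta> \<noteq> 0"
    and "\<alpha> * \<gamma> \<noteq> \<delta>\<^sup>2"
    and "\<beta> * (2 * pi / L)\<^sup>2 + C_minus \<alpha> \<gamma> \<delta> \<zeta>1 \<zeta>2 > 4 * \<beta> * k\<^sup>2"
  defines "u\<xi> \<equiv> const_state \<zeta>1 \<zeta>2"
  defines "G\<mu> \<equiv> coadjoint_stabilizer (momentum L u\<xi>)"
  defines "sol \<equiv> {u. nls_solution L \<beta> k \<alpha> \<gamma> \<delta> u}"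
  shows "relative_equilibrium L sol G\<mu> u\<xi> \<and> orbitally_stable L sol G\<mu> u\<xi>"
proof -
  interpret torus L by unfold_locales fact
  have G: "G\<mu> = UNIV" by (simp add: G\<mu>_def coadjoint_stabilizer_eq_UNIV)
  note near = solutions_stay_near_orbit[OF assms(2,4,5,8)]
  have u\<xi>: "u\<xi> \<in> phase_space L"
    by (simp add: u\<xi>_def const_state_def phase_space_def const_H1)
  have "relative_equilibrium L sol G\<mu> u\<xi>"
    unfolding relative_equilibrium_def
  proof (intro conjI ballI impI allI)
    show "\<exists>s\<in>sol. s 0 = u\<xi>"
      by (rule bexI[where x = "\<lambda>t. act ((\<beta> * k\<^sup>2 - (\<alpha> * \<zeta>1\<^sup>2 + \<delta> * \<zeta>2\<^sup>2)) * t,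
            (\<beta> * k\<^sup>2 - (\<delta> * \<zeta>1\<^sup>2 + \<gamma> * \<zeta>2\<^sup>2)) * t) (const_state \<zeta>1 \<zeta>2)"])
        (simp_all add: sol_def rotating_constant_solution, simp add: act_def u\<xi>_def)
  next
    fix s t assume s: "s \<in> sol" "s 0 = u\<xi>"
    have ps: "s t \<in> phase_space L" using s by (simp add: sol_def nls_solution_def)
    have d0: "distE L (s 0) (const_state \<zeta>1 \<zeta>2) = 0"
      using s(2) by (simp add: distE_eq u\<xi>_def h1_const)
    have gap: "orbit_gap \<zeta>1 (fst (s t)) + orbit_gap \<zeta>2 (snd (s t)) < \<epsilon>\<^sup>2" if \<epsilon>: "0 < \<epsilon>" for \<epsilon>
    proof -
      obtain \<eta> where "0 < \<eta>" "\<And>u t. nls_solution L \<beta> k \<alpha> \<gamma> \<delta> u \<Longrightarrow> distE L (u 0) (const_state \<zeta>1 \<zeta>2) \<le> \<eta> \<Longrightarrow>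
          orbit_gap \<zeta>1 (fst (u t)) + orbit_gap \<zeta>2 (snd (u t)) < \<epsilon>\<^sup>2"
        using near[OF \<epsilon>] by metis
      then show ?thesis using s d0 by (simp add: sol_def)
    qed
    obtain w1 w2 g where w: "(perturbation_size w1 w2)\<^sup>2 = orbit_gap \<zeta>1 (fst (s t)) + orbit_gap \<zeta>2 (snd (s t))"
      "distE L (s t) (act g u\<xi>) = perturbation_size w1 w2"
      using nearest_orbit_point[OF ps assms(4,5)] unfolding u\<xi>_def by metis
    have "perturbation_size w1 w2 = 0"
    proof (rule ccontr)
      assume "perturbation_size w1 w2 \<noteq> 0"
      then have "0 < perturbation_size w1 w2" by (simp add: perturbation_size_def less_le)
      from gap[OF this] w(1) show False by simp
    qed
    then have "distE L (s t) (act g u\<xi>) = 0" using w(2) by simp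
    then have h0: "h1 L (\<lambda>x. fst (s t) x - fst (act g u\<xi>) x) = 0" "h1 L (\<lambda>x. snd (s t) x - snd (act g u\<xi>) x) = 0"
      using h1_le_distE[of "s t" "act g u\<xi>"] h1_nonneg[of "\<lambda>x. fst (s t) x - fst (act g u\<xi>) x"]
        h1_nonneg[of "\<lambda>x. snd (s t) x - snd (act g u\<xi>) x"] by linarith+
    have a: "fst (act g u\<xi>) \<in> H1 L" "snd (act g u\<xi>) \<in> H1 L"
      by (simp_all add: act_def u\<xi>_def const_state_def const_H1)
    have p: "fst (s t) \<in> H1 L" "snd (s t) \<in> H1 L" using ps by (auto simp: phase_space_def)
    have "fst (s t) x = fst (act g u\<xi>) x" "snd (s t) x = snd (act g u\<xi>) x" for x
      using Sobolev[OF H1_diff[OF p(1) a(1)], of x] Sobolev[OF H1_diff[OF p(2) a(2)], of x] h0 by simp_all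
    then have "s t = act g u\<xi>" by (intro prod_eqI ext)
    then show "s t \<in> group_orbit G\<mu> u\<xi>" by (simp add: group_orbit_def G)
  qed (rule u\<xi>)
  moreover have "orbitally_stable L sol G\<mu> u\<xi>"
    unfolding orbitally_stable_def
  proof (intro allI impI)
    fix \<epsilon> :: real assume \<epsilon>: "0 < \<epsilon>"
    obtain \<eta> where \<eta>: "0 < \<eta>" "\<And>u t. nls_solution L \<beta> k \<alpha> \<gamma> \<delta> u \<Longrightarrow> distE L (u 0) (const_state \<zeta>1 \<zeta>2) \<le> \<eta> \<Longrightarrow>
        orbit_gap \<zeta>1 (fst (u t)) + orbit_gap \<zeta>2 (snd (u t)) < \<epsilon>\<^sup>2"
      using near[OF \<epsilon>] by metis
    have "dist_set L (s t) (group_orbit G\<mu> u\<xi>) \<le> \<epsilon>"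
      if s: "s \<in> sol" "distE L (s 0) u\<xi> \<le> \<eta>" for s t
    proof -
      have ps: "s t \<in> phase_space L" using s by (simp add: sol_def nls_solution_def)
      obtain w1 w2 g where w: "(perturbation_size w1 w2)\<^sup>2 = orbit_gap \<zeta>1 (fst (s t)) + orbit_gap \<zeta>2 (snd (s t))"
        "distE L (s t) (act g u\<xi>) = perturbation_size w1 w2"
        using nearest_orbit_point[OF ps assms(4,5)] unfolding u\<xi>_def by metis
      have "(distE L (s t) (act g u\<xi>))\<^sup>2 < \<epsilon>\<^sup>2"
        using \<eta>(2)[of s t] s unfolding w(2) w(1) by (simp add: sol_def u\<xi>_def)
      then have "distE L (s t) (act g u\<xi>) \<le> \<epsilon>"
        using \<epsilon> by (simp add: power2_less_imp_less less_imp_le)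
      moreover have "dist_set L (s t) (group_orbit G\<mu> u\<xi>) \<le> distE L (s t) (act g u\<xi>)"
        unfolding dist_set_def
      proof (rule cINF_lower)
        show "bdd_below (distE L (s t) ` group_orbit G\<mu> u\<xi>)"
          by (rule bdd_belowI[of _ 0]) (auto simp: distE_eq)
        show "act g u\<xi> \<in> group_orbit G\<mu> u\<xi>" by (simp add: group_orbit_def G)
      qed
      ultimately show ?thesis by linarith
    qed
    then show "\<exists>\<eta>>0. \<forall>v\<in>phase_space L. distE L v u\<xi> \<le> \<eta> \<longrightarrow>
        (\<forall>s\<in>sol. s 0 = v \<longrightarrow> (\<forall>t. dist_set L (s t) (group_orbit G\<mu> u\<xi>) \<le> \<epsilon>))"
      using \<eta>(1) by blast
  qed
  ultimately show ?thesis ..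
qed

end
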